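(* Let $d\ge1$ and let $\lambda\in\mathbb{R}\setminus\{0\}$. Let $E,\Omega$ be measurable subsets of $\mathbb{C}^d$ of positive and finite Lebesgue measure, and let $u$ be the solution of $$i\partial_t u(z,t)=L_\lambda u(z,t)\ \ ((z,t)\in\mathbb{C}^d\times(0,\infty)),\qquad u(z,0)=u_0(z),$$ for some $u_0\in L^2(\mathbb{C}^d)$. If there exists $t\in(0,\infty)$ such that $\lambda t\in\mathbb{R}\setminus\pi\mathbb{Z}$ and the supports of $u_0$ and $u(\cdot,t)$ are contained in $E$ and $\Omega$, respectively, then $u$ vanishes identically.
   Context: For $\lambda\in\mathbb{R}\setminus\{0\}$ the special Hermite operator on $\mathbb{C}^d$ is $$L_\lambda=-\Delta_{\mathbb{C}^d}+\frac14\lambda^2\|z\|^2-i\lambda\sum_{j=1}^d\left(x_j\frac{\partial}{\partial y_j}-y_j\frac{\partial}{\partial x_j}\right),$$ where $z=(x_1+iy_1,\dots,x_d+iy_d)\in\mathbb{C}^d$, $\|z\|$ is the Euclidean norm, and $\Delta_{\mathbb{C}^d}=\sum_j(\partial_{x_j}^2+\partial_{y_j}^2)$ is the Laplacian on $\mathbb{C}^d\cong\mathbb{R}^{2d}$. It is understood as a self-adjoint operator on $L^2(\mathbb{C}^d)$ (the closure of its restriction to $C_c^\infty(\mathbb{C}^d)$). The solution of the initial value problem with data $u_0\in L^2(\mathbb{C}^d)$ is $u(\cdot,t)=e^{-itL_\lambda}u_0$, defined by the spectral theorem. Functions are elements of $L^2(\mathbb{C}^d)$, so supports and vanishing are understood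 up to null sets: the support of $g$ being contained in $S$ means $g=0$ a.e. on $\mathbb{C}^d\setminus S$, and $u$ vanishing identically means $u(\cdot,s)=0$ in $L^2(\mathbb{C}^d)$ for all $s\ge0$. *)

theory Defs
  imports "HOL-Analysis.Analysis"
begin

section \<open>The Hilbert space of square-integrable functions\<close>

text \<open>
  Elements of the Hilbert space are represented by Lebesgue measurable functions; operators on it
  respect equality almost everywhere. Unbounded operators are represented by
  their graphs. The inner product is linear in its first argument.
\<close>

definition L2 :: "('a::euclidean_space \<Rightarrow> complex) set" where
  "L2 = {f \<in> borel_measurable lebesgue. integrable lebesgue (\<lambda>z. (norm (f z))\<^sup>2)}"

definition L2_inner :: "('a::euclidean_space \<Rightarrow> complex) \<Rightarrow> ('a \<Rightarrow> complex) \<Rightarrow> complex" where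
  "L2_inner f g = (LINT z|lebesgue. f z * cnj (g z))"

definition L2_norm :: "('a::euclidean_space \<Rightarrow> complex) \<Rightarrow> real" where
  "L2_norm f = sqrt (LINT z|lebesgue. (norm (f z))\<^sup>2)"

definition ae_eq :: "('a::euclidean_space \<Rightarrow> complex) \<Rightarrow> ('a \<Rightarrow> complex) \<Rightarrow> bool" where
  "ae_eq f g \<longleftrightarrow> (AE z in lebesgue. f z = g z)"

type_synonym 'a L2_operator = "(('a \<Rightarrow> complex) \<times> ('a \<Rightarrow> complex)) set"

section \<open>Spectral measures and the functional calculus\<close>

definition orthogonal_projection ::
    "(('a::euclidean_space \<Rightarrow> complex) \<Rightarrow> ('a \<Rightarrow> complex)) \<Rightarrow> bool" where
  "orthogonal_projection Q \<longleftrightarrow>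
     (\<forall>f\<in>L2. Q f \<in> L2) \<and>
     (\<forall>f\<in>L2. \<forall>g\<in>L2. ae_eq f g \<longrightarrow> ae_eq (Q f) (Q g)) \<and>
     (\<forall>f\<in>L2. \<forall>g\<in>L2. \<forall>c. ae_eq (Q (\<lambda>z. c * f z + g z)) (\<lambda>z. c * Q f z + Q g z)) \<and>
     (\<forall>f\<in>L2. ae_eq (Q (Q f)) (Q f)) \<and>
     (\<forall>f\<in>L2. \<forall>g\<in>L2. L2_inner (Q f) g = L2_inner f (Q g))"

definition projection_valued_measure ::
    "(real set \<Rightarrow> ('a::euclidean_space \<Rightarrow> complex) \<Rightarrow> ('a \<Rightarrow> complex)) \<Rightarrow> bool" where
  "projection_valued_measure P \<longleftrightarrow>
     (\<forall>B\<in>sets borel. orthogonal_projection (P B)) \<and>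
     (\<forall>f\<in>L2. ae_eq (P {} f) (\<lambda>_. 0)) \<and>
     (\<forall>f\<in>L2. ae_eq (P UNIV f) f) \<and>
     (\<forall>B\<in>sets borel. \<forall>C\<in>sets borel. \<forall>f\<in>L2. ae_eq (P (B \<inter> C) f) (P B (P C f))) \<and>
     (\<forall>A::nat \<Rightarrow> real set. range A \<subseteq> sets borel \<longrightarrow> disjoint_family A \<longrightarrow>
        (\<forall>f\<in>L2. (\<lambda>n. L2_norm (\<lambda>z. (\<Sum>i<n. P (A i) f z) - P (\<Union>i. A i) f z))
           \<longlonglongrightarrow> 0))"

definition scalar_spectral_measure ::
    "(real set \<Rightarrow> ('a::euclidean_space \<Rightarrow> complex) \<Rightarrow> ('a \<Rightarrow> complex))
      \<Rightarrow> ('a \<Rightarrow> complex) \<Rightarrow> real measure" where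
  "scalar_spectral_measure P f =
     measure_of UNIV (sets borel) (\<lambda>B. ennreal (Re (L2_inner (P B f) f)))"

definition simple_spectral_integral ::
    "(real set \<Rightarrow> ('a::euclidean_space \<Rightarrow> complex) \<Rightarrow> ('a \<Rightarrow> complex))
      \<Rightarrow> (real \<Rightarrow> complex) \<Rightarrow> ('a \<Rightarrow> complex) \<Rightarrow> ('a \<Rightarrow> complex)" where
  "simple_spectral_integral P s f = (\<lambda>z. \<Sum>c\<in>range s. c * P (s -` {c}) f z)"

text \<open>
  The graph of the operator given by integrating \<open>\<phi>\<close> against \<open>P\<close>. Its domain consists of the
  \<open>f\<close> for which \<open>\<phi>\<close> is square-integrable with respect to the scalar measure of \<open>f\<close>, and its
  value is obtained by extending the integral of simple functions isometrically.
\<close>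

definition spectral_integral ::
    "(real set \<Rightarrow> ('a::euclidean_space \<Rightarrow> complex) \<Rightarrow> ('a \<Rightarrow> complex))
      \<Rightarrow> (real \<Rightarrow> complex) \<Rightarrow> 'a L2_operator" where
  "spectral_integral P \<phi> =
     {(f, g). f \<in> L2 \<and> g \<in> L2 \<and>
        integrable (scalar_spectral_measure P f) (\<lambda>x. (norm (\<phi> x))\<^sup>2) \<and>
        (\<exists>s::nat \<Rightarrow> real \<Rightarrow> complex. (\<forall>n. simple_function borel (s n)) \<and>
           (\<lambda>n. LINT x|scalar_spectral_measure P f. (norm (s n x - \<phi> x))\<^sup>2) \<longlonglongrightarrow> 0 \<and>
           (\<lambda>n. L2_norm (\<lambda>z. simple_spectral_integral P (s n) f z - g z)) \<longlonglongrightarrow> 0)}"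

definition spectral_resolution ::
    "(real set \<Rightarrow> ('a::euclidean_space \<Rightarrow> complex) \<Rightarrow> ('a \<Rightarrow> complex))
      \<Rightarrow> 'a L2_operator \<Rightarrow> bool" where
  "spectral_resolution P A \<longleftrightarrow>
     projection_valued_measure P \<and> A = spectral_integral P complex_of_real"

text \<open>
  The graph of \<open>\<phi>(A)\<close>. By the spectral theorem every self-adjoint \<open>A\<close> has a spectral
  resolution, unique up to equality almost everywhere of the values of the projections.
\<close>

definition functional_calculus ::
    "'a::euclidean_space L2_operator \<Rightarrow> (real \<Rightarrow> complex) \<Rightarrow> 'a L2_operator" where
  "functional_calculus A \<phi> =
     {(f, g). \<exists>P. spectral_resolution P A \<and> (f, g) \<in> spectral_integral P \<phi>}"

section \<open>The special Hermite operator\<close>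

definition dir_deriv ::
    "'a::euclidean_space \<Rightarrow> ('a \<Rightarrow> complex) \<Rightarrow> 'a \<Rightarrow> complex" where
  "dir_deriv v f z = frechet_derivative f (at z) v"

primrec C_k :: "nat \<Rightarrow> ('a::euclidean_space \<Rightarrow> complex) \<Rightarrow> bool" where
  "C_k 0 f \<longleftrightarrow> continuous_on UNIV f"
| "C_k (Suc k) f \<longleftrightarrow>
     (\<forall>z. f differentiable (at z)) \<and> (\<forall>b\<in>Basis. C_k k (dir_deriv b f))"

definition test_functions :: "('a::euclidean_space \<Rightarrow> complex) set" where
  "test_functions = {f. (\<forall>k. C_k k f) \<and> compact (closure {z. f z \<noteq> 0})}"

text \<open>The real coordinates of \<open>z\<close> are \<open>x\<^sub>j = Re (z $ j)\<close> and \<open>y\<^sub>j = Im (z $ j)\<close>.\<close>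

definition partial_x :: "'d::finite \<Rightarrow> (complex ^ 'd \<Rightarrow> complex) \<Rightarrow> complex ^ 'd \<Rightarrow> complex" where
  "partial_x j = dir_deriv (axis j 1)"

definition partial_y :: "'d::finite \<Rightarrow> (complex ^ 'd \<Rightarrow> complex) \<Rightarrow> complex ^ 'd \<Rightarrow> complex" where
  "partial_y j = dir_deriv (axis j \<i>)"

definition laplacian :: "(complex ^ 'd::finite \<Rightarrow> complex) \<Rightarrow> complex ^ 'd \<Rightarrow> complex" where
  "laplacian f z =
     (\<Sum>j\<in>UNIV. partial_x j (partial_x j f) z + partial_y j (partial_y j f) z)"

definition special_hermite_expr ::
    "real \<Rightarrow> (complex ^ 'd::finite \<Rightarrow> complex) \<Rightarrow> complex ^ 'd \<Rightarrow> complex" where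
  "special_hermite_expr lam f z =
     - laplacian f z + complex_of_real (1 / 4 * lam\<^sup>2 * (norm z)\<^sup>2) * f z
     - \<i> * complex_of_real lam *
         (\<Sum>j\<in>UNIV. complex_of_real (Re (z $ j)) * partial_y j f z
                 - complex_of_real (Im (z $ j)) * partial_x j f z)"

text \<open>The closure of the differential expression on test functions.\<close>

definition special_hermite :: "real \<Rightarrow> (complex ^ 'd::finite) L2_operator" where
  "special_hermite lam =
     {(f, g). f \<in> L2 \<and> g \<in> L2 \<and>
        (\<exists>\<psi>::nat \<Rightarrow> complex ^ 'd \<Rightarrow> complex. (\<forall>n. \<psi> n \<in> test_functions) \<and>
           (\<lambda>n. L2_norm (\<lambda>z. \<psi> n z - f z)) \<longlonglongrightarrow> 0 \<and>
           (\<lambda>n. L2_norm (\<lambda>z. special_hermite_expr lam (\<psi> n) z - g z)) \<longlonglongrightarrow> 0)}"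

text \<open>\<open>u(t) = exp(-i t L) u\<^sub>0\<close> for all \<open>t \<ge> 0\<close>.\<close>

definition schroedinger_solution ::
    "real \<Rightarrow> (complex ^ 'd::finite \<Rightarrow> complex) \<Rightarrow> (real \<Rightarrow> complex ^ 'd \<Rightarrow> complex) \<Rightarrow> bool" where
  "schroedinger_solution lam u0 u \<longleftrightarrow>
     (\<forall>t\<ge>0. (u0, u t) \<in>
        functional_calculus (special_hermite lam)
          (\<lambda>x. exp (- \<i> * complex_of_real t * complex_of_real x)))"

end

theory Submission
  imports Defs
begin

text \<open>
  The proof is an uncertainty argument in the manner of Amrein and Berthier. It rests on two
  properties of the unitary map \<open>U = exp (- i t L)\<close>, where \<open>L\<close> is the special Hermite operator and
  \<open>sin (lam * t)\<close> is nonzero. First, \<open>U\<close> is dispersive: it maps \<open>L1\<close> boundedly into the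
  bounded functions. Secondly, \<open>U\<close> commutes with the twisted translations, which shift a function by \<open>a\<close>
  and multiply it with a phase of modulus one, so that they shift the supports of \<open>f\<close> and \<open>U f\<close>
  simultaneously.

  Consider the pairs \<open>(f, U f)\<close> such that \<open>f\<close> is supported in \<open>S\<close> and \<open>U f\<close> in \<open>T\<close>. The dispersive estimate and
  Bessel's inequality bound the number of orthonormal pairs of this kind by a constant times the
  product of the measures of \<open>S\<close> and \<open>T\<close> (\<open>dimension_bound\<close>). Suppose that there is a nonzero pair, and among all
  \<open>S\<close> and \<open>T\<close> of measure below some \<open>A\<close> choose two for which the number is maximal. A small
  twisted translation enlarges the measures of the supports only a little, so by maximality it
  maps the space of these pairs into itself (\<open>small_translation_invariance\<close>). Iterating it moves a nonzero function
  to infinity while its support remains in a fixed set of finite measure, which is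
  impossible (\<open>translates_in_finite_measure_set_zero\<close>).

  The map \<open>U\<close> enters only through its effect on Gaussians. The Schroedinger evolution of a Gaussian is again a
  Gaussian, with a width given by an explicit solution of a Riccati equation that is regular
  for all times (\<open>flow_derivative\<close>). The pair formed by the solution at times \<open>0\<close> and \<open>t\<close> has the same pairings with an
  evolving Gaussian at times \<open>\<tau>\<close> and \<open>\<tau> + t\<close> (\<open>solution_pairing_flow\<close>), and these relations replace the
  equation for \<open>U\<close>. As the initial Gaussian concentrates at a point, its pairings
  become point evaluations in the mean (\<open>bump_approximate_identity\<close>), while the evolved Gaussian stays
  bounded by \<open>(|lam| / (4 |sin (lam * t)|)) ^ d\<close> (\<open>norm_flow_le\<close>); this is the dispersive estimate.

  The relations are derived from the spectral resolution. On the spectral subspace of a short interval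
  around \<open>c\<close> the operator is nearly the scalar \<open>c\<close>, so a classical solution evolves there nearly by the
  factor \<open>exp (- i c s)\<close>, and the errors over a partition of the line are summable
  (\<open>spectral_flow_pairing\<close>). This requires the Gaussians to lie in the domain of the closure of \<open>L\<close>, where
  they are approximated by test functions with the cutoff \<open>exp (- 1 / x)\<close> (\<open>special_hermite_wave\<close>).
\<close>

section \<open>Semidefinite Hermitian forms and Bessel's inequality\<close>

text \<open>
  Elements of a function space are functions rather than classes modulo null sets, so a form on them
  is only positive semidefinite. The lemmas of this locale are applied to the inner product of
  \<open>L2\<close>, to the forms \<open>(P B f, g)\<close> given by a spectral projection, and to
  pairs of square-integrable functions.
\<close>

locale semi_inner =
  fixes V :: "('x \<Rightarrow> complex) set" and B :: "('x \<Rightarrow> complex) \<Rightarrow> ('x \<Rightarrow> complex) \<Rightarrow> complex"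
  assumes zero_mem: "(\<lambda>_. 0) \<in> V"
    and lin_mem: "\<And>f g c. f \<in> V \<Longrightarrow> g \<in> V \<Longrightarrow> (\<lambda>x. c * f x + g x) \<in> V"
    and lin_left: "\<And>f g h c. f \<in> V \<Longrightarrow> g \<in> V \<Longrightarrow> h \<in> V \<Longrightarrow>
          B (\<lambda>x. c * f x + g x) h = c * B f h + B g h"
    and herm: "\<And>f g. f \<in> V \<Longrightarrow> g \<in> V \<Longrightarrow> B g f = cnj (B f g)"
    and nonneg: "\<And>f. f \<in> V \<Longrightarrow> 0 \<le> Re (B f f)"
begin

lemma zero_left [simp]: "h \<in> V \<Longrightarrow> B (\<lambda>_. 0) h = 0"
  using lin_left[of "\<lambda>_. 0" "\<lambda>_. 0" h 1] zero_mem by simp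

lemma add_mem: "f \<in> V \<Longrightarrow> g \<in> V \<Longrightarrow> (\<lambda>x. f x + g x) \<in> V"
  using lin_mem[of f g 1] by simp

lemma scale_mem: "f \<in> V \<Longrightarrow> (\<lambda>x. c * f x) \<in> V"
  using lin_mem[of f "\<lambda>_. 0" c] zero_mem by simp

lemma diff_mem: "f \<in> V \<Longrightarrow> g \<in> V \<Longrightarrow> (\<lambda>x. f x - g x) \<in> V"
  using lin_mem[of g f "-1"] by simp

lemma add_left: "f \<in> V \<Longrightarrow> g \<in> V \<Longrightarrow> h \<in> V \<Longrightarrow> B (\<lambda>x. f x + g x) h = B f h + B g h"
  using lin_left[of f g h 1] by simp

lemma scale_left: "f \<in> V \<Longrightarrow> h \<in> V \<Longrightarrow> B (\<lambda>x. c * f x) h = c * B f h"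
  using lin_left[of f "\<lambda>_. 0" h c] zero_mem by simp

lemma diff_left: "f \<in> V \<Longrightarrow> g \<in> V \<Longrightarrow> h \<in> V \<Longrightarrow> B (\<lambda>x. f x - g x) h = B f h - B g h"
  using lin_left[of g f h "-1"] by simp

lemma add_right: "f \<in> V \<Longrightarrow> g \<in> V \<Longrightarrow> h \<in> V \<Longrightarrow> B h (\<lambda>x. f x + g x) = B h f + B h g"
  using add_left[of f g h] by (simp add: herm[of _ h] add_mem)

lemma scale_right: "f \<in> V \<Longrightarrow> h \<in> V \<Longrightarrow> B h (\<lambda>x. c * f x) = cnj c * B h f"
  using scale_left[of f h c] by (simp add: herm[of _ h] scale_mem)

lemma diff_right: "f \<in> V \<Longrightarrow> g \<in> V \<Longrightarrow> h \<in> V \<Longrightarrow> B h (\<lambda>x. f x - g x) = B h f - B h g"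
  using diff_left[of f g h] by (simp add: herm[of _ h] diff_mem)

lemma sum_mem: "finite I \<Longrightarrow> (\<And>i. i \<in> I \<Longrightarrow> f i \<in> V) \<Longrightarrow> (\<lambda>x. \<Sum>i\<in>I. c i * f i x) \<in> V"
  by (induction I rule: finite_induct) (simp_all add: zero_mem lin_mem)

lemma sum_left: "finite I \<Longrightarrow> (\<And>i. i \<in> I \<Longrightarrow> f i \<in> V) \<Longrightarrow> h \<in> V \<Longrightarrow>
   B (\<lambda>x. \<Sum>i\<in>I. c i * f i x) h = (\<Sum>i\<in>I. c i * B (f i) h)"
  by (induction I rule: finite_induct) (simp_all add: lin_left sum_mem)

lemma lin_right: "f \<in> V \<Longrightarrow> g \<in> V \<Longrightarrow> h \<in> V \<Longrightarrow>
   B h (\<lambda>x. c * f x + g x) = cnj c * B h f + B h g"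
  by (simp add: add_right scale_right scale_mem)

lemma zero_right [simp]: "h \<in> V \<Longrightarrow> B h (\<lambda>_. 0) = 0"
  using herm[OF zero_mem, of h] by simp

lemma sum_right: "finite I \<Longrightarrow> (\<And>i. i \<in> I \<Longrightarrow> f i \<in> V) \<Longrightarrow> h \<in> V \<Longrightarrow>
   B h (\<lambda>x. \<Sum>i\<in>I. c i * f i x) = (\<Sum>i\<in>I. cnj (c i) * B h (f i))"
  by (induction I rule: finite_induct) (simp_all add: lin_right sum_mem)

lemma sum_mem_plain: "finite I \<Longrightarrow> (\<And>i. i \<in> I \<Longrightarrow> f i \<in> V) \<Longrightarrow> (\<lambda>x. \<Sum>i\<in>I. f i x) \<in> V"
  using sum_mem[of I f "\<lambda>_. 1"] by simp

lemma sum_left_plain: "finite I \<Longrightarrow> (\<And>i. i \<in> I \<Longrightarrow> f i \<in> V) \<Longrightarrow> h \<in> V \<Longrightarrow>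
   B (\<lambda>x. \<Sum>i\<in>I. f i x) h = (\<Sum>i\<in>I. B (f i) h)"
  using sum_left[of I f h "\<lambda>_. 1"] by simp

lemma diff_scale_mem: "f \<in> V \<Longrightarrow> g \<in> V \<Longrightarrow> (\<lambda>x. f x - k * g x) \<in> V"
  by (intro diff_mem scale_mem)

lemma self_real: "f \<in> V \<Longrightarrow> B f f = of_real (Re (B f f))"
  using arg_cong[OF herm[of f f], of Im] by (simp add: complex_eq_iff)

text \<open>
  The form is nonnegative on \<open>f - t b g\<close> with \<open>b = B f g\<close>, for every real
  \<open>t\<close>. If \<open>B g g = 0\<close>, the resulting expression is affine in
  \<open>t\<close>, which forces \<open>b = 0\<close>.
\<close>

lemma Cauchy_Schwarz_square:
  assumes f: "f \<in> V" and g: "g \<in> V"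
  shows "(norm (B f g))\<^sup>2 \<le> Re (B f f) * Re (B g g)"
proof -
  let ?b = "B f g"
  have re: "Re (a - complex_of_real u + of_real v * b) = Re a - u + v * Re b" for a b u v
    by simp
  have poly: "0 \<le> Re (B f f) - 2 * t * (norm ?b)\<^sup>2 + t\<^sup>2 * (norm ?b)\<^sup>2 * Re (B g g)" for t :: real
  proof -
    let ?c = "of_real t * ?b"
    have m: "(\<lambda>x. ?c * g x) \<in> V" by (rule scale_mem[OF g])
    have "B (\<lambda>x. f x - ?c * g x) (\<lambda>x. f x - ?c * g x)
        = B f f - ?c * B g f - cnj ?c * B f g + ?c * cnj ?c * B g g"
      by (simp only: diff_left diff_right scale_left scale_right f g m diff_mem[OF f m])
        (simp add: algebra_simps)
    also have "\<dots> = B f f - of_real (2 * t * (norm ?b)\<^sup>2) + of_real (t\<^sup>2 * (norm ?b)\<^sup>2) * B g g"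
      unfolding herm[OF f g] of_real_mult complex_norm_square
      by (simp add: algebra_simps power2_eq_square)
    finally have "Re (B (\<lambda>x. f x - ?c * g x) (\<lambda>x. f x - ?c * g x))
        = Re (B f f) - 2 * t * (norm ?b)\<^sup>2 + t\<^sup>2 * (norm ?b)\<^sup>2 * Re (B g g)"
      by (simp only: re)
    then show ?thesis
      using nonneg[OF diff_mem[OF f m]] by simp
  qed
  have Bg: "0 \<le> Re (B g g)" using nonneg[OF g] .
  show ?thesis
  proof (cases "Re (B g g) = 0")
    case False
    then show ?thesis
      using poly[of "1 / Re (B g g)"] Bg by (simp add: field_simps power2_eq_square)
  next
    case True
    show ?thesis
    proof (cases "norm ?b = 0")
      case False
      then have "0 < (norm ?b)\<^sup>2" by simp
      then show ?thesis
        using poly[of "(Re (B f f) + 1) / (2 * (norm ?b)\<^sup>2)"] True by (simp add: field_simps)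
    qed (simp add: True)
  qed
qed

definition orthonormal :: "nat \<Rightarrow> (nat \<Rightarrow> 'x \<Rightarrow> complex) \<Rightarrow> bool" where
  "orthonormal N e \<longleftrightarrow> (\<forall>i<N. e i \<in> V) \<and> (\<forall>i<N. \<forall>j<N. B (e i) (e j) = (if i = j then 1 else 0))"

definition residual :: "nat \<Rightarrow> (nat \<Rightarrow> 'x \<Rightarrow> complex) \<Rightarrow> ('x \<Rightarrow> complex) \<Rightarrow> 'x \<Rightarrow> complex" where
  "residual N e m = (\<lambda>x. m x - (\<Sum>i<N. B m (e i) * e i x))"

lemma residual_mem: "orthonormal N e \<Longrightarrow> m \<in> V \<Longrightarrow> residual N e m \<in> V"
  unfolding residual_def orthonormal_def by (intro diff_mem sum_mem) auto

lemma residual_orthogonal: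
  assumes e: "orthonormal N e" and m: "m \<in> V" and j: "j < N"
  shows "B (residual N e m) (e j) = 0"
proof -
  have V: "\<And>i. i \<in> {..<N} \<Longrightarrow> e i \<in> V" using e by (simp add: orthonormal_def)
  have ej: "e j \<in> V" using V j by simp
  have s: "(\<lambda>x. \<Sum>i<N. B m (e i) * e i x) \<in> V" using V by (intro sum_mem) auto
  have "B (residual N e m) (e j) = B m (e j) - (\<Sum>i<N. B m (e i) * B (e i) (e j))"
    unfolding residual_def diff_left[OF m s ej] using V ej by (subst sum_left) auto
  also have "(\<Sum>i<N. B m (e i) * B (e i) (e j)) = (\<Sum>i<N. if i = j then B m (e j) else 0)"
    using e j by (intro sum.cong) (auto simp: orthonormal_def)
  finally show ?thesis using j by simp
qed

lemma Bessel:
  assumes e: "orthonormal N e" and m: "m \<in> V"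
  shows "(\<Sum>i<N. (norm (B m (e i)))\<^sup>2) \<le> Re (B m m)"
proof -
  let ?r = "residual N e m"
  let ?s = "\<lambda>x. \<Sum>i<N. B m (e i) * e i x"
  have V: "\<And>i. i \<in> {..<N} \<Longrightarrow> e i \<in> V" using e by (simp add: orthonormal_def)
  have s: "?s \<in> V" using V by (intro sum_mem) auto
  have r: "?r \<in> V" using residual_mem[OF e m] .
  have "B ?r ?s = (\<Sum>i<N. cnj (B m (e i)) * B ?r (e i))"
    using V r by (intro sum_right) auto
  also have "\<dots> = 0" using residual_orthogonal[OF e m] by simp
  finally have rs: "B ?r ?s = 0" .
  have "B ?r ?r = B ?r m - B ?r ?s"
    by (subst (2) residual_def) (rule diff_right[OF m s r])
  also have "\<dots> = B ?r m" using rs by simp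
  also have "\<dots> = B m m - (\<Sum>i<N. B m (e i) * B (e i) m)"
    unfolding residual_def diff_left[OF m s m] using V m by (subst sum_left) auto
  also have "(\<Sum>i<N. B m (e i) * B (e i) m) = of_real (\<Sum>i<N. (norm (B m (e i)))\<^sup>2)"
  proof -
    have "B m (e i) * B (e i) m = of_real ((norm (B m (e i)))\<^sup>2)" if "i < N" for i
      using herm[OF m, of "e i"] V that by (simp add: complex_norm_square del: of_real_power)
    then show ?thesis by simp
  qed
  finally show ?thesis using nonneg[OF r] by simp
qed

text \<open>
  The Gram-Schmidt step. Contrapositively, a maximal orthonormal system leaves no residual.
\<close>

lemma orthonormal_extend:
  assumes e: "orthonormal N e" and m: "m \<in> V" and r: "Re (B (residual N e m) (residual N e m)) \<noteq> 0"
  shows "\<exists>c. c \<noteq> 0 \<and> orthonormal (Suc N) (e(N := (\<lambda>x. c * residual N e m x)))"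
proof -
  let ?r = "residual N e m"
  let ?q = "Re (B ?r ?r)"
  have rV: "?r \<in> V" using residual_mem[OF e m] .
  have q: "0 < ?q" using nonneg[OF rV] r by linarith
  let ?c = "complex_of_real (1 / sqrt ?q)"
  have c: "?c \<noteq> 0" using q by simp
  have "B (\<lambda>x. ?c * ?r x) (\<lambda>x. ?c * ?r x) = ?c * cnj ?c * B ?r ?r"
    using rV scale_mem[OF rV, of ?c] by (simp only: scale_left scale_right) simp
  also have "\<dots> = of_real (1 / sqrt ?q * (1 / sqrt ?q) * ?q)"
    by (subst self_real[OF rV], unfold of_real_mult) simp
  also have "1 / sqrt ?q * (1 / sqrt ?q) * ?q = 1"
    using q by (simp add: field_simps)
  finally have n1: "B (\<lambda>x. ?c * ?r x) (\<lambda>x. ?c * ?r x) = 1" by simp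
  have V: "\<And>i. i < N \<Longrightarrow> e i \<in> V" using e by (simp add: orthonormal_def)
  have o1: "B (\<lambda>x. ?c * ?r x) (e j) = 0" if "j < N" for j
    using scale_left[OF rV V[OF that], of ?c] residual_orthogonal[OF e m that] by simp
  have o2: "B (e j) (\<lambda>x. ?c * ?r x) = 0" if "j < N" for j
    using o1[OF that] herm[OF scale_mem[OF rV] V[OF that], of ?c] by simp
  have "orthonormal (Suc N) (e(N := (\<lambda>x. ?c * ?r x)))"
    unfolding orthonormal_def using V e n1 o1 o2 scale_mem[OF rV, of ?c]
    by (auto simp: orthonormal_def less_Suc_eq)
  then show ?thesis using c by blast
qed

end

section \<open>Square-integrable functions\<close>

text \<open>
  The measure is a parameter because two of them occur: the operators act on functions over the
  complete measure \<open>lebesgue\<close>, while Fubini's theorem concerns products of the Borel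
  measure \<open>lborel\<close>.
\<close>

definition sqint :: "'a measure \<Rightarrow> ('a \<Rightarrow> complex) set" where
  "sqint M = {f \<in> borel_measurable M. integrable M (\<lambda>z. (norm (f z))\<^sup>2)}"

definition ip :: "'a measure \<Rightarrow> ('a \<Rightarrow> complex) \<Rightarrow> ('a \<Rightarrow> complex) \<Rightarrow> complex" where
  "ip M f g = (LINT z|M. f z * cnj (g z))"

lemma L2_eq_sqint: "L2 = sqint lebesgue"
  by (simp add: L2_def sqint_def)

lemma L2_inner_eq_ip: "L2_inner = ip lebesgue"
  by (simp add: L2_inner_def ip_def fun_eq_iff)

lemma norm_mult_le_squares: "norm (a * b) \<le> (norm (a::complex))\<^sup>2 + (norm b)\<^sup>2"
proof -
  have "2 * (norm a * norm b) \<le> (norm a)\<^sup>2 + (norm b)\<^sup>2"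
    using sum_squares_bound[of "norm a" "norm b"] by (simp add: mult.assoc)
  moreover have "0 \<le> norm a * norm b" by simp
  ultimately show ?thesis by (simp only: norm_mult)
qed

lemma borel_measurable_cnj [measurable]:
  "f \<in> borel_measurable M \<Longrightarrow> (\<lambda>z. cnj (f z)) \<in> borel_measurable M"
  by (auto intro!: borel_measurable_continuous_on[of cnj] continuous_intros)

lemma sqint_mult_integrable:
  assumes "f \<in> sqint M" "g \<in> sqint M"
  shows "integrable M (\<lambda>z. f z * g z)"
proof (rule Bochner_Integration.integrable_bound)
  show "integrable M (\<lambda>z. (norm (f z))\<^sup>2 + (norm (g z))\<^sup>2)"
    using assms by (simp add: sqint_def)
  show "(\<lambda>z. f z * g z) \<in> borel_measurable M"
    using assms by (auto simp: sqint_def)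
  show "AE z in M. norm (f z * g z) \<le> norm ((norm (f z))\<^sup>2 + (norm (g z))\<^sup>2)"
    by (intro AE_I2 order_trans[OF norm_mult_le_squares]) simp
qed

lemma sqint_cnj: "f \<in> sqint M \<Longrightarrow> (\<lambda>z. cnj (f z)) \<in> sqint M"
  by (auto simp: sqint_def intro!: borel_measurable_cnj)

lemma ip_integrable: "f \<in> sqint M \<Longrightarrow> g \<in> sqint M \<Longrightarrow> integrable M (\<lambda>z. f z * cnj (g z))"
  by (intro sqint_mult_integrable sqint_cnj)

lemma sqint_bound:
  assumes "g \<in> sqint M" "f \<in> borel_measurable M" "AE z in M. norm (f z) \<le> norm (g z)"
  shows "f \<in> sqint M"
proof -
  have "integrable M (\<lambda>z. (norm (f z))\<^sup>2)"
  proof (rule Bochner_Integration.integrable_bound)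
    show "integrable M (\<lambda>z. (norm (g z))\<^sup>2)" using assms by (simp add: sqint_def)
    show "(\<lambda>z. (norm (f z))\<^sup>2) \<in> borel_measurable M" using assms(2) by simp
    show "AE z in M. norm ((norm (f z))\<^sup>2) \<le> norm ((norm (g z))\<^sup>2)"
      using assms(3) by eventually_elim (auto intro: power_mono)
  qed
  then show ?thesis using assms(2) by (simp add: sqint_def)
qed

lemma ip_self: "ip M f f = of_real (LINT z|M. (norm (f z))\<^sup>2)"
  unfolding ip_def by (simp add: complex_norm_square[symmetric] del: of_real_power)

lemma sqint_semi_inner: "semi_inner (sqint M) (ip M)"
proof
  show "(\<lambda>_. 0) \<in> sqint M" by (simp add: sqint_def)
next
  fix f g c assume f: "f \<in> sqint M" and g: "g \<in> sqint M"
  have bnd: "(norm (c * f z + g z))\<^sup>2 \<le> 2 * (norm c)\<^sup>2 * (norm (f z))\<^sup>2 + 2 * (norm (g z))\<^sup>2" for z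
  proof -
    have "norm (c * f z + g z) \<le> norm c * norm (f z) + norm (g z)"
      by (metis norm_mult norm_triangle_ineq)
    then have "(norm (c * f z + g z))\<^sup>2 \<le> (norm c * norm (f z) + norm (g z))\<^sup>2"
      by (intro power_mono) auto
    also have "\<dots> \<le> 2 * (norm c * norm (f z))\<^sup>2 + 2 * (norm (g z))\<^sup>2"
      using sum_squares_bound[of "norm c * norm (f z)" "norm (g z)"]
      by (simp add: power2_sum)
    finally show ?thesis by (simp add: power_mult_distrib)
  qed
  have "integrable M (\<lambda>z. (norm (c * f z + g z))\<^sup>2)"
  proof (rule Bochner_Integration.integrable_bound)
    show "integrable M (\<lambda>z. 2 * (norm c)\<^sup>2 * (norm (f z))\<^sup>2 + 2 * (norm (g z))\<^sup>2)"
      using f g by (simp add: sqint_def)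
    show "(\<lambda>z. (norm (c * f z + g z))\<^sup>2) \<in> borel_measurable M"
      using f g by (auto simp: sqint_def)
    show "AE z in M. norm ((norm (c * f z + g z))\<^sup>2)
        \<le> norm (2 * (norm c)\<^sup>2 * (norm (f z))\<^sup>2 + 2 * (norm (g z))\<^sup>2)"
      by (simp add: abs_of_nonneg del: norm_power) (intro AE_I2 bnd)
  qed
  then show "(\<lambda>x. c * f x + g x) \<in> sqint M" using f g by (auto simp: sqint_def)
next
  fix f g h c assume "f \<in> sqint M" "g \<in> sqint M" "h \<in> sqint M"
  then show "ip M (\<lambda>x. c * f x + g x) h = c * ip M f h + ip M g h"
    unfolding ip_def by (simp add: distrib_right mult.assoc ip_integrable)
next
  fix f g assume "f \<in> sqint M" "g \<in> sqint M"
  have "ip M g f = (LINT z|M. cnj (f z * cnj (g z)))" by (simp add: ip_def mult.commute)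
  also have "\<dots> = cnj (ip M f g)" unfolding ip_def by (simp only: Bochner_Integration.integral_cnj)
  finally show "ip M g f = cnj (ip M f g)" .
next
  fix f :: "'a \<Rightarrow> complex" show "0 \<le> Re (ip M f f)" by (simp add: ip_self)
qed

interpretation sqint: semi_inner "sqint M" "ip M" for M
  by (rule sqint_semi_inner)

lemma ip_cong:
  assumes "f \<in> borel_measurable M" "g \<in> borel_measurable M" "f' \<in> borel_measurable M" "g' \<in> borel_measurable M"
    and "AE z in M. f z = f' z" "AE z in M. g z = g' z"
  shows "ip M f g = ip M f' g'"
  unfolding ip_def using assms
  by (intro integral_cong_AE borel_measurable_times borel_measurable_cnj) auto

lemma ip_self_zero_iff:
  assumes "f \<in> sqint M"
  shows "Re (ip M f f) = 0 \<longleftrightarrow> (AE z in M. f z = 0)"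
proof -
  have "Re (ip M f f) = 0 \<longleftrightarrow> (AE z in M. (norm (f z))\<^sup>2 = 0)"
    unfolding ip_self Re_complex_of_real using assms
    by (intro integral_nonneg_eq_0_iff_AE) (auto simp: sqint_def)
  then show ?thesis by simp
qed

interpretation L2: semi_inner "L2 :: ('a::euclidean_space \<Rightarrow> complex) set" L2_inner
  unfolding L2_eq_sqint L2_inner_eq_ip by (rule sqint_semi_inner)

lemma L2_norm_square: "(L2_norm f)\<^sup>2 = Re (L2_inner f f)"
  by (simp add: L2_norm_def L2_inner_eq_ip ip_self)

lemma L2_norm_nonneg: "0 \<le> L2_norm f"
  by (simp add: L2_norm_def)

lemma L2_Cauchy_Schwarz:
  assumes "f \<in> L2" "g \<in> L2"
  shows "norm (L2_inner f g) \<le> L2_norm f * L2_norm g"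
proof (rule power2_le_imp_le)
  show "(norm (L2_inner f g))\<^sup>2 \<le> (L2_norm f * L2_norm g)\<^sup>2"
    unfolding power_mult_distrib L2_norm_square by (rule L2.Cauchy_Schwarz_square[OF assms])
qed (simp add: L2_norm_nonneg)

lemma L2_inner_cong:
  assumes "f \<in> L2" "g \<in> L2" "f' \<in> L2" "g' \<in> L2" "ae_eq f f'" "ae_eq g g'"
  shows "L2_inner f g = L2_inner f' g'"
  unfolding L2_inner_eq_ip
  by (rule ip_cong) (use assms in \<open>auto simp: L2_def ae_eq_def\<close>)

lemma L2_inner_tendsto:
  assumes "\<And>n. f n \<in> L2" "g \<in> L2" "h \<in> L2"
    and "(\<lambda>n. L2_norm (\<lambda>z. f n z - g z)) \<longlonglongrightarrow> 0"
  shows "(\<lambda>n. L2_inner (f n) h) \<longlonglongrightarrow> L2_inner g h"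
proof (rule Lim_null[THEN iffD2], rule Lim_null_comparison)
  show "\<forall>\<^sub>F n in sequentially. norm (L2_inner (f n) h - L2_inner g h)
      \<le> L2_norm (\<lambda>z. f n z - g z) * L2_norm h"
  proof (intro always_eventually allI)
    fix n
    show "norm (L2_inner (f n) h - L2_inner g h) \<le> L2_norm (\<lambda>z. f n z - g z) * L2_norm h"
      using L2_Cauchy_Schwarz[OF L2.diff_mem[OF assms(1)[of n] assms(2)] assms(3)]
      by (simp add: L2.diff_left assms)
  qed
  show "(\<lambda>n. L2_norm (\<lambda>z. f n z - g z) * L2_norm h) \<longlonglongrightarrow> 0"
    using tendsto_mult_left_zero[OF assms(4)] .
qed

section \<open>Spectral measures and spectral integrals\<close>

locale pvm =
  fixes P :: "real set \<Rightarrow> ('a::euclidean_space \<Rightarrow> complex) \<Rightarrow> ('a \<Rightarrow> complex)"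
  assumes pvm: "projection_valued_measure P"
begin

lemma P_mem: "B \<in> sets borel \<Longrightarrow> f \<in> L2 \<Longrightarrow> P B f \<in> L2"
  using pvm by (simp add: projection_valued_measure_def orthogonal_projection_def)

lemma P_sym: "B \<in> sets borel \<Longrightarrow> f \<in> L2 \<Longrightarrow> g \<in> L2 \<Longrightarrow> L2_inner (P B f) g = L2_inner f (P B g)"
  using pvm by (simp add: projection_valued_measure_def orthogonal_projection_def)

lemma P_Int:
  assumes "B \<in> sets borel" "C \<in> sets borel" "f \<in> L2" "g \<in> L2"
  shows "L2_inner (P B f) (P C g) = L2_inner (P (B \<inter> C) f) g"
proof -
  have "L2_inner (P B f) (P C g) = L2_inner f (P B (P C g))"
    using assms by (simp add: P_sym P_mem)
  also have "\<dots> = L2_inner f (P (B \<inter> C) g)"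
  proof (rule L2_inner_cong)
    have "ae_eq (P (B \<inter> C) g) (P B (P C g))"
      using pvm assms by (simp add: projection_valued_measure_def)
    then show "ae_eq (P B (P C g)) (P (B \<inter> C) g)"
      by (auto simp: ae_eq_def)
  qed (use assms in \<open>auto simp: P_mem ae_eq_def\<close>)
  also have "\<dots> = L2_inner (P (B \<inter> C) f) g"
    using assms by (simp add: P_sym)
  finally show ?thesis .
qed

lemma P_empty: "f \<in> L2 \<Longrightarrow> g \<in> L2 \<Longrightarrow> L2_inner (P {} f) g = 0"
  using pvm L2_inner_cong[of "P {} f" g "\<lambda>_. 0" g]
  by (simp add: P_mem L2.zero_mem projection_valued_measure_def ae_eq_def)

lemma P_UNIV: "f \<in> L2 \<Longrightarrow> g \<in> L2 \<Longrightarrow> L2_inner (P UNIV f) g = L2_inner f g"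
  using pvm by (intro L2_inner_cong) (auto simp: P_mem projection_valued_measure_def ae_eq_def)

text \<open>
  The squared norm of \<open>P B f\<close>; as a function of \<open>B\<close> it is the scalar
  spectral measure of \<open>f\<close>.
\<close>

definition mass :: "real set \<Rightarrow> ('a \<Rightarrow> complex) \<Rightarrow> real" where
  "mass B f = Re (L2_inner (P B f) f)"

lemma mass_empty: "f \<in> L2 \<Longrightarrow> mass {} f = 0"
  by (simp add: mass_def P_empty)

text \<open>
  As \<open>P B\<close> is symmetric and idempotent, the form is the inner product of \<open>P B
  f\<close> and \<open>P B g\<close>.
\<close>

lemma P_semi_inner:
  assumes "B \<in> sets borel"
  shows "semi_inner L2 (\<lambda>f g. L2_inner (P B f) g)"
proof
  fix f g h :: "'a \<Rightarrow> complex" and c assume "f \<in> L2" "g \<in> L2" "h \<in> L2"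
  then show "L2_inner (P B (\<lambda>x. c * f x + g x)) h = c * L2_inner (P B f) h + L2_inner (P B g) h"
    using assms by (simp add: P_sym P_mem L2.lin_left L2.lin_mem)
next
  fix f g :: "'a \<Rightarrow> complex" assume "f \<in> L2" "g \<in> L2"
  then show "L2_inner (P B g) f = cnj (L2_inner (P B f) g)"
    using assms by (metis P_mem P_sym L2.herm)
next
  fix f :: "'a \<Rightarrow> complex" assume "f \<in> L2"
  then show "0 \<le> Re (L2_inner (P B f) f)"
    using assms P_Int[of B B f f] L2.nonneg[of "P B f"] by (simp add: P_mem)
qed (simp_all add: L2.zero_mem L2.lin_mem)

lemma mass_nonneg: "B \<in> sets borel \<Longrightarrow> f \<in> L2 \<Longrightarrow> 0 \<le> mass B f"
  using semi_inner.nonneg[OF P_semi_inner] by (simp add: mass_def)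

lemma mass_of_real: "B \<in> sets borel \<Longrightarrow> f \<in> L2 \<Longrightarrow> L2_inner (P B f) f = of_real (mass B f)"
  using semi_inner.self_real[OF P_semi_inner] by (simp add: mass_def)

text \<open>
  Both factors are localised to \<open>B\<close>, so the bounds can be summed over a partition of
  the line.
\<close>

lemma P_Cauchy_Schwarz:
  "B \<in> sets borel \<Longrightarrow> f \<in> L2 \<Longrightarrow> g \<in> L2 \<Longrightarrow> norm (L2_inner (P B f) g) \<le> sqrt (mass B f) * sqrt (mass B g)"
  using semi_inner.Cauchy_Schwarz_square[OF P_semi_inner, of B f g]
  by (metis mass_def real_le_rsqrt real_sqrt_mult)

abbreviation mu :: "('a \<Rightarrow> complex) \<Rightarrow> real measure" where
  "mu f \<equiv> scalar_spectral_measure P f"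

lemma P_sums:
  assumes A: "range A \<subseteq> sets borel" "disjoint_family A" and f: "f \<in> L2" "h \<in> L2"
  shows "(\<lambda>i::nat. L2_inner (P (A i) f) h) sums L2_inner (P (\<Union>i. A i) f) h"
proof -
  have Ai: "A i \<in> sets borel" for i using A by auto
  have "(\<lambda>n. L2_inner (\<lambda>z. \<Sum>i<n. P (A i) f z) h) \<longlonglongrightarrow> L2_inner (P (\<Union>i. A i) f) h"
  proof (rule L2_inner_tendsto)
    show "(\<lambda>n. L2_norm (\<lambda>z. (\<Sum>i<n. P (A i) f z) - P (\<Union>i. A i) f z)) \<longlonglongrightarrow> 0"
      using pvm A f unfolding projection_valued_measure_def by blast
    show "(\<lambda>z. \<Sum>i<n. P (A i) f z) \<in> L2" for n
      by (rule L2.sum_mem_plain) (use Ai f P_mem in auto)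
    show "P (\<Union>i. A i) f \<in> L2" by (rule P_mem) (use Ai f in auto)
  qed (use f in auto)
  moreover have "L2_inner (\<lambda>z. \<Sum>i<n. P (A i) f z) h = (\<Sum>i<n. L2_inner (P (A i) f) h)" for n
    by (rule L2.sum_left_plain) (use Ai f P_mem in auto)
  ultimately show ?thesis by (simp add: sums_def)
qed

lemma sets_mu [measurable_cong, simp]: "sets (mu f) = sets borel"
  and space_mu [simp]: "space (mu f) = UNIV"
  using sets.sigma_sets_eq[of "borel :: real measure"]
  by (simp_all add: scalar_spectral_measure_def)

lemma emeasure_mu:
  assumes f: "f \<in> L2" and B: "B \<in> sets borel"
  shows "emeasure (mu f) B = ennreal (mass B f)"
proof -
  have "emeasure (measure_of UNIV (sets borel) (\<lambda>B. ennreal (mass B f))) B = ennreal (mass B f)"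
  proof (rule emeasure_measure_of_sigma)
    show "sigma_algebra UNIV (sets (borel :: real measure))"
      using sets.sigma_algebra_axioms[of "borel :: real measure"] by simp
    show "positive (sets borel) (\<lambda>B. ennreal (mass B f))"
      using P_empty[OF f f] by (simp add: positive_def mass_def)
    show "countably_additive (sets borel) (\<lambda>B. ennreal (mass B f))"
    proof (rule countably_additiveI)
      fix A :: "nat \<Rightarrow> real set"
      assume A: "range A \<subseteq> sets borel" "disjoint_family A"
      show "(\<Sum>i. ennreal (mass (A i) f)) = ennreal (mass (\<Union>i. A i) f)"
      proof (rule suminf_ennreal_eq)
        show "0 \<le> mass (A i) f" for i using mass_nonneg[OF _ f] A by auto
        show "(\<lambda>i. mass (A i) f) sums mass (\<Union>i. A i) f"
          using sums_Re[OF P_sums[OF A f f]] by (simp add: mass_def)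
      qed
    qed
  qed (rule B)
  then show ?thesis by (simp add: scalar_spectral_measure_def mass_def)
qed

lemma measure_mu: "f \<in> L2 \<Longrightarrow> B \<in> sets borel \<Longrightarrow> measure (mu f) B = mass B f"
  by (simp add: measure_def emeasure_mu mass_nonneg)

lemma finite_mu: "f \<in> L2 \<Longrightarrow> finite_measure (mu f)"
  by (rule finite_measureI) (simp add: emeasure_mu)

lemma integral_indicator_mu:
  assumes "f \<in> L2" "B \<in> sets borel"
  shows "has_bochner_integral (mu f) (\<lambda>x. c * indicator B x) (c * mass B f :: real)"
  using assms has_bochner_integral_real_indicator[of B "mu f"]
  by (intro has_bochner_integral_mult_right) (auto simp: emeasure_mu measure_mu)

lemma mass_sum_le:
  assumes f: "f \<in> L2" and A: "range A \<subseteq> sets borel" "disjoint_family A"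
  shows "(\<Sum>i<(n::nat). mass (A i) f) \<le> Re (L2_inner f f)"
proof -
  interpret finite_measure "mu f" using finite_mu[OF f] .
  have "(\<Sum>i<n. mass (A i) f) = measure (mu f) (\<Union>i\<in>{..<n}. A i)"
    using A f by (subst finite_measure_finite_Union)
      (auto simp: measure_mu disjoint_family_on_def)
  also have "\<dots> \<le> measure (mu f) UNIV" using A by (intro finite_measure_mono) auto
  also have "\<dots> = Re (L2_inner f f)" using f by (simp add: measure_mu mass_def P_UNIV)
  finally show ?thesis .
qed

text \<open>
  The vectors \<open>P (s -` {d}) f\<close>, for \<open>d\<close> in the range of \<open>s\<close>,
  are mutually orthogonal, also with respect to the form of \<open>P B\<close>, and they add up to
  \<open>f\<close> as far as this form can see. Expanding the square of \<open>s(A) f - k f\<close>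
  therefore leaves only diagonal terms.
\<close>

lemma mass_simple_spectral_integral:
  fixes k :: complex
  assumes f: "f \<in> L2" and B: "B \<in> sets borel" and s: "simple_function borel s"
  defines "r \<equiv> \<lambda>z. simple_spectral_integral P s f z - k * f z"
  shows "r \<in> L2"
    and "has_bochner_integral (mu f) (\<lambda>x. (norm (s x - k))\<^sup>2 * indicator B x) (mass B r)"
proof -
  let ?T = "\<lambda>d. P (s -` {d}) f"
  let ?S = "simple_spectral_integral P s f"
  let ?m = "\<lambda>d. mass (B \<inter> s -` {d}) f"
  have fin: "finite (range s)" using s by (simp add: simple_function_def)
  have ms: "s -` {d} \<in> sets borel" for d
  proof (cases "d \<in> range s")
    case True then show ?thesis using s by (auto simp: simple_function_def)
  next
    case False then have "s -` {d} = {}" by auto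
    then show ?thesis by simp
  qed
  have T: "?T d \<in> L2" for d using ms f by (simp add: P_mem)
  have S: "?S \<in> L2"
    unfolding simple_spectral_integral_def using fin T by (intro L2.sum_mem) auto
  show r: "r \<in> L2" unfolding r_def using S f by (intro L2.diff_mem L2.scale_mem)
  interpret b: semi_inner L2 "\<lambda>f g. L2_inner (P B f) g" using P_semi_inner[OF B] .
  have bTT: "L2_inner (P B (?T d)) (?T e) = (if d = e then of_real (?m d) else 0)" for d e
  proof -
    have "L2_inner (P B (?T d)) (?T e) = L2_inner (P (B \<inter> s -` {e}) (?T d)) f"
      using B T f ms by (subst P_Int) auto
    also have "\<dots> = L2_inner (?T d) (P (B \<inter> s -` {e}) f)"
      using B T f ms by (subst P_sym) auto
    also have "\<dots> = L2_inner (P (s -` {d} \<inter> (B \<inter> s -` {e})) f) f"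
      using B f ms by (subst P_Int) auto
    also have "s -` {d} \<inter> (B \<inter> s -` {e}) = (if d = e then B \<inter> s -` {d} else {})" by auto
    finally show ?thesis using B f ms
      by (cases "d = e") (simp_all add: mass_of_real mass_empty sets.Int)
  qed
  have bTf: "L2_inner (P B (?T d)) f = of_real (?m d)" for d
  proof -
    have "L2_inner (P B (?T d)) f = L2_inner (?T d) (P B f)"
      using B T f ms by (subst P_sym) auto
    also have "\<dots> = L2_inner (P (s -` {d} \<inter> B) f) f" using B f ms by (subst P_Int) auto
    finally show ?thesis using B f ms by (simp add: mass_of_real sets.Int Int_commute)
  qed
  have bSh: "L2_inner (P B ?S) h = (\<Sum>d\<in>range s. d * L2_inner (P B (?T d)) h)" if "h \<in> L2" for h
    unfolding simple_spectral_integral_def using fin T that by (intro b.sum_left) auto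
  have bhS: "L2_inner (P B h) ?S = (\<Sum>d\<in>range s. cnj d * L2_inner (P B h) (?T d))" if "h \<in> L2" for h
    unfolding simple_spectral_integral_def using fin T that by (intro b.sum_right) auto
  have bfT: "L2_inner (P B f) (?T d) = of_real (?m d)" for d
    using b.herm[OF T f] bTf by simp
  have bSS: "L2_inner (P B ?S) ?S = (\<Sum>d\<in>range s. d * cnj d * of_real (?m d))"
  proof -
    have "L2_inner (P B (?T d)) ?S = cnj d * of_real (?m d)" if "d \<in> range s" for d
    proof -
      have "L2_inner (P B (?T d)) ?S = (\<Sum>e\<in>range s. if e = d then cnj d * of_real (?m d) else 0)"
        unfolding bhS[OF T] by (intro sum.cong) (auto simp: bTT)
      then show ?thesis using fin that by simp
    qed
    then show ?thesis unfolding bSh[OF S] by (intro sum.cong) (auto simp: mult.assoc)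
  qed
  have ind: "indicator B x = (\<Sum>d\<in>range s. indicator (B \<inter> s -` {d}) x :: real)" for x
  proof -
    have "(\<Sum>d\<in>range s. indicator (B \<inter> s -` {d}) x :: real) = (\<Sum>d\<in>range s. if d = s x then indicator B x else 0)"
      by (intro sum.cong) (auto simp: indicator_def)
    then show ?thesis using fin by simp
  qed
  have "has_bochner_integral (mu f) (\<lambda>x. indicator B x :: real) (\<Sum>d\<in>range s. 1 * ?m d)"
    unfolding ind using integral_indicator_mu[OF f, of _ 1] B ms
    by (intro has_bochner_integral_sum) (simp add: sets.Int)
  then have "mass B f = (\<Sum>d\<in>range s. ?m d)"
    using integral_indicator_mu[OF f B, of 1] by (auto dest: has_bochner_integral_eq)
  then have bff: "L2_inner (P B f) f = (\<Sum>d\<in>range s. of_real (?m d))"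
    using mass_of_real[OF B f] by simp
  have kf: "(\<lambda>z. k * f z) \<in> L2" using f by (rule L2.scale_mem)
  have "L2_inner (P B r) r = L2_inner (P B ?S) ?S - cnj k * L2_inner (P B ?S) f
      - k * L2_inner (P B f) ?S + k * cnj k * L2_inner (P B f) f"
    unfolding r_def
    by (simp only: b.diff_left b.diff_right b.scale_left b.scale_right S f kf L2.diff_mem[OF S kf])
      (simp add: algebra_simps)
  also have "\<dots> = (\<Sum>d\<in>range s. of_real ((norm (d - k))\<^sup>2 * ?m d))"
    unfolding bSS bSh[OF f] bhS[OF f] bff bTf bfT of_real_mult complex_norm_square sum_distrib_left
      sum_subtractf[symmetric] sum.distrib[symmetric]
    by (intro sum.cong) (auto simp: algebra_simps)
  finally have mr: "mass B r = (\<Sum>d\<in>range s. (norm (d - k))\<^sup>2 * ?m d)"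
    unfolding mass_def by (simp flip: of_real_sum)
  have ind2: "(norm (s x - k))\<^sup>2 * indicator B x
      = (\<Sum>d\<in>range s. (norm (d - k))\<^sup>2 * indicator (B \<inter> s -` {d}) x :: real)" for x
  proof -
    have "(\<Sum>d\<in>range s. (norm (d - k))\<^sup>2 * indicator (B \<inter> s -` {d}) x :: real)
        = (\<Sum>d\<in>range s. if d = s x then (norm (s x - k))\<^sup>2 * indicator B x else 0)"
      by (intro sum.cong) (auto simp: indicator_def)
    then show ?thesis using fin by simp
  qed
  show "has_bochner_integral (mu f) (\<lambda>x. (norm (s x - k))\<^sup>2 * indicator B x) (mass B r)"
    unfolding ind2 mr using B ms
    by (intro has_bochner_integral_sum integral_indicator_mu f) (simp add: sets.Int)
qed

text \<open>
  On the spectral subspace of a set where \<open>\<phi>\<close> is nearly equal to \<open>k\<close>,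
  the operator \<open>\<phi>(A)\<close> is nearly equal to \<open>k\<close>. With simple functions
  \<open>s n\<close> approximating \<open>\<phi>\<close>, this follows from \<open>|s n - k|\<^sup>2
  \<le> 2 |s n - \<phi>|\<^sup>2 + 2 |\<phi> - k|\<^sup>2\<close>, where the first term disappears
  in the limit.
\<close>

lemma mass_spectral_integral_le:
  assumes fg: "(f, g) \<in> spectral_integral P \<phi>" and [measurable]: "\<phi> \<in> borel_measurable borel"
    and B[measurable]: "B \<in> sets borel" and k: "\<And>x. x \<in> B \<Longrightarrow> norm (\<phi> x - k) \<le> \<eta>"
  shows "mass B (\<lambda>z. g z - k * f z) \<le> 2 * \<eta>\<^sup>2 * mass B f"
proof -
  from fg obtain s where f: "f \<in> L2" and g: "g \<in> L2"
    and int\<phi>: "integrable (mu f) (\<lambda>x. (norm (\<phi> x))\<^sup>2)"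
    and s: "\<And>n. simple_function borel (s n)"
    and lim0: "(\<lambda>n. LINT x|mu f. (norm (s n x - \<phi> x))\<^sup>2) \<longlonglongrightarrow> 0"
    and lim: "(\<lambda>n. L2_norm (\<lambda>z. simple_spectral_integral P (s n) f z - g z)) \<longlonglongrightarrow> 0"
    by (auto simp: spectral_integral_def)
  define r where "r n = (\<lambda>z. simple_spectral_integral P (s n) f z - k * f z)" for n
  define q where "q = (\<lambda>z. g z - k * f z)"
  have rn: "r n \<in> L2" for n unfolding r_def using mass_simple_spectral_integral(1)[OF f B s] .
  have q: "q \<in> L2" unfolding q_def using f g by (intro L2.diff_mem L2.scale_mem)
  interpret finite_measure "mu f" using finite_mu[OF f] .
  define K where "K n = 2 * (LINT x|mu f. (norm (s n x - \<phi> x))\<^sup>2) + 2 * \<eta>\<^sup>2 * mass B f" for n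
  have massr: "mass B (r n) \<le> K n" for n
  proof -
    have [measurable]: "s n \<in> borel_measurable borel" using s by (rule borel_measurable_simple_function)
    have fin: "finite (range (s n))" using s[of n] by (simp add: simple_function_def)
    obtain C where C: "\<And>x. norm (s n x) \<le> C"
      using finite_imp_bounded[OF fin] by (auto simp: bounded_iff)
    have "integrable (mu f) (\<lambda>x. (norm (s n x))\<^sup>2)"
      by (rule integrable_const_bound[where B = "C\<^sup>2"]) (auto intro!: AE_I2 power_mono C)
    with int\<phi> have i2: "integrable (mu f) (\<lambda>x. 2 * (norm (s n x))\<^sup>2 + 2 * (norm (\<phi> x))\<^sup>2)"
      by simp
    have sq: "(norm (a - b :: complex))\<^sup>2 \<le> 2 * (norm a)\<^sup>2 + 2 * (norm b)\<^sup>2" for a b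
    proof -
      have "(norm (a - b))\<^sup>2 \<le> (norm a + norm b)\<^sup>2" by (intro power_mono norm_triangle_ineq4) auto
      also have "\<dots> \<le> 2 * (norm a)\<^sup>2 + 2 * (norm b)\<^sup>2"
        using sum_squares_bound[of "norm a" "norm b"] by (simp add: power2_sum)
      finally show ?thesis .
    qed
    have i1: "integrable (mu f) (\<lambda>x. (norm (s n x - \<phi> x))\<^sup>2)"
      by (rule Bochner_Integration.integrable_bound[OF i2])
        (auto intro!: AE_I2 order_trans[OF sq])
    note hb = mass_simple_spectral_integral(2)[OF f B s[of n], of k, folded r_def]
    have "mass B (r n) = (LINT x|mu f. (norm (s n x - k))\<^sup>2 * indicator B x)"
      using hb by (simp add: has_bochner_integral_iff)
    also have "\<dots> \<le> (LINT x|mu f. 2 * (norm (s n x - \<phi> x))\<^sup>2 + 2 * \<eta>\<^sup>2 * indicator B x)"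
    proof (rule integral_mono)
      show "integrable (mu f) (\<lambda>x. (norm (s n x - k))\<^sup>2 * indicator B x)"
        using hb by (simp add: has_bochner_integral_iff)
      show "integrable (mu f) (\<lambda>x. 2 * (norm (s n x - \<phi> x))\<^sup>2 + 2 * \<eta>\<^sup>2 * indicator B x)"
        using i1 integral_indicator_mu[OF f B, of "2 * \<eta>\<^sup>2"] by (auto simp: has_bochner_integral_iff)
      fix x
      show "(norm (s n x - k))\<^sup>2 * indicator B x \<le> 2 * (norm (s n x - \<phi> x))\<^sup>2 + 2 * \<eta>\<^sup>2 * indicator B x"
      proof (cases "x \<in> B")
        case True
        have "(norm (s n x - k))\<^sup>2 \<le> 2 * (norm (s n x - \<phi> x))\<^sup>2 + 2 * (norm (k - \<phi> x))\<^sup>2"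
          using sq[of "s n x - \<phi> x" "k - \<phi> x"] by simp
        also have "(norm (k - \<phi> x))\<^sup>2 \<le> \<eta>\<^sup>2"
          using k[OF True] by (intro power_mono) (auto simp: norm_minus_commute)
        finally show ?thesis using True by simp
      qed simp
    qed
    also have "\<dots> = K n"
      using i1 integral_indicator_mu[OF f B, of "2 * \<eta>\<^sup>2"]
      by (auto simp: has_bochner_integral_iff K_def)
    finally show ?thesis .
  qed
  have limK: "K \<longlonglongrightarrow> 2 * \<eta>\<^sup>2 * mass B f"
    unfolding K_def[abs_def] using tendsto_add[OF tendsto_mult_right_zero[OF lim0, of 2] tendsto_const]
    by simp
  have limr: "(\<lambda>n. L2_inner (r n) (P B q)) \<longlonglongrightarrow> L2_inner q (P B q)"
    by (rule L2_inner_tendsto) (use lim rn q B in \<open>auto simp: P_mem r_def q_def\<close>)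
  have Kpos: "0 \<le> K n" for n using massr[of n] mass_nonneg[OF B rn] by (meson order_trans)
  have "(norm (L2_inner q (P B q)))\<^sup>2 \<le> 2 * \<eta>\<^sup>2 * mass B f * mass B q"
  proof (rule LIMSEQ_le)
    show "(\<lambda>n. (norm (L2_inner (r n) (P B q)))\<^sup>2) \<longlonglongrightarrow> (norm (L2_inner q (P B q)))\<^sup>2"
      by (intro tendsto_intros limr)
    show "(\<lambda>n. K n * mass B q) \<longlonglongrightarrow> 2 * \<eta>\<^sup>2 * mass B f * mass B q"
      by (intro tendsto_intros limK)
    have "(norm (L2_inner (r n) (P B q)))\<^sup>2 \<le> K n * mass B q" for n
    proof -
      have "norm (L2_inner (r n) (P B q)) = norm (L2_inner (P B (r n)) q)"
        using rn q B by (simp add: P_sym)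
      then have "(norm (L2_inner (r n) (P B q)))\<^sup>2 \<le> mass B (r n) * mass B q"
        using semi_inner.Cauchy_Schwarz_square[OF P_semi_inner[OF B] rn q] by (simp add: mass_def)
      also have "\<dots> \<le> K n * mass B q" by (intro mult_right_mono massr mass_nonneg q B)
      finally show ?thesis .
    qed
    then show "\<exists>N. \<forall>n\<ge>N. (norm (L2_inner (r n) (P B q)))\<^sup>2 \<le> K n * mass B q" by blast
  qed
  moreover have "L2_inner q (P B q) = of_real (mass B q)"
    using q B P_sym[OF B q q] mass_of_real[OF B q] by simp
  ultimately have "(mass B q)\<^sup>2 \<le> 2 * \<eta>\<^sup>2 * mass B f * mass B q" by simp
  moreover have "0 \<le> mass B q" using mass_nonneg[OF B q] .
  moreover have "0 \<le> 2 * \<eta>\<^sup>2 * mass B f" using mass_nonneg[OF B f] by simp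
  ultimately have "mass B q \<le> 2 * \<eta>\<^sup>2 * mass B f"
    by (cases "mass B q = 0") (auto simp: power2_eq_square)
  then show ?thesis unfolding q_def .
qed

end

section \<open>Unitary groups paired with strong solutions\<close>

lemma exp_i_real_vector_derivative:
  "((\<lambda>s. exp (- \<i> * of_real c * of_real s)) has_vector_derivative
     - \<i> * of_real c * exp (- \<i> * of_real c * of_real s)) (at s within S)"
proof -
  have "((\<lambda>z. exp (- \<i> * of_real c * z)) has_field_derivative
     - \<i> * of_real c * exp (- \<i> * of_real c * of_real s)) (at (of_real s))"
    by (auto intro!: derivative_eq_intros)
  from has_vector_derivative_real_field[OF this] show ?thesis .
qed

lemma vector_derivative_increment_le:
  fixes f :: "real \<Rightarrow> complex"
  assumes "convex S" "x \<in> S" "y \<in> S"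
    and "\<And>s. s \<in> S \<Longrightarrow> (f has_vector_derivative f' s) (at s within S)"
    and "\<And>s. s \<in> S \<Longrightarrow> norm (f' s) \<le> C"
  shows "norm (f y - f x) \<le> C * \<bar>y - x\<bar>"
proof -
  have "norm (f y - f x) \<le> C * norm (y - x)"
  proof (rule differentiable_bound)
    show "(f has_derivative (\<lambda>h. h *\<^sub>R f' s)) (at s within S)" if "s \<in> S" for s
      using assms(4)[OF that] by (simp add: has_vector_derivative_def)
    show "onorm (\<lambda>h. h *\<^sub>R f' s) \<le> C" if "s \<in> S" for s
      using assms(5)[OF that] by (intro onorm_le) (simp add: mult.commute[of C] mult_left_mono)
  qed (use assms in auto)
  then show ?thesis by simp
qed

lemma norm_exp_i_diff_le:
  "norm (exp (- \<i> * of_real a * of_real x) - exp (- \<i> * of_real a * of_real y)) \<le> \<bar>a\<bar> * \<bar>x - y\<bar>"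
  by (rule vector_derivative_increment_le[OF convex_UNIV UNIV_I UNIV_I exp_i_real_vector_derivative])
    (simp add: norm_mult norm_exp_eq_Re)

text \<open>
  Half-open intervals of length \<open>\<epsilon>\<close>, enumerated by natural numbers because
  projection-valued measures are additive over sequences.
\<close>

definition grid_cell :: "real \<Rightarrow> nat \<Rightarrow> real set" where
  "grid_cell \<epsilon> i = {x. \<lfloor>x / \<epsilon>\<rfloor> = int_decode i}"

definition grid_point :: "real \<Rightarrow> nat \<Rightarrow> real" where
  "grid_point \<epsilon> i = \<epsilon> * of_int (int_decode i)"

lemma grid_cell_borel [measurable]: "grid_cell \<epsilon> i \<in> sets borel"
  unfolding grid_cell_def by measurable

lemma range_grid_cell: "range (grid_cell \<epsilon>) \<subseteq> sets borel"
  using grid_cell_borel by blast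

lemma disjoint_grid_cell: "disjoint_family (grid_cell \<epsilon>)"
  by (auto simp: disjoint_family_on_def grid_cell_def int_decode_eq)

lemma UN_grid_cell: "(\<Union>i. grid_cell \<epsilon> i) = UNIV"
proof (intro set_eqI iffI UNIV_I)
  fix x show "x \<in> (\<Union>i. grid_cell \<epsilon> i)"
    by (intro UN_I[of "int_encode \<lfloor>x / \<epsilon>\<rfloor>"]) (auto simp: grid_cell_def)
qed

lemma grid_cell_near: "0 < \<epsilon> \<Longrightarrow> x \<in> grid_cell \<epsilon> i \<Longrightarrow> \<bar>x - grid_point \<epsilon> i\<bar> \<le> \<epsilon>"
proof -
  assume e: "0 < \<epsilon>" and x: "x \<in> grid_cell \<epsilon> i"
  have "of_int (int_decode i) \<le> x / \<epsilon>" "x / \<epsilon> < of_int (int_decode i) + 1"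
    using x by (auto simp: grid_cell_def floor_eq_iff)
  then show ?thesis using e by (simp add: grid_point_def field_simps abs_le_iff)
qed

context pvm
begin

text \<open>
  Cauchy-Schwarz followed by the inequality of arithmetic and geometric means: the bound is additive
  in \<open>B\<close>, so over a partition it sums to a multiple of the squared norms of
  \<open>f\<close> and \<open>w\<close>.
\<close>

lemma P_pairing_le:
  assumes "B \<in> sets borel" "f \<in> L2" "q \<in> L2" "0 \<le> e"
    and "mass B q \<le> 2 * e\<^sup>2 * mass B w" "w \<in> L2"
  shows "norm (L2_inner (P B f) q) \<le> e * (mass B f + mass B w)"
proof -
  let ?a = "sqrt (mass B f)" and ?b = "sqrt (mass B w)"
  have n: "0 \<le> mass B f" "0 \<le> mass B w" using assms by (auto intro: mass_nonneg)
  have "norm (L2_inner (P B f) q) \<le> ?a * sqrt (mass B q)"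
    using assms by (intro P_Cauchy_Schwarz)
  also have "\<dots> \<le> ?a * (2 * e * ?b)"
  proof (intro mult_left_mono)
    have "sqrt (mass B q) \<le> sqrt ((2 * e)\<^sup>2 * mass B w)"
    proof (rule real_sqrt_le_mono)
      have "0 \<le> e\<^sup>2 * mass B w" using n by simp
      with assms(5) show "mass B q \<le> (2 * e)\<^sup>2 * mass B w" by (simp add: power_mult_distrib)
    qed
    then show "sqrt (mass B q) \<le> 2 * e * ?b" using assms(4) by (simp add: real_sqrt_mult)
  qed (use n in simp)
  also have "\<dots> = e * (2 * ?a * ?b)" by simp
  also have "\<dots> \<le> e * (mass B f + mass B w)"
    using sum_squares_bound[of ?a ?b] n assms(4) by (intro mult_left_mono) auto
  finally show ?thesis .
qed

text \<open>
  Formally \<open>w t = exp (- i t A) (w 0)\<close> and \<open>g = exp (- i t A) f\<close>, and the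
  exponential is unitary. To argue with nothing but the spectral resolution, cut the line into cells
  of length \<open>\<epsilon>\<close>. On the subspace of the cell at \<open>c\<close> the operator
  is \<open>c\<close> up to \<open>\<epsilon>\<close>, so the sum \<open>F\<close> of the terms
  \<open>exp (- i c s)\<close> times the pairing of \<open>P f\<close> with \<open>w s\<close> has a
  derivative of order \<open>\<epsilon>\<close>. As the range of cells exhausts the line, its value
  at \<open>0\<close> tends to the pairing of \<open>f\<close> with \<open>w 0\<close>, and its
  value at \<open>t\<close> differs in the limit from the pairing of \<open>g\<close> with \<open>w
  t\<close> by order \<open>\<epsilon>\<close>.
\<close>

theorem spectral_flow_pairing:
  fixes w v :: "real \<Rightarrow> 'a \<Rightarrow> complex"
  assumes t: "0 \<le> t"
    and fg: "(f, g) \<in> spectral_integral P (\<lambda>x. exp (- \<i> * complex_of_real t * complex_of_real x))"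
    and dom: "\<And>s. s \<in> {0..t} \<Longrightarrow> (w s, v s) \<in> spectral_integral P complex_of_real"
    and bound: "\<And>s. s \<in> {0..t} \<Longrightarrow> Re (L2_inner (w s) (w s)) \<le> M"
    and deriv: "\<And>s h. s \<in> {0..t} \<Longrightarrow> h \<in> L2 \<Longrightarrow>
       ((\<lambda>s. L2_inner h (w s)) has_vector_derivative \<i> * L2_inner h (v s)) (at s within {0..t})"
  shows "L2_inner g (w t) = L2_inner f (w 0)"
proof -
  have f: "f \<in> L2" and g: "g \<in> L2" using fg by (auto simp: spectral_integral_def)
  have w: "w s \<in> L2" and v: "v s \<in> L2" if "s \<in> {0..t}" for s
    using dom[OF that] by (auto simp: spectral_integral_def)
  have w0: "w 0 \<in> L2" and wt: "w t \<in> L2" using w t by auto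
  define K where "K = Re (L2_inner f f) + M"
  have small: "norm (L2_inner g (w t) - L2_inner f (w 0)) \<le> 2 * t * K * \<epsilon>" if \<epsilon>: "0 < \<epsilon>" for \<epsilon>
  proof -
    let ?A = "grid_cell \<epsilon>" and ?c = "grid_point \<epsilon>"
    let ?ph = "\<lambda>i s. exp (- \<i> * complex_of_real (?c i) * complex_of_real s)"
    have A[simp]: "?A i \<in> sets borel" for i by (rule grid_cell_borel)
    have Pf: "P (?A i) f \<in> L2" for i using f by (simp add: P_mem)
    define F where "F n s = (\<Sum>i<n. ?ph i s * L2_inner (P (?A i) f) (w s))" for n s
    define F' where "F' n s = (\<Sum>i<n. ?ph i s * (\<i> * L2_inner (P (?A i) f) (v s))
       + (- \<i> * of_real (?c i) * ?ph i s) * L2_inner (P (?A i) f) (w s))" for n s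
    have total: "(\<Sum>i<n. mass (?A i) f + mass (?A i) (w s)) \<le> K" if "s \<in> {0..t}" for n s
      using mass_sum_le[OF f range_grid_cell disjoint_grid_cell, of \<epsilon> n]
        mass_sum_le[OF w[OF that] range_grid_cell disjoint_grid_cell, of \<epsilon> n] bound[OF that]
      by (simp add: K_def sum.distrib)
    have bF': "norm (F' n s) \<le> \<epsilon> * K" if s: "s \<in> {0..t}" for n s
    proof -
      have "F' n s = (\<Sum>i<n. \<i> * ?ph i s * L2_inner (P (?A i) f) (\<lambda>z. v s z - of_real (?c i) * w s z))"
        unfolding F'_def
        by (intro sum.cong refl)
          (simp only: L2.diff_right L2.scale_right L2.scale_mem Pf v[OF s] w[OF s], simp add: algebra_simps)
      also have "norm \<dots> \<le> (\<Sum>i<n. \<epsilon> * (mass (?A i) f + mass (?A i) (w s)))"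
      proof (rule sum_norm_le)
        fix i
        have "norm (L2_inner (P (?A i) f) (\<lambda>z. v s z - of_real (?c i) * w s z))
            \<le> \<epsilon> * (mass (?A i) f + mass (?A i) (w s))"
        proof (rule P_pairing_le)
          show "mass (?A i) (\<lambda>z. v s z - of_real (?c i) * w s z) \<le> 2 * \<epsilon>\<^sup>2 * mass (?A i) (w s)"
          proof (rule mass_spectral_integral_le[OF dom[OF s]])
            show "norm (complex_of_real x - of_real (?c i)) \<le> \<epsilon>" if "x \<in> ?A i" for x
              using grid_cell_near[OF \<epsilon> that] by (simp flip: of_real_diff)
          qed auto
          show "(\<lambda>z. v s z - of_real (?c i) * w s z) \<in> L2"
            by (intro L2.diff_scale_mem v w s)
        qed (use \<epsilon> f w s in auto)
        then show "norm (\<i> * ?ph i s * L2_inner (P (?A i) f) (\<lambda>z. v s z - of_real (?c i) * w s z))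
            \<le> \<epsilon> * (mass (?A i) f + mass (?A i) (w s))"
          by (simp add: norm_mult norm_exp_eq_Re)
      qed
      also have "\<dots> \<le> \<epsilon> * K"
        using total[OF s, of n] \<epsilon> by (simp add: sum_distrib_left[symmetric])
      finally show ?thesis .
    qed
    have dF: "(F n has_vector_derivative F' n s) (at s within {0..t})" if s: "s \<in> {0..t}" for n s
      unfolding F_def[abs_def] F'_def
      by (intro has_vector_derivative_sum has_vector_derivative_mult exp_i_real_vector_derivative
          deriv[OF s Pf])
    have incr: "norm (F n t - F n 0) \<le> \<epsilon> * K * t" for n
      using vector_derivative_increment_le[of "{0..t}" 0 t "F n" "F' n" "\<epsilon> * K", OF _ _ _ dF bF'] t by simp
    have endpoint: "norm ((\<Sum>i<n. L2_inner (P (?A i) g) (w t)) - F n t) \<le> t * \<epsilon> * K" for n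
    proof -
      let ?q = "\<lambda>i z. g z - ?ph i t * f z"
      have q: "?q i \<in> L2" for i by (intro L2.diff_scale_mem f g)
      have "(\<Sum>i<n. L2_inner (P (?A i) g) (w t)) - F n t = (\<Sum>i<n. L2_inner (P (?A i) (?q i)) (w t))"
      proof -
        have "L2_inner (P (?A i) (?q i)) (w t) = L2_inner (P (?A i) g) (w t) - ?ph i t * L2_inner (P (?A i) f) (w t)" for i
        proof -
          interpret b: semi_inner L2 "\<lambda>f g. L2_inner (P (?A i) f) g" by (rule P_semi_inner[OF A])
          show ?thesis by (simp only: b.diff_left b.scale_left L2.scale_mem f g wt)
        qed
        then show ?thesis by (simp add: F_def sum_subtractf)
      qed
      also have "norm \<dots> \<le> (\<Sum>i<n. t * \<epsilon> * (mass (?A i) f + mass (?A i) (w t)))"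
      proof (rule sum_norm_le)
        fix i
        have "norm (L2_inner (P (?A i) (?q i)) (w t)) = norm (L2_inner (P (?A i) (w t)) (?q i))"
          using L2.herm[OF P_mem[OF A q] wt] P_sym[OF A q wt] P_sym[OF A wt q] 
            L2.herm[OF q P_mem[OF A wt], of i i]
          by (metis complex_mod_cnj)
        also have "\<dots> \<le> t * \<epsilon> * (mass (?A i) (w t) + mass (?A i) f)"
        proof (rule P_pairing_le)
          show "mass (?A i) (?q i) \<le> 2 * (t * \<epsilon>)\<^sup>2 * mass (?A i) f"
          proof (rule mass_spectral_integral_le[OF fg])
            fix x assume x: "x \<in> ?A i"
            have "norm (exp (- \<i> * of_real t * of_real x) - exp (- \<i> * of_real t * of_real (?c i))) \<le> \<bar>t\<bar> * \<bar>x - ?c i\<bar>"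
              by (rule norm_exp_i_diff_le)
            also have "\<dots> \<le> t * \<epsilon>"
              using grid_cell_near[OF \<epsilon> x] t by (auto intro: mult_mono)
            finally show "norm (exp (- \<i> * of_real t * of_real x) - ?ph i t) \<le> t * \<epsilon>"
              by (simp add: mult_ac)
          qed auto
        qed (use t \<epsilon> f wt q in auto)
        finally show "norm (L2_inner (P (?A i) (?q i)) (w t)) \<le> t * \<epsilon> * (mass (?A i) f + mass (?A i) (w t))"
          by (simp add: add.commute)
      qed
      also have "\<dots> \<le> t * \<epsilon> * K"
        using total[of t n] \<epsilon> t by (simp add: sum_distrib_left[symmetric] mult_left_mono)
      finally show ?thesis .
    qed
    have F0: "F n 0 = (\<Sum>i<n. L2_inner (P (?A i) f) (w 0))" for n by (simp add: F_def)
    have conv: "(\<lambda>n. \<Sum>i<n. L2_inner (P (?A i) h) k) \<longlonglongrightarrow> L2_inner h k" if "h \<in> L2" "k \<in> L2" for h k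
      using P_sums[OF range_grid_cell disjoint_grid_cell that] that
      by (simp add: UN_grid_cell sums_def P_UNIV)
    show ?thesis
    proof (rule LIMSEQ_le_const2)
      show "(\<lambda>n. norm ((\<Sum>i<n. L2_inner (P (?A i) g) (w t)) - (\<Sum>i<n. L2_inner (P (?A i) f) (w 0))))
          \<longlonglongrightarrow> norm (L2_inner g (w t) - L2_inner f (w 0))"
        by (intro tendsto_intros conv f g w0 wt)
      have "norm ((\<Sum>i<n. L2_inner (P (?A i) g) (w t)) - (\<Sum>i<n. L2_inner (P (?A i) f) (w 0)))
          \<le> 2 * t * K * \<epsilon>" for n
      proof -
        have "norm (a - F n 0) \<le> norm (a - F n t) + norm (F n t - F n 0)" for a
          by (metis diff_add_cancel add_diff_eq norm_triangle_ineq)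
        from this[of "\<Sum>i<n. L2_inner (P (?A i) g) (w t)"] show ?thesis
          using endpoint[of n] incr[of n] unfolding F0 by (simp add: mult_ac)
      qed
      then show "\<exists>N. \<forall>n\<ge>N. norm ((\<Sum>i<n. L2_inner (P (?A i) g) (w t)) - (\<Sum>i<n. L2_inner (P (?A i) f) (w 0)))
          \<le> 2 * t * K * \<epsilon>" by blast
    qed
  qed
  have "norm (L2_inner g (w t) - L2_inner f (w 0)) \<le> 0"
  proof (rule tendsto_lowerbound)
    show "((\<lambda>\<epsilon>. 2 * t * K * \<epsilon>) \<longlongrightarrow> 0) (at_right 0)"
      by (auto intro!: tendsto_eq_intros)
    show "\<forall>\<^sub>F \<epsilon> in at_right 0. norm (L2_inner g (w t) - L2_inner f (w 0)) \<le> 2 * t * K * \<epsilon>"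
      using eventually_at_right_less[of 0] by eventually_elim (rule small)
  qed simp
  then show ?thesis by simp
qed

text \<open>
  The exponential is bounded by \<open>1\<close>, so the mass estimate applies on the whole line
  with \<open>k = 0\<close>.
\<close>

lemma spectral_integral_zero:
  assumes fg: "(f, g) \<in> spectral_integral P (\<lambda>x. exp (- \<i> * complex_of_real t * complex_of_real x))"
    and f0: "AE z in lebesgue. f z = 0"
  shows "AE z in lebesgue. g z = 0"
proof -
  have f: "f \<in> L2" and g: "g \<in> L2" using fg by (auto simp: spectral_integral_def)
  have "mass UNIV (\<lambda>z. g z - 0 * f z) \<le> 2 * 1\<^sup>2 * mass UNIV f"
    by (rule mass_spectral_integral_le[OF fg]) (auto simp: norm_exp_eq_Re)
  moreover have "mass UNIV f = 0"
    using f f0 ip_self_zero_iff[of f lebesgue] P_UNIV[OF f f]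
    by (simp add: mass_def L2_inner_eq_ip L2_eq_sqint)
  ultimately have "Re (L2_inner g g) \<le> 0" using g by (simp add: mass_def P_UNIV)
  then have "Re (L2_inner g g) = 0" using L2.nonneg[OF g] by linarith
  then show ?thesis
    using g ip_self_zero_iff[of g lebesgue] by (simp add: L2_inner_eq_ip L2_eq_sqint)
qed

end

section \<open>Gaussian decay\<close>

text \<open>
  The function is at most \<open>exp (- c n)\<close> on the part of the ball of radius \<open>n +
  1\<close> where the norm is at least \<open>n\<close>, and the volumes of these balls grow only
  polynomially.
\<close>

lemma integrable_exp_minus_norm:
  fixes c :: real
  assumes c: "0 < c"
  shows "integrable lborel (\<lambda>z::'a::euclidean_space. exp (- c * norm z))"
proof (rule integrableI_nonneg)
  let ?D = "DIM('a)"
  let ?v = "unit_ball_vol (real ?D)"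
  let ?a = "\<lambda>n::nat. exp (- c * real n) * (?v * (real n + 1) ^ ?D)"
  have "((\<lambda>x::real. x ^ ?D / exp x) \<longlongrightarrow> 0) at_top" by (rule tendsto_power_div_exp_0)
  moreover have "filterlim (\<lambda>n. c / 2 * (real n + 1)) at_top sequentially"
    using c by (intro filterlim_tendsto_pos_mult_at_top[OF tendsto_const])
      (auto intro!: filterlim_tendsto_add_at_top filterlim_real_sequentially simp: add.commute)
  ultimately have "((\<lambda>n. (c / 2 * (real n + 1)) ^ ?D / exp (c / 2 * (real n + 1))) \<longlongrightarrow> 0) sequentially"
    by (rule filterlim_compose)
  then have ev: "\<forall>\<^sub>F n in sequentially. (c / 2 * (real n + 1)) ^ ?D / exp (c / 2 * (real n + 1)) < 1"
    by (rule order_tendstoD) simp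
  have "summable ?a"
  proof (rule summable_comparison_test_ev)
    show "\<forall>\<^sub>F n in sequentially. norm (?a n) \<le> ?v * (2 / c) ^ ?D * exp (c / 2) * exp (- c / 2) ^ n"
      using ev
    proof eventually_elim
      case (elim n)
      have v: "0 \<le> ?v" by simp
      have "(real n + 1) ^ ?D = (2 / c) ^ ?D * (c / 2 * (real n + 1)) ^ ?D"
      proof -
        have "2 / c * (c / 2 * (real n + 1)) = real n + 1" using c by simp
        then show ?thesis by (simp only: power_mult_distrib[symmetric])
      qed
      also have "\<dots> \<le> (2 / c) ^ ?D * exp (c / 2 * (real n + 1))"
        using elim c by (intro mult_left_mono) (auto simp: divide_less_eq)
      finally have "?a n \<le> exp (- c * real n) * (?v * ((2 / c) ^ ?D * exp (c / 2 * (real n + 1))))"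
        using v by (intro mult_left_mono) auto
      also have "\<dots> = ?v * (2 / c) ^ ?D * (exp (- c * real n) * exp (c / 2 * (real n + 1)))"
        by simp
      also have "exp (- c * real n) * exp (c / 2 * (real n + 1)) = exp (c / 2) * exp (- c / 2) ^ n"
        by (simp add: exp_add[symmetric] exp_of_nat_mult[symmetric] field_simps)
      finally show ?case using v by (simp add: abs_mult mult.assoc)
    qed
    show "summable (\<lambda>n. ?v * (2 / c) ^ ?D * exp (c / 2) * exp (- c / 2) ^ n)"
      using c by (intro summable_mult summable_geometric) simp
  qed
  then have fin: "(\<Sum>n. ennreal (?a n)) < \<infinity>"
    by (subst suminf_ennreal2) auto
  have le: "ennreal (exp (- c * norm z)) \<le> (\<Sum>n. ennreal (exp (- c * real n)) * indicator (cball 0 (real n + 1)) z)" for z :: 'a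
  proof -
    define n where "n = nat \<lfloor>norm z\<rfloor>"
    have n: "real n \<le> norm z" "norm z \<le> real n + 1"
      unfolding n_def by (simp add: of_nat_floor) linarith
    have "ennreal (exp (- c * norm z)) \<le> ennreal (exp (- c * real n)) * indicator (cball 0 (real n + 1)) z"
      using n c by (auto simp: ennreal_leI)
    also have "\<dots> \<le> (\<Sum>n. ennreal (exp (- c * real n)) * indicator (cball 0 (real n + 1)) z)"
    proof -
      have "h n \<le> suminf h" for h :: "nat \<Rightarrow> ennreal"
        using sum_le_suminf[of h "{n}"] by (simp add: summableI)
      then show ?thesis .
    qed
    finally show ?thesis .
  qed
  have "(\<integral>\<^sup>+(z::'a). ennreal (exp (- c * norm z)) \<partial>lborel)
      \<le> (\<integral>\<^sup>+(z::'a). (\<Sum>n. ennreal (exp (- c * real n)) * indicator (cball 0 (real n + 1)) z) \<partial>lborel)"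
    by (intro nn_integral_mono le)
  also have "\<dots> = (\<Sum>n. \<integral>\<^sup>+(z::'a). ennreal (exp (- c * real n)) * indicator (cball 0 (real n + 1)) z \<partial>lborel)"
    by (intro nn_integral_suminf borel_measurable_times_ennreal borel_measurable_indicator) auto
  also have "\<dots> = (\<Sum>n. ennreal (?a n))"
    by (intro suminf_cong) (simp add: nn_integral_cmult_indicator emeasure_cball ennreal_mult)
  also note fin
  finally show "(\<integral>\<^sup>+(z::'a). ennreal (exp (- c * norm z)) \<partial>lborel) < \<infinity>" .
qed auto

lemma borel_measurable_lebesgueI:
  "f \<in> borel_measurable borel \<Longrightarrow> f \<in> borel_measurable (lebesgue :: 'a::euclidean_space measure)"
  by (rule measurable_completion) simp

lemma sqint_lborel_imp_L2: "f \<in> sqint lborel \<Longrightarrow> f \<in> L2"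
  by (auto simp: sqint_def L2_def integrable_completion borel_measurable_lebesgueI)

lemma exp_minus_norm_sqint:
  "(\<lambda>z::'a::euclidean_space. complex_of_real (C * exp (- norm z))) \<in> sqint lborel"
proof -
  have "(norm (complex_of_real (C * exp (- norm z))))\<^sup>2 = C\<^sup>2 * exp (- 2 * norm z)" for z :: 'a
    by (simp add: norm_mult power_mult_distrib exp_of_nat_mult[symmetric])
  then show ?thesis
    using integrable_exp_minus_norm[of 2, where 'a = 'a] by (simp add: sqint_def)
qed

text \<open>
  By completing the square. Every Gaussian with a quadratic factor is thus dominated by a multiple
  of \<open>exp (- norm z)\<close>, the majorant for all applications of dominated convergence
  below.
\<close>

lemma polynomial_gaussian_bound:
  fixes a z :: "'a::real_normed_vector"
  assumes c: "0 < c"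
  shows "(1 + norm z)\<^sup>2 * exp (- c * (norm (z - a))\<^sup>2) \<le> exp (3 * norm a + 9 / (4 * c)) * exp (- norm z)"
proof -
  let ?u = "norm (z - a)"
  have u: "norm z \<le> ?u + norm a" by (metis diff_add_cancel norm_triangle_ineq)
  have "(1 + norm z)\<^sup>2 \<le> (exp (norm z))\<^sup>2"
    by (intro power_mono) (auto simp: exp_ge_add_one_self)
  also have "\<dots> = exp (2 * norm z)" by (simp add: exp_of_nat_mult[symmetric])
  finally have "(1 + norm z)\<^sup>2 * exp (- c * ?u\<^sup>2) \<le> exp (2 * norm z) * exp (- c * ?u\<^sup>2)"
    by (rule mult_right_mono) simp
  also have "\<dots> = exp (2 * norm z - c * ?u\<^sup>2)" by (simp add: exp_add[symmetric])
  also have "\<dots> \<le> exp (3 * norm a + 9 / (4 * c) - norm z)"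
  proof -
    have "0 \<le> c * (?u - 3 / (2 * c))\<^sup>2" using c by simp
    also have "\<dots> = c * ?u\<^sup>2 - 3 * ?u + 9 / (4 * c)"
      using c by (simp add: power2_eq_square field_simps)
    finally show ?thesis using u by simp
  qed
  also have "\<dots> = exp (3 * norm a + 9 / (4 * c)) * exp (- norm z)" by (simp add: exp_add[symmetric])
  finally show ?thesis .
qed

lemma L2_dominated_convergence:
  fixes f :: "nat \<Rightarrow> 'a::euclidean_space \<Rightarrow> complex"
  assumes "\<And>n. f n \<in> borel_measurable lebesgue" "g \<in> borel_measurable lebesgue"
    and "h \<in> L2" "\<And>n z. norm (f n z - g z) \<le> norm (h z)"
    and "\<And>z. (\<lambda>n. f n z) \<longlonglongrightarrow> g z"
  shows "(\<lambda>n. L2_norm (\<lambda>z. f n z - g z)) \<longlonglongrightarrow> 0"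
proof -
  have "(\<lambda>n. LINT z|lebesgue. (norm (f n z - g z))\<^sup>2) \<longlonglongrightarrow> (LINT z|(lebesgue :: 'a measure). 0)"
  proof (rule integral_dominated_convergence)
    show "integrable lebesgue (\<lambda>z. (norm (h z))\<^sup>2)" using assms(3) by (simp add: L2_def)
    show "AE z in lebesgue. (\<lambda>n. (norm (f n z - g z))\<^sup>2) \<longlonglongrightarrow> 0"
      using assms(5) by (intro AE_I2) (auto intro!: tendsto_eq_intros simp: LIM_zero)
    show "AE z in lebesgue. norm ((norm (f n z - g z))\<^sup>2) \<le> (norm (h z))\<^sup>2" for n
      using assms(4) by (intro AE_I2) (simp add: power_mono)
  qed (use assms in measurable)
  from tendsto_real_sqrt[OF this] show ?thesis by (simp add: L2_norm_def)
qed

section \<open>Smooth functions of compact support\<close>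

text \<open>
  The derivative of \<open>exp (- 1 / x) / x ^ m\<close> is a combination of two functions of the
  same form. Hence the family is closed under differentiation, and all its members are smooth.
\<close>

definition flat :: "nat \<Rightarrow> real \<Rightarrow> real" where
  "flat m x = (if 0 < x then exp (- (1 / x)) / x ^ m else 0)"

lemma flat_nonneg: "0 \<le> flat m x" by (simp add: flat_def)

lemma flat_tendsto_0: "(flat m \<longlongrightarrow> 0) (at 0)"
proof -
  have "((\<lambda>x::real. x ^ m / exp x) \<longlongrightarrow> 0) at_top" by (rule tendsto_power_div_exp_0)
  from filterlim_compose[OF this filterlim_inverse_at_top_right]
  have "((\<lambda>x::real. (inverse x) ^ m / exp (inverse x)) \<longlongrightarrow> 0) (at_right 0)" .
  moreover have "\<forall>\<^sub>F x in at_right (0::real). (inverse x) ^ m / exp (inverse x) = flat m x"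
    using eventually_at_right_less[of 0]
    by eventually_elim (simp add: flat_def exp_minus field_simps)
  ultimately have r: "(flat m \<longlongrightarrow> 0) (at_right 0)" by (simp cong: tendsto_cong)
  have "\<forall>\<^sub>F x in at_left (0::real). flat m x = 0"
    by (auto simp: flat_def eventually_at_filter)
  then have "(flat m \<longlongrightarrow> 0) (at_left 0)" by (simp add: tendsto_eventually)
  with r show ?thesis by (simp add: filterlim_split_at)
qed

lemma flat_has_derivative:
  "(flat m has_real_derivative flat (m + 2) x - real m * flat (m + 1) x) (at x)"
proof -
  consider "0 < x" | "x < 0" | "x = 0" by linarith
  then show ?thesis
  proof cases
    case 1
    have "((\<lambda>x. exp (- (1 / x)) / x ^ m) has_real_derivative flat (m + 2) x - real m * flat (m + 1) x) (at x)"
    proof (cases m)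
      case 0
      then show ?thesis using 1
        by (auto intro!: derivative_eq_intros simp: flat_def power2_eq_square field_simps)
    next
      case (Suc k)
      then show ?thesis using 1
        by (auto intro!: derivative_eq_intros simp: flat_def power2_eq_square field_simps)
          (cases k; simp)
    qed
    then show ?thesis
      by (rule has_field_derivative_transform_within_open[where S = "{0<..}"])
        (use 1 in \<open>auto simp: flat_def\<close>)
  next
    case 2
    have "((\<lambda>x. 0) has_real_derivative flat (m + 2) x - real m * flat (m + 1) x) (at x)"
      using 2 by (simp add: flat_def)
    then show ?thesis
      by (rule has_field_derivative_transform_within_open[where S = "{..<0}"])
        (use 2 in \<open>auto simp: flat_def\<close>)
  next
    case 3
    have "((\<lambda>h. (flat m (0 + h) - flat m 0) / h) \<longlongrightarrow> 0) (at 0)"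
    proof (rule Lim_transform_eventually[OF flat_tendsto_0[of "Suc m"]])
      show "\<forall>\<^sub>F x in at 0. flat (Suc m) x = (flat m (0 + x) - flat m 0) / x"
        by (auto simp: flat_def eventually_at_filter)
    qed
    then show ?thesis using 3 by (simp add: DERIV_def flat_def)
  qed
qed

lemma flat_continuous: "continuous_on A (flat m)"
  by (intro continuous_at_imp_continuous_on ballI DERIV_isCont[OF flat_has_derivative])

lemma flat_continuous_compose [continuous_intros]:
  "continuous_on A f \<Longrightarrow> continuous_on A (\<lambda>x. flat m (f x))"
  by (rule continuous_on_compose2[OF flat_continuous[of UNIV]]) auto

lemma flat_bounded: "\<exists>C\<ge>0. \<forall>x\<le>1. flat m x \<le> C"
proof -
  have "compact (flat m ` {0..1})" by (intro compact_continuous_image flat_continuous) auto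
  then have "bounded (flat m ` {0..1})" by (rule compact_imp_bounded)
  then obtain C where "\<forall>y \<in> flat m ` {0..1}. norm y \<le> C" unfolding bounded_iff by blast
  then have C: "\<bar>flat m x\<bar> \<le> C" if "x \<in> {0..1}" for x using that by simp
  have "flat m x \<le> max C 0" if "x \<le> 1" for x
  proof (cases "0 \<le> x")
    case True then show ?thesis using C[of x] that by auto
  next
    case False then show ?thesis by (simp add: flat_def)
  qed
  then show ?thesis by (intro exI[of _ "max C 0"]) auto
qed

text \<open>
  An algebra of functions that contains the Gaussians and their cutoffs and is closed under partial
  derivatives. Closure alone gives derivatives of every order.
\<close>

inductive smooth_alg :: "('a::euclidean_space \<Rightarrow> complex) \<Rightarrow> bool" where
  const: "smooth_alg (\<lambda>_. c)"
| coord: "smooth_alg (\<lambda>z. of_real (z \<bullet> b))"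
| add: "smooth_alg f \<Longrightarrow> smooth_alg g \<Longrightarrow> smooth_alg (\<lambda>z. f z + g z)"
| mult: "smooth_alg f \<Longrightarrow> smooth_alg g \<Longrightarrow> smooth_alg (\<lambda>z. f z * g z)"
| exp: "smooth_alg f \<Longrightarrow> smooth_alg (\<lambda>z. exp (f z))"
| flat: "smooth_alg (\<lambda>z. of_real (flat m (1 - r * (z \<bullet> z))))"

lemma flat_comp_has_derivative:
  "((\<lambda>z::'a::real_inner. complex_of_real (flat m (1 - r * (z \<bullet> z)))) has_derivative
     (\<lambda>h. of_real ((flat (m + 2) (1 - r * (z \<bullet> z)) - real m * flat (m + 1) (1 - r * (z \<bullet> z)))
        * (- (2 * r) * (z \<bullet> h))))) (at z)"
proof -
  have i: "((\<lambda>z::'a. 1 - r * (z \<bullet> z)) has_derivative (\<lambda>h. - (2 * r) * (z \<bullet> h))) (at z)"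
    by (auto intro!: derivative_eq_intros simp: inner_commute)
  have "(flat m has_derivative (\<lambda>h. (flat (m + 2) (1 - r * (z \<bullet> z)) - real m * flat (m + 1) (1 - r * (z \<bullet> z))) * h))
      (at (1 - r * (z \<bullet> z)))"
    using flat_has_derivative[of m] by (simp add: has_field_derivative_def)
  from has_derivative_compose[OF i this] show ?thesis
    by (rule has_derivative_of_real)
qed

lemma smooth_alg_has_derivative:
  "smooth_alg f \<Longrightarrow> \<exists>D. (\<forall>z. (f has_derivative D z) (at z)) \<and> (\<forall>b. smooth_alg (\<lambda>z. D z b))"
proof (induction rule: smooth_alg.induct)
  case (const c)
  show ?case by (intro exI[of _ "\<lambda>z h. 0"]) (auto intro: smooth_alg.const)
next
  case (coord b)
  show ?case
    by (intro exI[of _ "\<lambda>z h. of_real (h \<bullet> b)"])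
      (auto intro!: derivative_eq_intros smooth_alg.const)
next
  case (add f g)
  then obtain D E where "\<forall>z. (f has_derivative D z) (at z)" "\<forall>b. smooth_alg (\<lambda>z. D z b)"
    "\<forall>z. (g has_derivative E z) (at z)" "\<forall>b. smooth_alg (\<lambda>z. E z b)" by blast
  then show ?case
    by (intro exI[of _ "\<lambda>z h. D z h + E z h"]) (auto intro!: has_derivative_add smooth_alg.add)
next
  case (mult f g)
  then obtain D E where "\<forall>z. (f has_derivative D z) (at z)" "\<forall>b. smooth_alg (\<lambda>z. D z b)"
    "\<forall>z. (g has_derivative E z) (at z)" "\<forall>b. smooth_alg (\<lambda>z. E z b)" by blast
  with mult show ?case
    by (intro exI[of _ "\<lambda>z h. f z * E z h + D z h * g z"])
      (auto intro!: has_derivative_mult smooth_alg.add smooth_alg.mult)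
next
  case (exp f)
  then obtain D where D: "\<forall>z. (f has_derivative D z) (at z)" "\<forall>b. smooth_alg (\<lambda>z. D z b)" by blast
  have "((\<lambda>z. exp (f z)) has_derivative (\<lambda>h. exp (f z) * D z h)) (at z)" for z
    using has_derivative_compose[OF D(1)[rule_format] DERIV_exp[unfolded has_field_derivative_def]] .
  with D exp show ?case
    by (intro exI[of _ "\<lambda>z h. exp (f z) * D z h"]) (auto intro!: smooth_alg.mult smooth_alg.exp)
next
  case (flat m r)
  have "smooth_alg (\<lambda>z. of_real ((flat (m + 2) (1 - r * (z \<bullet> z)) - real m * flat (m + 1) (1 - r * (z \<bullet> z)))
        * (- (2 * r) * (z \<bullet> b))))" for b :: 'a
  proof -
    have "smooth_alg (\<lambda>z. (of_real (flat (m + 2) (1 - r * (z \<bullet> z)))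
       + - of_real (real m) * of_real (flat (m + 1) (1 - r * (z \<bullet> z)))) * (of_real (- (2 * r)) * of_real (z \<bullet> b)))"
      by (intro smooth_alg.intros)
    then show ?thesis by simp
  qed
  then show ?case using flat_comp_has_derivative
    by (intro exI[of _ "\<lambda>z h. of_real ((flat (m + 2) (1 - r * (z \<bullet> z)) - real m * flat (m + 1) (1 - r * (z \<bullet> z)))
        * (- (2 * r) * (z \<bullet> h)))"] conjI allI)
qed

lemma dir_deriv_eq: "(f has_derivative D) (at z) \<Longrightarrow> dir_deriv b f z = D b"
  unfolding dir_deriv_def using frechet_derivative_at by metis

lemma smooth_alg_differentiable: "smooth_alg f \<Longrightarrow> f differentiable (at z)"
  using smooth_alg_has_derivative[of f] by (auto simp: differentiable_def)

lemma smooth_alg_continuous: "smooth_alg f \<Longrightarrow> continuous_on A f"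
  by (intro continuous_at_imp_continuous_on ballI differentiable_imp_continuous_within
      smooth_alg_differentiable)

lemma smooth_alg_dir_deriv: "smooth_alg f \<Longrightarrow> smooth_alg (dir_deriv b f)"
proof -
  assume "smooth_alg f"
  then obtain D where D: "\<forall>z. (f has_derivative D z) (at z)" "\<forall>b. smooth_alg (\<lambda>z. D z b)"
    using smooth_alg_has_derivative by blast
  then have "dir_deriv b f = (\<lambda>z. D z b)" by (auto simp: fun_eq_iff dir_deriv_eq)
  then show ?thesis using D by simp
qed

lemma smooth_alg_C_k: "smooth_alg f \<Longrightarrow> C_k k f"
  by (induction k arbitrary: f)
    (auto intro: smooth_alg_continuous smooth_alg_differentiable smooth_alg_dir_deriv)

lemma smooth_alg_sum:
  "finite I \<Longrightarrow> (\<And>i. i \<in> I \<Longrightarrow> smooth_alg (f i)) \<Longrightarrow> smooth_alg (\<lambda>z. \<Sum>i\<in>I. f i z)"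
  by (induction I rule: finite_induct) (auto intro: smooth_alg.const smooth_alg.add)

lemma smooth_alg_inner_self: "smooth_alg (\<lambda>z. of_real (z \<bullet> z))"
proof -
  have "smooth_alg (\<lambda>z::'a. \<Sum>b\<in>Basis. of_real (z \<bullet> b) * of_real (z \<bullet> b))"
    by (intro smooth_alg_sum smooth_alg.mult smooth_alg.coord) auto
  moreover have "(\<lambda>z::'a. \<Sum>b\<in>Basis. complex_of_real (z \<bullet> b) * of_real (z \<bullet> b)) = (\<lambda>z. of_real (z \<bullet> z))"
    by (simp add: fun_eq_iff euclidean_inner[of z z for z :: 'a])
  ultimately show ?thesis by simp
qed

section \<open>The special Hermite operator on Gaussians\<close>

text \<open>
  The real inner product of \<open>z\<close> with \<open>twist lam a\<close> is \<open>- lam /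
  2\<close> times the imaginary part of the sum of the \<open>z $ j * cnj (a $ j)\<close>.
  Translation by \<open>a\<close>, followed by multiplication with the exponential of
  \<open>\<i>\<close> times this phase, commutes with the special Hermite operator.
\<close>

definition twist :: "real \<Rightarrow> complex ^ 'd::finite \<Rightarrow> complex ^ 'd" where
  "twist lam a = (\<chi> j. - \<i> * of_real (lam / 2) * a $ j)"

text \<open>The twisted translate, by \<open>a\<close>, of a centred Gaussian with complex width.\<close>

definition wave :: "real \<Rightarrow> complex \<Rightarrow> complex ^ 'd::finite \<Rightarrow> complex \<Rightarrow> complex ^ 'd \<Rightarrow> complex" where
  "wave lam \<beta> a c z = c * exp (- \<beta> * of_real ((z - a) \<bullet> (z - a)) + \<i> * of_real (z \<bullet> twist lam a))"

text \<open>
  The derivative of \<open>wave\<close> in the direction \<open>b\<close>, divided by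
  \<open>wave\<close>.
\<close>

definition log_slope :: "real \<Rightarrow> complex \<Rightarrow> complex ^ 'd::finite \<Rightarrow> complex ^ 'd \<Rightarrow> complex ^ 'd \<Rightarrow> complex" where
  "log_slope lam \<beta> a b z = - 2 * \<beta> * of_real ((z - a) \<bullet> b) + \<i> * of_real (b \<bullet> twist lam a)"

text \<open>The factor by which the special Hermite operator multiplies \<open>wave\<close>.\<close>

definition symbol :: "real \<Rightarrow> complex \<Rightarrow> complex ^ 'd::finite \<Rightarrow> complex ^ 'd \<Rightarrow> complex" where
  "symbol lam \<beta> a z = 4 * \<beta> * of_nat CARD('d) - (4 * \<beta>\<^sup>2 - of_real (lam\<^sup>2 / 4)) * of_real ((z - a) \<bullet> (z - a))"

definition transport :: "real \<Rightarrow> complex \<Rightarrow> complex ^ 'd::finite \<Rightarrow> complex ^ 'd \<Rightarrow> complex" where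
  "transport lam \<beta> a z = of_nat CARD('d) - 2 * \<beta> * of_real (z \<bullet> (z - a)) + \<i> * of_real (z \<bullet> twist lam a)"

text \<open>The terms in which a derivative falls on the cutoff, divided by \<open>wave\<close>.\<close>

definition cutoff_error :: "real \<Rightarrow> complex \<Rightarrow> complex ^ 'd::finite \<Rightarrow> real \<Rightarrow> complex ^ 'd \<Rightarrow> complex" where
  "cutoff_error lam \<beta> a r z =
     - of_real (4 * r\<^sup>2 * (flat 4 (1 - r * (z \<bullet> z)) - 2 * flat 3 (1 - r * (z \<bullet> z))) * (z \<bullet> z))
     + of_real (4 * r * flat 2 (1 - r * (z \<bullet> z))) * transport lam \<beta> a z"

abbreviation flat_cut :: "nat \<Rightarrow> real \<Rightarrow> 'a::real_inner \<Rightarrow> complex" where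
  "flat_cut m r z \<equiv> of_real (flat m (1 - r * (z \<bullet> z)))"

lemma wave_has_derivative:
  "(wave lam \<beta> a c has_derivative (\<lambda>h. wave lam \<beta> a c z * log_slope lam \<beta> a h z)) (at z)"
proof -
  have i: "((\<lambda>z. - \<beta> * of_real ((z - a) \<bullet> (z - a)) + \<i> * of_real (z \<bullet> twist lam a))
      has_derivative (\<lambda>h. log_slope lam \<beta> a h z)) (at z)"
    unfolding log_slope_def
    by (auto intro!: derivative_eq_intros simp: inner_commute algebra_simps)
  have "((\<lambda>z. exp (- \<beta> * of_real ((z - a) \<bullet> (z - a)) + \<i> * of_real (z \<bullet> twist lam a))) has_derivative
     (\<lambda>h. exp (- \<beta> * of_real ((z - a) \<bullet> (z - a)) + \<i> * of_real (z \<bullet> twist lam a)) * log_slope lam \<beta> a h z)) (at z)"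
    using has_derivative_compose[OF i DERIV_exp[unfolded has_field_derivative_def]] .
  from has_derivative_mult_right[OF this, of c] show ?thesis
    by (simp add: wave_def[abs_def] mult.assoc)
qed

lemma log_slope_has_derivative:
  "(log_slope lam \<beta> a b has_derivative (\<lambda>h. - 2 * \<beta> * of_real (h \<bullet> b))) (at z)"
  unfolding log_slope_def[abs_def] by (auto intro!: derivative_eq_intros)

lemma dir_deriv_cut_wave:
  "dir_deriv b (\<lambda>z. flat_cut 0 r z * wave lam \<beta> a c z) z
     = (flat_cut 2 r z * of_real (- 2 * r * (z \<bullet> b)) + flat_cut 0 r z * log_slope lam \<beta> a b z) * wave lam \<beta> a c z"
proof -
  have "((\<lambda>z. flat_cut 0 r z * wave lam \<beta> a c z) has_derivative
     (\<lambda>h. flat_cut 0 r z * (wave lam \<beta> a c z * log_slope lam \<beta> a h z)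
       + of_real ((flat (0 + 2) (1 - r * (z \<bullet> z)) - real 0 * flat (0 + 1) (1 - r * (z \<bullet> z))) * (- (2 * r) * (z \<bullet> h)))
          * wave lam \<beta> a c z)) (at z)"
    by (rule has_derivative_mult[OF flat_comp_has_derivative wave_has_derivative])
  from dir_deriv_eq[OF this, of b, unfolded add_0] show ?thesis by (simp add: algebra_simps)
qed

lemma dir_deriv_twice_cut_wave:
  "dir_deriv b (dir_deriv b (\<lambda>z. flat_cut 0 r z * wave lam \<beta> a c z)) z
     = ((flat_cut 4 r z - 2 * flat_cut 3 r z) * of_real (4 * r\<^sup>2 * (z \<bullet> b)\<^sup>2)
        - flat_cut 2 r z * of_real (2 * r * (b \<bullet> b))
        - flat_cut 2 r z * of_real (4 * r * (z \<bullet> b)) * log_slope lam \<beta> a b z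
        + flat_cut 0 r z * ((log_slope lam \<beta> a b z)\<^sup>2 - 2 * \<beta> * of_real (b \<bullet> b))) * wave lam \<beta> a c z"
proof -
  let ?d2 = "\<lambda>h. complex_of_real ((flat (2 + 2) (1 - r * (z \<bullet> z)) - real 2 * flat (2 + 1) (1 - r * (z \<bullet> z))) * (- (2 * r) * (z \<bullet> h)))"
  let ?d0 = "\<lambda>h. complex_of_real ((flat (0 + 2) (1 - r * (z \<bullet> z)) - real 0 * flat (0 + 1) (1 - r * (z \<bullet> z))) * (- (2 * r) * (z \<bullet> h)))"
  have l: "((\<lambda>z. complex_of_real (- 2 * r * (z \<bullet> b))) has_derivative (\<lambda>h. of_real (- 2 * r * (h \<bullet> b)))) (at z)"
    by (auto intro!: derivative_eq_intros)
  have "((\<lambda>z. (flat_cut 2 r z * of_real (- 2 * r * (z \<bullet> b)) + flat_cut 0 r z * log_slope lam \<beta> a b z) * wave lam \<beta> a c z)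
    has_derivative (\<lambda>h. (flat_cut 2 r z * of_real (- 2 * r * (z \<bullet> b)) + flat_cut 0 r z * log_slope lam \<beta> a b z)
         * (wave lam \<beta> a c z * log_slope lam \<beta> a h z)
       + ((flat_cut 2 r z * of_real (- 2 * r * (h \<bullet> b)) + ?d2 h * of_real (- 2 * r * (z \<bullet> b)))
          + (flat_cut 0 r z * (- 2 * \<beta> * of_real (h \<bullet> b)) + ?d0 h * log_slope lam \<beta> a b z)) * wave lam \<beta> a c z)) (at z)"
    by (intro has_derivative_mult has_derivative_add flat_comp_has_derivative wave_has_derivative
        log_slope_has_derivative l)
  note dir_deriv_eq[OF this, of b]
  moreover have "dir_deriv b (\<lambda>z. flat_cut 0 r z * wave lam \<beta> a c z)
    = (\<lambda>z. (flat_cut 2 r z * of_real (- 2 * r * (z \<bullet> b)) + flat_cut 0 r z * log_slope lam \<beta> a b z) * wave lam \<beta> a c z)"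
    by (simp add: fun_eq_iff dir_deriv_cut_wave)
  moreover have "(2::nat) + 2 = 4" "(2::nat) + 1 = 3" "(0::nat) + 2 = 2" by simp_all
  ultimately show ?thesis
    by (simp only:) (simp add: power2_eq_square algebra_simps)
qed

lemma inner_axis_complex:
  "z \<bullet> axis j (1::complex) = Re (z $ j)" "z \<bullet> axis j \<i> = Im (z $ j)"
  "axis j (1::complex) \<bullet> z = Re (z $ j)" "axis j \<i> \<bullet> z = Im (z $ j)"
  by (simp_all add: inner_axis inner_axis' inner_complex_def)

lemma inner_vec_complex: "z \<bullet> w = (\<Sum>j\<in>UNIV. Re (z $ j) * Re (w $ j) + Im (z $ j) * Im (w $ j))"
  by (simp add: inner_vec_def inner_complex_def)

text \<open>
  Writing \<open>x, y\<close> for the coordinates of \<open>z\<close> and \<open>p, s\<close> for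
  those of \<open>a\<close>, both the squared logarithmic derivatives and the rotation produce
  multiples of \<open>x s - y p\<close>. The factor \<open>- lam / 2\<close> in the phase makes them
  cancel, and what remains depends on \<open>z - a\<close> only through its norm. The rotation does
  not see the cutoff, which is radial.
\<close>

lemma special_hermite_cut_wave:
  fixes z :: "complex ^ 'd::finite"
  shows "special_hermite_expr lam (\<lambda>z. flat_cut 0 r z * wave lam \<beta> a c z) z
    = (flat_cut 0 r z * symbol lam \<beta> a z + cutoff_error lam \<beta> a r z) * wave lam \<beta> a c z"
proof -
  let ?W = "wave lam \<beta> a c z" and ?f = "\<lambda>m. flat_cut m r z" and ?L = "complex_of_real lam"
  let ?x = "\<lambda>j. complex_of_real (Re (z $ j))" and ?y = "\<lambda>j. complex_of_real (Im (z $ j))"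
  let ?p = "\<lambda>j. complex_of_real (Re (a $ j))" and ?s = "\<lambda>j. complex_of_real (Im (a $ j))"
  let ?qx = "\<lambda>j. - 2 * \<beta> * (?x j - ?p j) + \<i> * (?L / 2 * ?s j)"
  let ?qy = "\<lambda>j. - 2 * \<beta> * (?y j - ?s j) + \<i> * (- ?L / 2 * ?p j)"
  let ?R = "complex_of_real r"
  have qx: "log_slope lam \<beta> a (axis j 1) z = ?qx j" and qy: "log_slope lam \<beta> a (axis j \<i>) z = ?qy j" for j
    by (simp_all add: log_slope_def inner_axis_complex twist_def)
  have axx: "axis j (1::complex) \<bullet> axis j 1 = 1" "axis j \<i> \<bullet> axis j \<i> = 1" for j :: 'd
    by (simp_all add: inner_axis_complex)
  have expand: "special_hermite_expr lam (\<lambda>z. flat_cut 0 r z * wave lam \<beta> a c z) z =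
     (\<Sum>j\<in>UNIV. (- ((?f 4 - 2 * ?f 3) * (4 * ?R\<^sup>2 * (?x j)\<^sup>2) - ?f 2 * (2 * ?R)
         - ?f 2 * (4 * ?R * ?x j) * ?qx j + ?f 0 * ((?qx j)\<^sup>2 - 2 * \<beta>))
       - ((?f 4 - 2 * ?f 3) * (4 * ?R\<^sup>2 * (?y j)\<^sup>2) - ?f 2 * (2 * ?R)
         - ?f 2 * (4 * ?R * ?y j) * ?qy j + ?f 0 * ((?qy j)\<^sup>2 - 2 * \<beta>))
       + ?L\<^sup>2 / 4 * ((?x j)\<^sup>2 + (?y j)\<^sup>2) * ?f 0
       - \<i> * ?L * (?x j * (?f 2 * (- 2 * ?R * ?y j) + ?f 0 * ?qy j)
          - ?y j * (?f 2 * (- 2 * ?R * ?x j) + ?f 0 * ?qx j))) * ?W)"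
  proof -
    have n: "complex_of_real (1 / 4 * lam\<^sup>2 * (norm z)\<^sup>2) = (\<Sum>j\<in>UNIV. ?L\<^sup>2 / 4 * ((?x j)\<^sup>2 + (?y j)\<^sup>2))"
      unfolding power2_norm_eq_inner inner_vec_complex
      by (simp add: sum_distrib_left power2_eq_square)
    show ?thesis
      unfolding special_hermite_expr_def laplacian_def partial_x_def partial_y_def
        dir_deriv_twice_cut_wave dir_deriv_cut_wave n qx qy axx inner_axis_complex
        sum_distrib_left sum_distrib_right sum_negf[symmetric] sum.distrib[symmetric] sum_subtractf[symmetric]
      by (intro sum.cong refl) (simp add: algebra_simps)
  qed
  have summand: "(- ((?f 4 - 2 * ?f 3) * (4 * ?R\<^sup>2 * (?x j)\<^sup>2) - ?f 2 * (2 * ?R)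
         - ?f 2 * (4 * ?R * ?x j) * ?qx j + ?f 0 * ((?qx j)\<^sup>2 - 2 * \<beta>))
       - ((?f 4 - 2 * ?f 3) * (4 * ?R\<^sup>2 * (?y j)\<^sup>2) - ?f 2 * (2 * ?R)
         - ?f 2 * (4 * ?R * ?y j) * ?qy j + ?f 0 * ((?qy j)\<^sup>2 - 2 * \<beta>))
       + ?L\<^sup>2 / 4 * ((?x j)\<^sup>2 + (?y j)\<^sup>2) * ?f 0
       - \<i> * ?L * (?x j * (?f 2 * (- 2 * ?R * ?y j) + ?f 0 * ?qy j)
          - ?y j * (?f 2 * (- 2 * ?R * ?x j) + ?f 0 * ?qx j)))
     = ?f 0 * (4 * \<beta> - (4 * \<beta>\<^sup>2 - ?L\<^sup>2 / 4) * ((?x j - ?p j) * (?x j - ?p j) + (?y j - ?s j) * (?y j - ?s j)))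
       + (- (4 * ?R\<^sup>2 * (?f 4 - 2 * ?f 3) * (?x j * ?x j + ?y j * ?y j))
        + 4 * ?R * ?f 2 * (1 - 2 * \<beta> * (?x j * (?x j - ?p j) + ?y j * (?y j - ?s j))
            + \<i> * (?x j * (?L / 2 * ?s j) + ?y j * (- ?L / 2 * ?p j))))" for j
  proof -
    have i2: "\<i> * (\<i> * u) = - u" for u by (simp add: mult.assoc[symmetric])
    show ?thesis
      by (simp add: power2_eq_square field_simps i2)
  qed
  have z1: "complex_of_real ((z - a) \<bullet> (z - a)) =
      (\<Sum>j\<in>UNIV. (?x j - ?p j) * (?x j - ?p j) + (?y j - ?s j) * (?y j - ?s j))"
    by (simp add: inner_vec_complex)
  have z2: "complex_of_real (z \<bullet> z) = (\<Sum>j\<in>UNIV. ?x j * ?x j + ?y j * ?y j)"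
    by (simp add: inner_vec_complex)
  have z3: "complex_of_real (z \<bullet> (z - a)) = (\<Sum>j\<in>UNIV. ?x j * (?x j - ?p j) + ?y j * (?y j - ?s j))"
    by (simp add: inner_vec_complex)
  have z4: "complex_of_real (z \<bullet> twist lam a) = (\<Sum>j\<in>UNIV. ?x j * (?L / 2 * ?s j) + ?y j * (- ?L / 2 * ?p j))"
    by (simp add: inner_vec_complex twist_def)
  have z5: "of_nat CARD('d) = (\<Sum>j\<in>(UNIV :: 'd set). 1 :: complex)" by simp
  have "?f 0 * symbol lam \<beta> a z + cutoff_error lam \<beta> a r z = 
     (\<Sum>j\<in>UNIV. ?f 0 * (4 * \<beta> - (4 * \<beta>\<^sup>2 - ?L\<^sup>2 / 4) * ((?x j - ?p j) * (?x j - ?p j) + (?y j - ?s j) * (?y j - ?s j)))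
       + (- (4 * ?R\<^sup>2 * (?f 4 - 2 * ?f 3) * (?x j * ?x j + ?y j * ?y j))
        + 4 * ?R * ?f 2 * (1 - 2 * \<beta> * (?x j * (?x j - ?p j) + ?y j * (?y j - ?s j))
            + \<i> * (?x j * (?L / 2 * ?s j) + ?y j * (- ?L / 2 * ?p j)))))"
    unfolding symbol_def cutoff_error_def transport_def of_real_mult z1 z2 z3 z4 z5
    unfolding sum.distrib sum_distrib_left[symmetric] sum_subtractf sum_negf
    by simp
  then show ?thesis unfolding expand summand sum_distrib_right[symmetric] by simp
qed

section \<open>Gaussians in the domain of the closure\<close>

lemma norm_wave: "norm (wave lam \<beta> a c z) = norm c * exp (- Re \<beta> * (norm (z - a))\<^sup>2)"
  by (simp add: wave_def norm_mult norm_exp_eq_Re power2_norm_eq_inner)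

lemma smooth_alg_wave: "smooth_alg (wave lam \<beta> a c)"
proof -
  have e: "complex_of_real ((z - a) \<bullet> (z - a)) = of_real (z \<bullet> z) + of_real (- 2) * of_real (z \<bullet> a) + of_real (a \<bullet> a)" for z
    by (simp add: inner_diff inner_commute)
  show ?thesis
    unfolding wave_def[abs_def] e
    by (intro smooth_alg.mult smooth_alg.add smooth_alg.const smooth_alg.coord smooth_alg.exp
        smooth_alg_inner_self)
qed

lemma continuous_imp_measurable_lebesgue:
  "continuous_on UNIV f \<Longrightarrow> f \<in> borel_measurable (lebesgue :: 'a::euclidean_space measure)"
  by (intro borel_measurable_lebesgueI borel_measurable_continuous_onI)

lemma exp_minus_norm_L2:
  "(\<lambda>z::'a::euclidean_space. complex_of_real (C * exp (- norm z))) \<in> L2"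
  by (rule sqint_lborel_imp_L2[OF exp_minus_norm_sqint])

lemma sqint_lborel_exp_bound:
  assumes "continuous_on UNIV (f :: 'a::euclidean_space \<Rightarrow> complex)" "\<And>z. norm (f z) \<le> C * exp (- norm z)"
  shows "f \<in> sqint lborel"
proof (rule sqint_bound[OF exp_minus_norm_sqint[of C]])
  show "f \<in> borel_measurable lborel" using borel_measurable_continuous_onI[OF assms(1)] by simp
  show "AE z in lborel. norm (f z) \<le> norm (complex_of_real (C * exp (- norm z)))"
    by (intro AE_I2) (simp only: norm_of_real, rule order_trans[OF assms(2) abs_ge_self])
qed

lemma one_le_square: "1 \<le> (1 + norm z)\<^sup>2"
  by (simp add: power2_eq_square algebra_simps)

lemma norm_square_le: "norm z * norm z \<le> (1 + norm z)\<^sup>2"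
  by (simp add: power2_eq_square algebra_simps)

lemma norm_shift_le:
  fixes z a :: "'a::real_normed_vector"
  shows "norm (z - a) \<le> (1 + norm a) * (1 + norm z)"
proof -
  have "norm (z - a) \<le> norm z + norm a" by (rule norm_triangle_ineq4)
  also have "\<dots> \<le> (1 + norm a) * (1 + norm z)" by (simp add: algebra_simps)
  finally show ?thesis .
qed

lemma norm_shift_square_le:
  fixes z a :: "'a::real_inner"
  shows "(z - a) \<bullet> (z - a) \<le> (1 + norm a)\<^sup>2 * (1 + norm z)\<^sup>2"
proof -
  have "(norm (z - a))\<^sup>2 \<le> ((1 + norm a) * (1 + norm z))\<^sup>2"
    by (intro power_mono norm_shift_le) auto
  then show ?thesis by (simp add: power_mult_distrib power2_norm_eq_inner)
qed

lemma norm_symbol_le: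
  fixes a z :: "complex ^ 'd::finite"
  assumes "norm \<beta> \<le> W"
  shows "norm (symbol lam \<beta> a z)
     \<le> (4 * W * real CARD('d) + (4 * W\<^sup>2 + lam\<^sup>2 / 4) * (1 + norm a)\<^sup>2) * (1 + norm z)\<^sup>2"
proof -
  have W: "0 \<le> W" using assms norm_ge_zero order_trans by blast
  have 1: "norm (4 * \<beta> * of_nat CARD('d)) \<le> 4 * W * real CARD('d) * (1 + norm z)\<^sup>2"
  proof -
    have "norm (4 * \<beta> * of_nat CARD('d)) = 4 * norm \<beta> * real CARD('d) * 1" by (simp add: norm_mult)
    also have "\<dots> \<le> 4 * W * real CARD('d) * (1 + norm z)\<^sup>2"
      using assms W one_le_square by (intro mult_mono) auto
    finally show ?thesis .
  qed
  have "norm (4 * \<beta>\<^sup>2 - complex_of_real (lam\<^sup>2 / 4)) \<le> norm (4 * \<beta>\<^sup>2) + norm (complex_of_real (lam\<^sup>2 / 4))"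
    by (rule norm_triangle_ineq4)
  also have "\<dots> \<le> 4 * W\<^sup>2 + lam\<^sup>2 / 4"
    using assms by (simp add: norm_mult norm_power power_mono del: of_real_divide of_real_power)
  finally have 2: "norm ((4 * \<beta>\<^sup>2 - of_real (lam\<^sup>2 / 4)) * of_real ((z - a) \<bullet> (z - a)))
     \<le> (4 * W\<^sup>2 + lam\<^sup>2 / 4) * ((1 + norm a)\<^sup>2 * (1 + norm z)\<^sup>2)"
    unfolding norm_mult using norm_shift_square_le[of z a]
    by (intro mult_mono) (auto simp del: of_real_divide of_real_power)
  have "norm (symbol lam \<beta> a z) \<le> norm (4 * \<beta> * of_nat CARD('d))
      + norm ((4 * \<beta>\<^sup>2 - of_real (lam\<^sup>2 / 4)) * of_real ((z - a) \<bullet> (z - a)))"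
    unfolding symbol_def by (rule norm_triangle_ineq4)
  with 1 2 show ?thesis by (simp add: algebra_simps)
qed

lemma gaussian_moment_exp_bound:
  fixes z a :: "'a::real_normed_vector"
  assumes "0 < b" "b \<le> b'"  "0 \<le> S"
    and "norm u \<le> S * (1 + norm z)\<^sup>2" "norm v \<le> A * exp (- b' * (norm (z - a))\<^sup>2)"
  shows "norm (u * v :: complex) \<le> S * A * exp (3 * norm a + 9 / (4 * b)) * exp (- norm z)"
proof -
  have "0 \<le> A * exp (- b' * (norm (z - a))\<^sup>2)" using assms(5) norm_ge_zero order_trans by blast
  then have A: "0 \<le> A" by (simp add: zero_le_mult_iff)
  have "norm (u * v) \<le> (S * (1 + norm z)\<^sup>2) * (A * exp (- b' * (norm (z - a))\<^sup>2))"
    unfolding norm_mult using assms by (intro mult_mono) auto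
  also have "\<dots> \<le> (S * (1 + norm z)\<^sup>2) * (A * exp (- b * (norm (z - a))\<^sup>2))"
    using assms A by (intro mult_left_mono) (auto simp: mult_right_mono)
  also have "\<dots> = S * A * ((1 + norm z)\<^sup>2 * exp (- b * (norm (z - a))\<^sup>2))" by simp
  also have "\<dots> \<le> S * A * (exp (3 * norm a + 9 / (4 * b)) * exp (- norm z))"
    using assms A by (intro mult_left_mono polynomial_gaussian_bound) auto
  finally show ?thesis by simp
qed

definition wave_const :: "real \<Rightarrow> real \<Rightarrow> complex ^ 'd::finite \<Rightarrow> real" where
  "wave_const A b a = A * exp (3 * norm a + 9 / (4 * b))"

lemma norm_wave_exp_bound:
  assumes "0 < b" "b \<le> Re \<beta>" "norm c \<le> A" "0 \<le> S" "norm u \<le> S * (1 + norm z)\<^sup>2"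
  shows "norm (u * wave lam \<beta> a c z) \<le> S * wave_const A b a * exp (- norm z)"
proof -
  have "norm (wave lam \<beta> a c z) \<le> A * exp (- Re \<beta> * (norm (z - a))\<^sup>2)"
    using assms by (simp add: norm_wave mult_right_mono)
  from gaussian_moment_exp_bound[OF assms(1,2,4,5) this] show ?thesis
    by (simp add: wave_const_def mult.assoc)
qed

lemma continuous_wave [continuous_intros]: "continuous_on UNIV (wave lam \<beta> a c)"
  by (rule smooth_alg_continuous[OF smooth_alg_wave])

lemma continuous_symbol [continuous_intros]: "continuous_on UNIV (symbol lam \<beta> a)"
  unfolding symbol_def[abs_def] by (intro continuous_intros)

lemma wave_sqint: "0 < Re \<beta> \<Longrightarrow> wave lam \<beta> a c \<in> sqint lborel"
  using norm_wave_exp_bound[of "Re \<beta>" \<beta> c "norm c" 1 1] one_le_square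
  by (intro sqint_lborel_exp_bound[where C = "wave_const (norm c) (Re \<beta>) a"] continuous_intros) auto

lemma symbol_wave_sqint: "0 < Re \<beta> \<Longrightarrow> (\<lambda>z. symbol lam \<beta> a z * wave lam \<beta> a c z) \<in> sqint lborel"
  by (rule sqint_lborel_exp_bound[OF _ norm_wave_exp_bound[OF _ order_refl order_refl _ norm_symbol_le[OF order_refl]]])
    (auto intro!: continuous_intros)

lemma flat_0_le: "x \<le> 1 \<Longrightarrow> exp 1 * flat 0 x \<le> 1"
  by (auto simp: flat_def exp_add[symmetric] field_simps)

text \<open>
  The test functions are the products of the Gaussian with \<open>exp 1 * flat 0 (1 - r n * (z
  \<bullet> z))\<close>, which tends to \<open>1\<close> as \<open>r n = 1 / (n + 1)\<close> tends
  to \<open>0\<close>. Each term with a derivative of the cutoff carries a factor \<open>r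
  n\<close>. Everything is bounded by a quadratic factor times the Gaussian.
\<close>

lemma special_hermite_wave:
  fixes a :: "complex ^ 'd::finite"
  assumes \<beta>: "0 < Re \<beta>"
  shows "(wave lam \<beta> a c, \<lambda>z. symbol lam \<beta> a z * wave lam \<beta> a c z) \<in> special_hermite lam"
proof -
  let ?w = "wave lam \<beta> a c" and ?e = "complex_of_real (exp 1)"
  define r where "r n = inverse (real (Suc n))" for n
  define \<psi> where "\<psi> n z = flat_cut 0 (r n) z * wave lam \<beta> a (?e * c) z" for n z
  have r: "0 < r n" "r n \<le> 1" for n
    by (simp_all add: r_def field_simps)
  have r0: "r \<longlonglongrightarrow> 0"
    unfolding r_def[abs_def] by (rule LIMSEQ_inverse_real_of_nat)
  have w_e: "wave lam \<beta> a (?e * c) z = ?e * ?w z" for z by (simp add: wave_def)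
  have arg: "1 - r n * (z \<bullet> z) \<le> 1" for n z using r[of n] by simp
  obtain B where B: "0 \<le> B" "\<And>m x. m \<in> {2,3,4} \<Longrightarrow> x \<le> 1 \<Longrightarrow> flat m x \<le> B"
  proof -
    obtain B2 B3 B4 where "0 \<le> B2" "\<forall>x\<le>1. flat 2 x \<le> B2" "0 \<le> B3" "\<forall>x\<le>1. flat 3 x \<le> B3"
      "0 \<le> B4" "\<forall>x\<le>1. flat 4 x \<le> B4" using flat_bounded by metis
    then have "flat m x \<le> B2 + B3 + B4" if "m \<in> {2,3,4}" "x \<le> 1" for m x
      using that by fastforce
    then show thesis using that[of "B2 + B3 + B4"] \<open>0 \<le> B2\<close> \<open>0 \<le> B3\<close> \<open>0 \<le> B4\<close> by simp
  qed
  have lim_flat: "(\<lambda>n. flat_cut m (r n) z) \<longlonglongrightarrow> of_real (flat m 1)" for m and z :: "complex ^ 'd"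
  proof -
    have "(\<lambda>n. 1 - r n * (z \<bullet> z)) \<longlonglongrightarrow> 1" by (auto intro!: tendsto_eq_intros r0)
    from isCont_tendsto_compose[OF DERIV_isCont[OF flat_has_derivative] this, of m]
    show ?thesis by (rule tendsto_of_real)
  qed
  have e1: "?e * of_real (flat 0 1) = 1" by (simp add: flat_def exp_minus flip: of_real_mult)
  have test: "\<psi> n \<in> test_functions" for n
  proof -
    have "smooth_alg (\<psi> n)" unfolding \<psi>_def[abs_def]
      by (intro smooth_alg.mult smooth_alg.flat smooth_alg_wave)
    moreover have "bounded {z. \<psi> n z \<noteq> 0}"
    proof (rule bounded_subset[OF bounded_cball])
      show "{z. \<psi> n z \<noteq> 0} \<subseteq> cball 0 (1 / r n)"
      proof
        fix z assume "z \<in> {z. \<psi> n z \<noteq> 0}"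
        then have "0 < 1 - r n * (z \<bullet> z)" by (auto simp: \<psi>_def flat_def split: if_splits)
        then have "r n * (norm z)\<^sup>2 < 1" by (simp add: power2_norm_eq_inner)
        then have "(norm z)\<^sup>2 < 1 / r n" using r[of n] by (simp add: field_simps)
        also have "1 / r n \<le> (1 / r n)\<^sup>2" using r[of n] by (simp add: power2_eq_square field_simps)
        finally have "(norm z)\<^sup>2 < (1 / r n)\<^sup>2" .
        then have "norm z < 1 / r n" by (rule power2_less_imp_less) (use r(1)[of n] in simp)
        then show "z \<in> cball 0 (1 / r n)" by simp
      qed
    qed
    ultimately show ?thesis by (auto simp: test_functions_def smooth_alg_C_k)
  qed
  have cut1: "norm (?e * flat_cut 0 (r n) z - 1) \<le> 1" for n and z :: "complex ^ 'd"
  proof -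
    have "?e * flat_cut 0 (r n) z - 1 = of_real (exp 1 * flat 0 (1 - r n * (z \<bullet> z)) - 1)" by simp
    then show ?thesis
      using flat_0_le[OF arg, of n z] flat_nonneg[of 0 "1 - r n * (z \<bullet> z)"]
      by (simp only: norm_of_real) (simp add: abs_le_iff)
  qed
  have lim1: "(\<lambda>n. L2_norm (\<lambda>z. \<psi> n z - ?w z)) \<longlonglongrightarrow> 0"
  proof (rule L2_dominated_convergence)
    show "?w \<in> L2" using wave_sqint[OF \<beta>] by (rule sqint_lborel_imp_L2)
    show "\<psi> n \<in> borel_measurable lebesgue" for n
      unfolding \<psi>_def[abs_def] by (intro continuous_imp_measurable_lebesgue continuous_intros)
    show "?w \<in> borel_measurable lebesgue"
      by (intro continuous_imp_measurable_lebesgue continuous_intros)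
    have split: "\<psi> n z - ?w z = (?e * flat_cut 0 (r n) z - 1) * ?w z" for n z
      unfolding \<psi>_def w_e by (simp add: algebra_simps)
    show "norm (\<psi> n z - ?w z) \<le> norm (?w z)" for n z
      unfolding split norm_mult using mult_right_mono[OF cut1] by fastforce
    show "(\<lambda>n. \<psi> n z) \<longlonglongrightarrow> ?w z" for z
    proof -
      have "(\<lambda>n. flat_cut 0 (r n) z * (?e * ?w z)) \<longlonglongrightarrow> of_real (flat 0 1) * (?e * ?w z)"
        by (intro tendsto_intros lim_flat)
      also have "of_real (flat 0 1) * (?e * ?w z) = (?e * of_real (flat 0 1)) * ?w z" by (simp only: mult_ac)
      finally show ?thesis unfolding \<psi>_def w_e e1 by simp
    qed
  qed
  let ?v = "\<lambda>z. symbol lam \<beta> a z * ?w z"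
  have Lpsi: "special_hermite_expr lam (\<psi> n) z
     = (?e * flat_cut 0 (r n) z * symbol lam \<beta> a z + ?e * cutoff_error lam \<beta> a (r n) z) * ?w z" for n z
    unfolding \<psi>_def[abs_def] special_hermite_cut_wave unfolding w_e by (simp add: algebra_simps)
  define Ssym where "Ssym = 4 * norm \<beta> * real CARD('d) + (4 * (norm \<beta>)\<^sup>2 + lam\<^sup>2 / 4) * (1 + norm a)\<^sup>2"
  have Ssym: "norm (symbol lam \<beta> a z) \<le> Ssym * (1 + norm z)\<^sup>2" "0 \<le> Ssym" for z
    using norm_symbol_le[OF order_refl, of lam \<beta> a z] by (auto simp: Ssym_def)
  define Serr where "Serr = 12 * B + 4 * B * (real CARD('d) + 2 * norm \<beta> * (1 + norm a) + norm (twist lam a))"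
  have Serr0: "0 \<le> Serr" using B(1) by (simp add: Serr_def)
  have err: "norm (cutoff_error lam \<beta> a (r n) z) \<le> Serr * (1 + norm z)\<^sup>2" for n z
  proof -
    let ?M = "real CARD('d) + 2 * norm \<beta> * (1 + norm a) + norm (twist lam a)"
    let ?x = "1 - r n * (z \<bullet> z)" and ?Q = "(1 + norm z)\<^sup>2"
    have b: "0 \<le> flat m ?x" "m \<in> {2,3,4} \<Longrightarrow> flat m ?x \<le> B" for m
      by (rule flat_nonneg) (rule B(2)[OF _ arg])
    have Q: "0 \<le> ?Q" "z \<bullet> z \<le> ?Q" "1 \<le> ?Q"
      using one_le_square[of z] norm_square_le[of z] by (auto simp: norm_eq_sqrt_inner)
    have r2: "(r n)\<^sup>2 \<le> 1" using r[of n] by (simp add: power_le_one)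
    have 1: "norm (of_real (4 * (r n)\<^sup>2 * (flat 4 ?x - 2 * flat 3 ?x) * (z \<bullet> z)) :: complex) \<le> 12 * B * ?Q"
    proof -
      have "\<bar>flat 4 ?x - 2 * flat 3 ?x\<bar> \<le> 3 * B" using b[of 4] b[of 3] B(1) by (auto simp: abs_le_iff)
      then have "(4 * (r n)\<^sup>2) * \<bar>flat 4 ?x - 2 * flat 3 ?x\<bar> * (z \<bullet> z) \<le> (4 * 1) * (3 * B) * ?Q"
        using r2 Q B(1) by (intro mult_mono) auto
      then show ?thesis unfolding norm_of_real by (simp add: abs_mult)
    qed
    have 2: "norm (transport lam \<beta> a z)
       \<le> ?M * ?Q"
    proof -
      have "\<bar>z \<bullet> (z - a)\<bar> \<le> norm z * norm (z - a)" by (rule Cauchy_Schwarz_ineq2)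
      also have "\<dots> \<le> (1 + norm z) * ((1 + norm a) * (1 + norm z))"
      proof (intro mult_mono)
        show "norm (z - a) \<le> (1 + norm a) * (1 + norm z)" by (rule norm_shift_le)
      qed auto
      finally have i1: "\<bar>z \<bullet> (z - a)\<bar> \<le> (1 + norm a) * ?Q" by (simp add: power2_eq_square mult_ac)
      have "\<bar>z \<bullet> twist lam a\<bar> \<le> norm z * norm (twist lam a)" by (rule Cauchy_Schwarz_ineq2)
      also have "\<dots> \<le> ?Q * norm (twist lam a)"
        by (intro mult_right_mono) (auto simp: power2_eq_square algebra_simps)
      finally have i2: "\<bar>z \<bullet> twist lam a\<bar> \<le> norm (twist lam a) * ?Q" by (simp add: mult.commute)
      have "norm (transport lam \<beta> a z)
         \<le> norm (of_nat CARD('d) :: complex) + norm (2 * \<beta> * of_real (z \<bullet> (z - a))) + norm (\<i> * of_real (z \<bullet> twist lam a))"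
        unfolding transport_def
        by (meson norm_triangle_ineq norm_triangle_ineq4 add_mono order_refl order_trans)
      also have "\<dots> = real CARD('d) * 1 + 2 * norm \<beta> * \<bar>z \<bullet> (z - a)\<bar> + \<bar>z \<bullet> twist lam a\<bar>"
        by (simp add: norm_mult)
      also have "\<dots> \<le> real CARD('d) * ?Q + 2 * norm \<beta> * ((1 + norm a) * ?Q) + norm (twist lam a) * ?Q"
        using i1 i2 Q by (intro add_mono mult_left_mono) auto
      finally show ?thesis by (simp add: algebra_simps)
    qed
    have 3: "norm (of_real (4 * r n * flat 2 ?x) :: complex) \<le> 4 * B"
    proof -
      have "4 * r n * flat 2 ?x \<le> 4 * 1 * B" using r[of n] b[of 2] by (intro mult_mono) auto
      moreover have "0 \<le> 4 * r n * flat 2 ?x" using r[of n] b[of 2] by simp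
      ultimately show ?thesis unfolding norm_of_real by simp
    qed
    have "norm (cutoff_error lam \<beta> a (r n) z) \<le> 12 * B * ?Q
       + 4 * B * (?M * ?Q)"
    proof -
      have "norm (- p + q * s) \<le> norm p + norm q * norm s" for p q s :: complex
        using norm_triangle_ineq[of "- p" "q * s"] by (simp add: norm_mult)
      then have "norm (cutoff_error lam \<beta> a (r n) z) \<le> norm (of_real (4 * (r n)\<^sup>2 * (flat 4 ?x - 2 * flat 3 ?x) * (z \<bullet> z)) :: complex)
         + norm (of_real (4 * r n * flat 2 ?x) :: complex) *
           norm (transport lam \<beta> a z)"
        unfolding cutoff_error_def by blast
      also have "\<dots> \<le> 12 * B * ?Q
       + 4 * B * (?M * ?Q)"
        using 1 2 3 B(1) by (intro add_mono mult_mono) auto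
      finally show ?thesis .
    qed
    then show ?thesis by (simp add: Serr_def algebra_simps)
  qed
  have lim2: "(\<lambda>n. L2_norm (\<lambda>z. special_hermite_expr lam (\<psi> n) z - ?v z)) \<longlonglongrightarrow> 0"
  proof (rule L2_dominated_convergence)
    let ?S = "Ssym + exp 1 * Serr"
    let ?K = "?S * wave_const (norm c) (Re \<beta>) a"
    show "(\<lambda>z::complex ^ 'd. complex_of_real (?K * exp (- norm z))) \<in> L2" by (rule exp_minus_norm_L2)
    show "special_hermite_expr lam (\<psi> n) \<in> borel_measurable lebesgue" for n
      unfolding Lpsi[abs_def] cutoff_error_def transport_def
      by (intro continuous_imp_measurable_lebesgue continuous_intros)
    show "?v \<in> borel_measurable lebesgue"
      by (intro continuous_imp_measurable_lebesgue continuous_intros)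
    fix z :: "complex ^ 'd"
    have split: "special_hermite_expr lam (\<psi> n) z - ?v z
       = ((?e * flat_cut 0 (r n) z - 1) * symbol lam \<beta> a z + ?e * cutoff_error lam \<beta> a (r n) z) * ?w z" for n
      unfolding Lpsi by (simp add: algebra_simps)
    show "norm (special_hermite_expr lam (\<psi> n) z - ?v z) \<le> norm (complex_of_real (?K * exp (- norm z)))" for n
    proof -
      have "norm ((?e * flat_cut 0 (r n) z - 1) * symbol lam \<beta> a z + ?e * cutoff_error lam \<beta> a (r n) z)
          \<le> 1 * norm (symbol lam \<beta> a z) + exp 1 * norm (cutoff_error lam \<beta> a (r n) z)"
        by (rule order_trans[OF norm_triangle_ineq], unfold norm_mult, intro add_mono mult_right_mono cut1) auto
      also have "\<dots> \<le> 1 * (Ssym * (1 + norm z)\<^sup>2) + exp 1 * (Serr * (1 + norm z)\<^sup>2)"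
        by (intro add_mono mult_left_mono Ssym err) auto
      finally have "norm ((?e * flat_cut 0 (r n) z - 1) * symbol lam \<beta> a z + ?e * cutoff_error lam \<beta> a (r n) z)
          \<le> ?S * (1 + norm z)\<^sup>2" by (simp add: algebra_simps)
      then have "norm (special_hermite_expr lam (\<psi> n) z - ?v z) \<le> ?K * exp (- norm z)"
        unfolding split using \<beta> Ssym(2) Serr0 by (intro norm_wave_exp_bound) auto
      then show ?thesis unfolding norm_of_real by simp
    qed
    show "(\<lambda>n. special_hermite_expr lam (\<psi> n) z) \<longlonglongrightarrow> ?v z"
    proof -
      have "(\<lambda>n. cutoff_error lam \<beta> a (r n) z) \<longlonglongrightarrow>
         - (4 * 0\<^sup>2 * (of_real (flat 4 1) - 2 * of_real (flat 3 1)) * of_real (z \<bullet> z))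
         + 4 * 0 * of_real (flat 2 1) * transport lam \<beta> a z"
        unfolding cutoff_error_def of_real_mult of_real_diff of_real_power of_real_numeral
        by (intro tendsto_intros lim_flat tendsto_of_real[OF r0, unfolded of_real_0])
      then have c0: "(\<lambda>n. cutoff_error lam \<beta> a (r n) z) \<longlonglongrightarrow> 0" by simp
      have "(\<lambda>n. (?e * flat_cut 0 (r n) z * symbol lam \<beta> a z + ?e * cutoff_error lam \<beta> a (r n) z) * ?w z)
        \<longlonglongrightarrow> (?e * of_real (flat 0 1) * symbol lam \<beta> a z + ?e * 0) * ?w z"
        by (intro tendsto_intros lim_flat c0)
      then show ?thesis unfolding Lpsi e1 by simp
    qed
  qed
  show ?thesis
    unfolding special_hermite_def
    using sqint_lborel_imp_L2[OF wave_sqint[OF \<beta>]] sqint_lborel_imp_L2[OF symbol_wave_sqint[OF \<beta>]]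
      test lim1 lim2 by blast
qed

section \<open>Explicit evolution of Gaussians\<close>

lemma has_vector_derivative_iff_quotient:
  fixes f :: "real \<Rightarrow> complex"
  shows "(f has_vector_derivative D) (at x within S)
    \<longleftrightarrow> ((\<lambda>y. (f y - f x) /\<^sub>R (y - x)) \<longlongrightarrow> D) (at x within S)"
proof -
  have null_iff: "(G \<longlongrightarrow> 0) F \<longleftrightarrow> (H \<longlongrightarrow> 0) F"
    if "\<And>y. norm (G y) = norm (H y)" for G H :: "real \<Rightarrow> complex" and F
    using tendsto_norm_zero_iff[of G F] tendsto_norm_zero_iff[of H F] that by simp
  have "((\<lambda>y. (f y - f x) /\<^sub>R (y - x)) \<longlongrightarrow> D) (at x within S)
     \<longleftrightarrow> ((\<lambda>y. (f y - f x) /\<^sub>R (y - x) - D) \<longlongrightarrow> 0) (at x within S)"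
    by (rule LIM_zero_iff[symmetric])
  also have "\<dots> \<longleftrightarrow> ((\<lambda>y. (1 / (y - x)) *\<^sub>R (f y - (f x + (y - x) *\<^sub>R D))) \<longlongrightarrow> 0) (at x within S)"
    by (rule filterlim_cong)
      (auto simp: eventually_at_filter scaleR_diff_right scaleR_add_right divide_inverse)
  also have "\<dots> \<longleftrightarrow> ((\<lambda>y. (1 / norm (y - x)) *\<^sub>R (f y - (f x + (y - x) *\<^sub>R D))) \<longlongrightarrow> 0) (at x within S)"
    by (rule null_iff) simp
  also have "\<dots> \<longleftrightarrow> (f has_vector_derivative D) (at x within S)"
    unfolding has_vector_derivative_def has_derivative_within
    by (simp add: bounded_linear_scaleR_left)
  finally show ?thesis by simp
qed

text \<open>
  The mean value inequality bounds the difference quotients by \<open>g\<close>, uniformly, so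
  differentiation under the integral sign is dominated convergence.
\<close>

lemma L2_inner_has_vector_derivative:
  fixes w w' :: "real \<Rightarrow> 'a::euclidean_space \<Rightarrow> complex"
  assumes h: "h \<in> L2" and g: "g \<in> L2" and S: "convex S" and s: "s \<in> S"
    and w: "\<And>s. s \<in> S \<Longrightarrow> w s \<in> L2" and w'm: "w' s \<in> borel_measurable lebesgue"
    and deriv: "\<And>s z. s \<in> S \<Longrightarrow> ((\<lambda>s. w s z) has_vector_derivative w' s z) (at s within S)"
    and bound: "\<And>s z. s \<in> S \<Longrightarrow> norm (w' s z) \<le> norm (g z)"
  shows "((\<lambda>s. L2_inner h (w s)) has_vector_derivative L2_inner h (w' s)) (at s within S)"
  unfolding has_vector_derivative_iff_quotient tendsto_at_iff_sequentially
proof (intro allI impI, unfold o_def)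
  fix X :: "nat \<Rightarrow> real"
  assume X: "\<forall>i. X i \<in> S - {s}" and Xs: "X \<longlonglongrightarrow> s"
  let ?d = "\<lambda>n z. (w (X n) z - w s z) /\<^sub>R (X n - s)"
  have conv: "(\<lambda>n. LINT z|lebesgue. h z * cnj (?d n z)) \<longlonglongrightarrow> (LINT z|lebesgue. h z * cnj (w' s z))"
  proof (rule integral_dominated_convergence)
    have [measurable]: "w s \<in> borel_measurable lebesgue" "w (X n) \<in> borel_measurable lebesgue"
      "h \<in> borel_measurable lebesgue" "w' s \<in> borel_measurable lebesgue" for n
      using w[of s] w[of "X n"] s X h w'm by (auto simp: L2_def)
    show "(\<lambda>z. h z * cnj (w' s z)) \<in> borel_measurable lebesgue" by measurable
    show "(\<lambda>z. h z * cnj (?d n z)) \<in> borel_measurable lebesgue" for n by measurable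
    have "integrable lebesgue (\<lambda>z. h z * g z)"
      using h g unfolding L2_eq_sqint by (rule sqint_mult_integrable)
    then show "integrable lebesgue (\<lambda>z. norm (h z * g z))" by (rule integrable_norm)
    show "AE z in lebesgue. norm (h z * cnj (?d n z)) \<le> norm (h z * g z)" for n
    proof (intro AE_I2)
      fix z
      have Xn: "X n \<in> S" "X n \<noteq> s" using X by auto
      have "norm (w (X n) z - w s z) \<le> norm (g z) * \<bar>X n - s\<bar>"
        by (rule vector_derivative_increment_le[OF S s Xn(1) deriv bound])
      then have "norm (?d n z) \<le> norm (g z)" using Xn(2) by (simp add: divide_simps mult.commute)
      then show "norm (h z * cnj (?d n z)) \<le> norm (h z * g z)"
        unfolding norm_mult complex_mod_cnj by (rule mult_left_mono) simp
    qed
    show "AE z in lebesgue. (\<lambda>n. h z * cnj (?d n z)) \<longlonglongrightarrow> h z * cnj (w' s z)"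
    proof (intro AE_I2 tendsto_intros)
      fix z
      show "(\<lambda>n. ?d n z) \<longlonglongrightarrow> w' s z"
        using deriv[OF s, of z] X Xs
        unfolding has_vector_derivative_iff_quotient tendsto_at_iff_sequentially o_def by blast
    qed
  qed
  have quot: "(LINT z|lebesgue. h z * cnj (?d n z)) = (L2_inner h (w (X n)) - L2_inner h (w s)) /\<^sub>R (X n - s)" for n
  proof -
    have wn: "w (X n) \<in> L2" "w s \<in> L2" using w X s by auto
    have "(LINT z|lebesgue. h z * cnj (?d n z)) = L2_inner h (\<lambda>z. of_real (inverse (X n - s)) * (w (X n) z - w s z))"
      by (simp only: L2_inner_def scaleR_conv_of_real)
    also have "\<dots> = (L2_inner h (w (X n)) - L2_inner h (w s)) /\<^sub>R (X n - s)"
      unfolding L2.scale_right[OF L2.diff_mem[OF wn] h] L2.diff_right[OF wn h]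
      by (simp add: scaleR_conv_of_real)
    finally show ?thesis .
  qed
  show "(\<lambda>n. (L2_inner h (w (X n)) - L2_inner h (w s)) /\<^sub>R (X n - s)) \<longlonglongrightarrow> L2_inner h (w' s)"
    using conv unfolding quot by (simp only: L2_inner_def)
qed

text \<open>
  The Gaussian with width \<open>\<beta>\<close> and amplitude \<open>c\<close> solves the
  Schroedinger equation if \<open>\<beta>' = - \<i> (4 \<beta>\<^sup>2 - lam\<^sup>2 / 4)\<close>
  and \<open>c' = - 4 \<i> d \<beta> c\<close>. Substituting \<open>\<beta> = - (\<i> / 4) y' /
  y\<close> turns the Riccati equation into \<open>y'' = - lam\<^sup>2 y\<close>, and the amplitude
  becomes a multiple of \<open>1 / y ^ d\<close>. The solution \<open>y\<close> with \<open>y 0 =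
  1\<close> and \<open>\<beta> 0 = \<alpha>\<close> is \<open>osc\<close>.
\<close>

definition osc :: "real \<Rightarrow> real \<Rightarrow> real \<Rightarrow> complex" where
  "osc lam \<alpha> s = of_real (cos (lam * s)) + \<i> * of_real (4 * \<alpha> / lam * sin (lam * s))"

definition osc' :: "real \<Rightarrow> real \<Rightarrow> real \<Rightarrow> complex" where
  "osc' lam \<alpha> s = of_real (- lam * sin (lam * s)) + \<i> * of_real (4 * \<alpha> * cos (lam * s))"

definition width :: "real \<Rightarrow> real \<Rightarrow> real \<Rightarrow> complex" where
  "width lam \<alpha> s = - (\<i> / 4) * (osc' lam \<alpha> s / osc lam \<alpha> s)"

definition amplitude :: "nat \<Rightarrow> real \<Rightarrow> real \<Rightarrow> real \<Rightarrow> complex" where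
  "amplitude d lam \<alpha> s = (of_real \<alpha> / osc lam \<alpha> s) ^ d"

definition flow :: "real \<Rightarrow> real \<Rightarrow> complex ^ 'd::finite \<Rightarrow> real \<Rightarrow> complex ^ 'd \<Rightarrow> complex" where
  "flow lam \<alpha> a s = wave lam (width lam \<alpha> s) a (amplitude CARD('d) lam \<alpha> s)"

definition flow_velocity :: "real \<Rightarrow> real \<Rightarrow> complex ^ 'd::finite \<Rightarrow> real \<Rightarrow> complex ^ 'd \<Rightarrow> complex" where
  "flow_velocity lam \<alpha> a s z = symbol lam (width lam \<alpha> s) a z * flow lam \<alpha> a s z"

lemma norm_osc_square: "(norm (osc lam \<alpha> s))\<^sup>2 = (cos (lam * s))\<^sup>2 + (4 * \<alpha> / lam)\<^sup>2 * (sin (lam * s))\<^sup>2"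
  by (simp add: osc_def cmod_power2 power_mult_distrib power_divide)

lemma norm_osc_lower:
  assumes "lam \<noteq> 0" "0 < \<alpha>"
  shows "min 1 ((4 * \<alpha> / lam)\<^sup>2) \<le> (norm (osc lam \<alpha> s))\<^sup>2"
proof -
  let ?m = "min 1 ((4 * \<alpha> / lam)\<^sup>2)"
  have "?m = ?m * (cos (lam * s))\<^sup>2 + ?m * (sin (lam * s))\<^sup>2"
    by (metis distrib_left mult.right_neutral sin_cos_squared_add2)
  also have "\<dots> \<le> 1 * (cos (lam * s))\<^sup>2 + (4 * \<alpha> / lam)\<^sup>2 * (sin (lam * s))\<^sup>2"
    by (intro add_mono mult_right_mono) auto
  finally show ?thesis unfolding norm_osc_square by simp
qed

lemma norm_osc_upper: "(norm (osc lam \<alpha> s))\<^sup>2 \<le> 1 + (4 * \<alpha> / lam)\<^sup>2"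
proof -
  have "(cos (lam * s))\<^sup>2 \<le> 1" "(sin (lam * s))\<^sup>2 \<le> 1"
    by (simp_all add: abs_square_le_1)
  then have "(cos (lam * s))\<^sup>2 + (4 * \<alpha> / lam)\<^sup>2 * (sin (lam * s))\<^sup>2 \<le> 1 + (4 * \<alpha> / lam)\<^sup>2 * 1"
    by (intro add_mono mult_left_mono) auto
  then show ?thesis unfolding norm_osc_square by simp
qed

lemma osc_nonzero: "lam \<noteq> 0 \<Longrightarrow> 0 < \<alpha> \<Longrightarrow> osc lam \<alpha> s \<noteq> 0"
  using norm_osc_lower[of lam \<alpha> s] by (auto simp: min_def split: if_splits)

text \<open>
  The imaginary part of \<open>y' * cnj y\<close> is a Wronskian and keeps its initial value
  \<open>4 \<alpha>\<close>. The Gaussian therefore stays integrable for all times, also at the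
  caustics where \<open>sin (lam * s) = 0\<close>.
\<close>

lemma Re_width:
  assumes "lam \<noteq> 0" "0 < \<alpha>"
  shows "Re (width lam \<alpha> s) = \<alpha> / (norm (osc lam \<alpha> s))\<^sup>2"
proof -
  have "osc' lam \<alpha> s / osc lam \<alpha> s = osc' lam \<alpha> s * cnj (osc lam \<alpha> s) / of_real ((norm (osc lam \<alpha> s))\<^sup>2)"
    using complex_div_cnj by blast
  then have "Re (width lam \<alpha> s) = Im (osc' lam \<alpha> s * cnj (osc lam \<alpha> s)) / (norm (osc lam \<alpha> s))\<^sup>2 / 4"
    by (simp add: width_def del: of_real_power) (simp add: divide_simps)
  also have "Im (osc' lam \<alpha> s * cnj (osc lam \<alpha> s)) = 4 * \<alpha> * (cos (lam * s))\<^sup>2 + 4 * \<alpha> * (sin (lam * s))\<^sup>2"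
    using assms by (simp add: osc_def osc'_def power2_eq_square)
  also have "\<dots> = 4 * \<alpha>" by (metis distrib_left mult.right_neutral sin_cos_squared_add2)
  finally show ?thesis by simp
qed

lemma osc_derivative:
  assumes "lam \<noteq> 0"
  shows "(osc lam \<alpha> has_vector_derivative osc' lam \<alpha> s) (at s within S)"
    and "(osc' lam \<alpha> has_vector_derivative - of_real (lam\<^sup>2) * osc lam \<alpha> s) (at s within S)"
proof -
  have c: "((\<lambda>s. complex_of_real (f s)) has_vector_derivative of_real f') (at s within S)"
    if "(f has_real_derivative f') (at s within S)" for f f'
    using that has_vector_derivative_of_real[of f f' "at s within S"]
    by (simp add: has_real_derivative_iff_has_vector_derivative)
  have ci: "((\<lambda>s. \<i> * complex_of_real (f s)) has_vector_derivative \<i> * of_real f') (at s within S)"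
    if "(f has_real_derivative f') (at s within S)" for f f'
    using has_vector_derivative_mult_right[OF c[OF that]] .
  show "(osc lam \<alpha> has_vector_derivative osc' lam \<alpha> s) (at s within S)"
    unfolding osc_def[abs_def] osc'_def
    by (intro has_vector_derivative_add c ci) (use assms in \<open>auto intro!: derivative_eq_intros\<close>)
  have "(osc' lam \<alpha> has_vector_derivative (of_real (- lam * (cos (lam * s) * lam))
      + \<i> * of_real (4 * \<alpha> * (- sin (lam * s) * lam)))) (at s within S)"
    unfolding osc'_def[abs_def]
    by (intro has_vector_derivative_add c ci) (auto intro!: derivative_eq_intros)
  moreover have "of_real (- lam * (cos (lam * s) * lam)) + \<i> * of_real (4 * \<alpha> * (- sin (lam * s) * lam))
      = - of_real (lam\<^sup>2) * osc lam \<alpha> s"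
    using assms by (simp add: osc_def power2_eq_square field_simps)
  ultimately show "(osc' lam \<alpha> has_vector_derivative - of_real (lam\<^sup>2) * osc lam \<alpha> s) (at s within S)" by simp
qed

lemma osc'_eq_width:
  assumes "lam \<noteq> 0" "0 < \<alpha>"
  shows "osc' lam \<alpha> s = 4 * \<i> * width lam \<alpha> s * osc lam \<alpha> s"
  using osc_nonzero[OF assms] by (simp add: width_def)

lemma inverse_osc_derivative:
  assumes "lam \<noteq> 0" "0 < \<alpha>"
  shows "((\<lambda>s. inverse (osc lam \<alpha> s)) has_vector_derivative
    - (inverse (osc lam \<alpha> s) * osc' lam \<alpha> s * inverse (osc lam \<alpha> s))) (at s within S)"
  using Deriv.has_derivative_inverse[OF osc_nonzero[OF assms]
      osc_derivative(1)[OF assms(1), unfolded has_vector_derivative_def]]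
  unfolding has_vector_derivative_def by simp

lemma width_derivative:
  assumes "lam \<noteq> 0" "0 < \<alpha>"
  shows "(width lam \<alpha> has_vector_derivative - \<i> * (4 * (width lam \<alpha> s)\<^sup>2 - of_real (lam\<^sup>2 / 4))) (at s within S)"
proof -
  let ?y = "osc lam \<alpha> s" and ?\<beta> = "width lam \<alpha> s"
  have y: "?y \<noteq> 0" using osc_nonzero[OF assms] .
  note inv = inverse_osc_derivative[OF assms]
  have D: "((\<lambda>s. - (\<i> / 4) * (osc' lam \<alpha> s * inverse (osc lam \<alpha> s))) has_vector_derivative
     - (\<i> / 4) * (osc' lam \<alpha> s * - (inverse ?y * osc' lam \<alpha> s * inverse ?y)
        + - of_real (lam\<^sup>2) * ?y * inverse ?y)) (at s within S)"
    by (intro has_vector_derivative_mult_right has_vector_derivative_mult inv osc_derivative assms)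
  have eq: "- (\<i> / 4) * (osc' lam \<alpha> s * - (inverse ?y * osc' lam \<alpha> s * inverse ?y)
        + - of_real (lam\<^sup>2) * ?y * inverse ?y) = - \<i> * (4 * ?\<beta>\<^sup>2 - of_real (lam\<^sup>2 / 4))"
    unfolding osc'_eq_width[OF assms] using y
    by (simp add: field_simps power2_eq_square)
  show ?thesis using D unfolding eq by (simp only: width_def[abs_def] divide_inverse)
qed

lemma amplitude_derivative:
  assumes "lam \<noteq> 0" "0 < \<alpha>"
  shows "(amplitude d lam \<alpha> has_vector_derivative - (4 * \<i> * of_nat d * width lam \<alpha> s) * amplitude d lam \<alpha> s) (at s within S)"
proof (induction d)
  case 0
  show ?case by (simp add: amplitude_def[abs_def])
next
  case (Suc d)
  let ?y = "osc lam \<alpha> s"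
  have y: "?y \<noteq> 0" using osc_nonzero[OF assms] .
  note inv = inverse_osc_derivative[OF assms]
  have "((\<lambda>s. (of_real \<alpha> * inverse (osc lam \<alpha> s)) * amplitude d lam \<alpha> s) has_vector_derivative
     (of_real \<alpha> * inverse ?y) * (- (4 * \<i> * of_nat d * width lam \<alpha> s) * amplitude d lam \<alpha> s)
     + (of_real \<alpha> * - (inverse ?y * osc' lam \<alpha> s * inverse ?y)) * amplitude d lam \<alpha> s) (at s within S)"
    by (intro has_vector_derivative_mult has_vector_derivative_mult_right inv Suc.IH)
  moreover have "(of_real \<alpha> * inverse ?y) * (- (4 * \<i> * of_nat d * width lam \<alpha> s) * amplitude d lam \<alpha> s)
     + (of_real \<alpha> * - (inverse ?y * osc' lam \<alpha> s * inverse ?y)) * amplitude d lam \<alpha> s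
    = - (4 * \<i> * of_nat (Suc d) * width lam \<alpha> s) * amplitude (Suc d) lam \<alpha> s"
    unfolding osc'_eq_width[OF assms] using y by (simp add: amplitude_def field_simps)
  ultimately show ?case by (simp add: amplitude_def[abs_def] divide_inverse)
qed

text \<open>
  The equations for width and amplitude say that the time derivative is \<open>- \<i>\<close> times
  \<open>flow_velocity\<close>, which is the special Hermite operator applied to the Gaussian.
\<close>

lemma flow_derivative:
  fixes a z :: "complex ^ 'd::finite"
  assumes "lam \<noteq> 0" "0 < \<alpha>"
  shows "((\<lambda>s. flow lam \<alpha> a s z) has_vector_derivative - \<i> * flow_velocity lam \<alpha> a s z) (at s within S)"
proof -
  let ?u = "complex_of_real ((z - a) \<bullet> (z - a))" and ?p = "\<i> * complex_of_real (z \<bullet> twist lam a)"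
  let ?\<beta> = "width lam \<alpha>"
  have alg: "- \<i> * ((4 * b * d - (4 * b\<^sup>2 - L) * u) * (A * e))
      = A * ((\<i> * (4 * b\<^sup>2 - L)) * u * e) + - (4 * \<i> * d * b) * A * e" for b d L u A e :: complex
    by (simp add: algebra_simps)
  have i: "((\<lambda>s. - ?\<beta> s * ?u + ?p) has_vector_derivative
     - (- \<i> * (4 * (?\<beta> s)\<^sup>2 - of_real (lam\<^sup>2 / 4))) * ?u + 0) (at s within S)"
    by (intro has_vector_derivative_add has_vector_derivative_const has_vector_derivative_mult_left
        has_vector_derivative_minus width_derivative assms)
  have e: "((\<lambda>s. exp (- ?\<beta> s * ?u + ?p)) has_vector_derivative
      (\<i> * (4 * (?\<beta> s)\<^sup>2 - of_real (lam\<^sup>2 / 4))) * ?u * exp (- ?\<beta> s * ?u + ?p)) (at s within S)"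
    using field_vector_diff_chain_within[OF i DERIV_exp[THEN DERIV_subset]] by (simp add: o_def mult_ac)
  have "((\<lambda>s. amplitude CARD('d) lam \<alpha> s * exp (- ?\<beta> s * ?u + ?p)) has_vector_derivative
     amplitude CARD('d) lam \<alpha> s * ((\<i> * (4 * (?\<beta> s)\<^sup>2 - of_real (lam\<^sup>2 / 4))) * ?u * exp (- ?\<beta> s * ?u + ?p))
      + - (4 * \<i> * of_nat CARD('d) * ?\<beta> s) * amplitude CARD('d) lam \<alpha> s * exp (- ?\<beta> s * ?u + ?p)) (at s within S)"
    by (intro has_vector_derivative_mult e amplitude_derivative assms)
  moreover have "- \<i> * flow_velocity lam \<alpha> a s z =
     amplitude CARD('d) lam \<alpha> s * ((\<i> * (4 * (?\<beta> s)\<^sup>2 - of_real (lam\<^sup>2 / 4))) * ?u * exp (- ?\<beta> s * ?u + ?p))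
      + - (4 * \<i> * of_nat CARD('d) * ?\<beta> s) * amplitude CARD('d) lam \<alpha> s * exp (- ?\<beta> s * ?u + ?p)"
    unfolding flow_velocity_def flow_def wave_def symbol_def by (rule alg)
  ultimately show ?thesis unfolding flow_def wave_def by simp
qed

lemma flow_uniform_bounds:
  fixes a :: "complex ^ 'd::finite"
  assumes "lam \<noteq> 0" "0 < \<alpha>"
  shows "\<exists>K. \<forall>s z. norm (flow lam \<alpha> a s z) \<le> K * exp (- norm z)
     \<and> norm (flow_velocity lam \<alpha> a s z) \<le> K * exp (- norm z)"
proof -
  \<comment> \<open>Uniform bounds in time: \<open>m\<close> from below for \<open>osc\<close>, \<open>b\<close> from below for the real part of the width, \<open>W\<close>, \<open>A\<close> and \<open>S\<close> from above for the moduli of width, amplitude and symbol.\<close>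
  define m where "m = sqrt (min 1 ((4 * \<alpha> / lam)\<^sup>2))"
  define b where "b = \<alpha> / (1 + (4 * \<alpha> / lam)\<^sup>2)"
  define W where "W = (\<bar>lam\<bar> + 4 * \<alpha>) / m / 4"
  define A where "A = (\<alpha> / m) ^ CARD('d)"
  define S where "S = 4 * W * real CARD('d) + (4 * W\<^sup>2 + lam\<^sup>2 / 4) * (1 + norm a)\<^sup>2"
  have m0: "0 < m" using assms by (simp add: m_def)
  have m: "m \<le> norm (osc lam \<alpha> s)" for s
    unfolding m_def using real_sqrt_le_mono[OF norm_osc_lower[OF assms]] by simp
  have b0: "0 < b" using assms by (simp add: b_def add_pos_nonneg)
  have b: "b \<le> Re (width lam \<alpha> s)" for s
    unfolding b_def Re_width[OF assms] using assms norm_osc_upper osc_nonzero[OF assms]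
    by (intro divide_left_mono mult_pos_pos add_pos_nonneg) auto
  have W: "norm (width lam \<alpha> s) \<le> W" for s
  proof -
    have "norm (osc' lam \<alpha> s) \<le> norm (complex_of_real (- lam * sin (lam * s))) + norm (\<i> * complex_of_real (4 * \<alpha> * cos (lam * s)))"
      unfolding osc'_def by (rule norm_triangle_ineq)
    also have "\<dots> = \<bar>lam\<bar> * \<bar>sin (lam * s)\<bar> + 4 * \<alpha> * \<bar>cos (lam * s)\<bar>"
      using assms by (simp add: norm_mult abs_mult)
    also have "\<dots> \<le> \<bar>lam\<bar> * 1 + 4 * \<alpha> * 1"
      using assms by (intro add_mono mult_left_mono) auto
    finally have n: "norm (osc' lam \<alpha> s) \<le> \<bar>lam\<bar> + 4 * \<alpha>" by simp
    have "norm (osc' lam \<alpha> s) / norm (osc lam \<alpha> s) \<le> (\<bar>lam\<bar> + 4 * \<alpha>) / m"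
      using n m[of s] m0 assms by (intro frac_le) auto
    then show ?thesis by (simp add: width_def W_def norm_mult norm_divide)
  qed
  have A: "norm (amplitude CARD('d) lam \<alpha> s) \<le> A" for s
  proof -
    have "\<alpha> / norm (osc lam \<alpha> s) \<le> \<alpha> / m" using m[of s] m0 assms osc_nonzero[OF assms]
      by (intro divide_left_mono mult_pos_pos) auto
    then show ?thesis using assms by (simp add: amplitude_def A_def norm_power norm_divide power_mono)
  qed
  have W0: "0 \<le> W" using m0 assms by (simp add: W_def)
  have S0: "0 \<le> S" using W0 by (simp add: S_def)
  have A0: "0 \<le> wave_const A b a" using m0 assms by (simp add: A_def wave_const_def)
  define K where "K = 1 * wave_const A b a + S * wave_const A b a"
  have KK: "1 * wave_const A b a \<le> K" "S * wave_const A b a \<le> K" using S0 A0 by (simp_all add: K_def)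
  have "norm (1 * flow lam \<alpha> a s z) \<le> 1 * wave_const A b a * exp (- norm z)" for s z
    unfolding flow_def using b0 b A one_le_square[of z] by (intro norm_wave_exp_bound) auto
  then have "norm (flow lam \<alpha> a s z) \<le> K * exp (- norm z)" for s z
    using order_trans[OF _ mult_right_mono[OF KK(1), of "exp (- norm z)"]] by simp
  moreover have "norm (flow_velocity lam \<alpha> a s z) \<le> S * wave_const A b a * exp (- norm z)" for s z
    unfolding flow_velocity_def flow_def using norm_symbol_le[OF W, of lam s a z, folded S_def] b0 b A S0
    by (intro norm_wave_exp_bound) auto
  then have "norm (flow_velocity lam \<alpha> a s z) \<le> K * exp (- norm z)" for s z
    using order_trans[OF _ mult_right_mono[OF KK(2), of "exp (- norm z)"]] by simp
  ultimately show ?thesis by blast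
qed

lemma Re_width_pos: "lam \<noteq> 0 \<Longrightarrow> 0 < \<alpha> \<Longrightarrow> 0 < Re (width lam \<alpha> s)"
  by (simp add: Re_width osc_nonzero)

lemma flow_sqint: "lam \<noteq> 0 \<Longrightarrow> 0 < \<alpha> \<Longrightarrow> flow lam \<alpha> a s \<in> sqint lborel"
  unfolding flow_def by (intro wave_sqint Re_width_pos)

lemma flow_velocity_sqint: "lam \<noteq> 0 \<Longrightarrow> 0 < \<alpha> \<Longrightarrow> flow_velocity lam \<alpha> a s \<in> sqint lborel"
  unfolding flow_velocity_def[abs_def] flow_def by (intro symbol_wave_sqint Re_width_pos)

text \<open>
  The initial time \<open>\<tau>\<close> of the Gaussian is arbitrary. The choices \<open>\<tau> =
  0\<close> and \<open>\<tau> = - t\<close> compare the solution with a Gaussian that is explicit at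
  the initial and at the final time, respectively.
\<close>

theorem solution_pairing_flow:
  fixes a :: "complex ^ 'd::finite"
  assumes lam: "lam \<noteq> 0" "0 < \<alpha>" and t: "0 \<le> t"
    and fg: "(f, g) \<in> functional_calculus (special_hermite lam)
          (\<lambda>x. exp (- \<i> * complex_of_real t * complex_of_real x))"
  shows "L2_inner g (flow lam \<alpha> a (\<tau> + t)) = L2_inner f (flow lam \<alpha> a \<tau>)"
proof -
  from fg obtain P where P: "projection_valued_measure P" "special_hermite lam = spectral_integral P complex_of_real"
    and fgP: "(f, g) \<in> spectral_integral P (\<lambda>x. exp (- \<i> * complex_of_real t * complex_of_real x))"
    by (auto simp: functional_calculus_def spectral_resolution_def)
  interpret pvm P by unfold_locales (rule P)
  let ?w = "\<lambda>s. flow lam \<alpha> a (\<tau> + s)" and ?v = "\<lambda>s. flow_velocity lam \<alpha> a (\<tau> + s)"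
  obtain K where K: "\<And>s z. norm (flow lam \<alpha> a s z) \<le> K * exp (- norm z)"
    "\<And>s z. norm (flow_velocity lam \<alpha> a s z) \<le> K * exp (- norm z)"
    using flow_uniform_bounds[OF lam] by blast
  let ?E = "\<lambda>z::complex ^ 'd. complex_of_real (K * exp (- norm z))"
  have E: "?E \<in> L2" by (rule exp_minus_norm_L2)
  have "L2_inner g (?w t) = L2_inner f (?w 0)"
  proof (rule spectral_flow_pairing[OF t fgP, where M = "Re (L2_inner ?E ?E)"])
    show "(?w s, ?v s) \<in> spectral_integral P complex_of_real" for s
      unfolding P(2)[symmetric] flow_velocity_def[abs_def] flow_def
      by (intro special_hermite_wave Re_width_pos lam)
    show "Re (L2_inner (?w s) (?w s)) \<le> Re (L2_inner ?E ?E)" for s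
    proof -
      have "(LINT z|lebesgue. (norm (?w s z))\<^sup>2) \<le> (LINT z|lebesgue. (norm (?E z))\<^sup>2)"
      proof (rule integral_mono)
        show "integrable lebesgue (\<lambda>z. (norm (?w s z))\<^sup>2)"
          using sqint_lborel_imp_L2[OF flow_sqint[OF lam], of a "\<tau> + s"] unfolding L2_def by blast
        show "integrable lebesgue (\<lambda>z. (norm (?E z))\<^sup>2)" using E unfolding L2_def by blast
        show "(norm (?w s z))\<^sup>2 \<le> (norm (?E z))\<^sup>2" for z
          unfolding norm_of_real using K(1)[of "\<tau> + s" z] by (intro power_mono) auto
      qed
      then show ?thesis unfolding L2_inner_eq_ip ip_self Re_complex_of_real .
    qed
    fix s h assume s: "s \<in> {0..t}" and h: "(h :: complex ^ 'd \<Rightarrow> complex) \<in> L2"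
    have v: "?v s \<in> L2" for s by (rule sqint_lborel_imp_L2[OF flow_velocity_sqint[OF lam]])
    have "((\<lambda>s. L2_inner h (?w s)) has_vector_derivative L2_inner h (\<lambda>z. - \<i> * ?v s z)) (at s within {0..t})"
    proof (rule L2_inner_has_vector_derivative[OF h E _ s])
      show "?w s \<in> L2" for s by (rule sqint_lborel_imp_L2[OF flow_sqint[OF lam]])
      show "(\<lambda>z. - \<i> * ?v s z) \<in> borel_measurable lebesgue"
        using L2.scale_mem[OF v, of "- \<i>" s] by (simp add: L2_def)
      show "((\<lambda>s. ?w s z) has_vector_derivative - \<i> * ?v s z) (at s within {0..t})" for s z
      proof -
        have "((\<lambda>s. \<tau> + s) has_vector_derivative 1) (at s within {0..t})"
          by (auto intro!: derivative_eq_intros)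
        from vector_diff_chain_within[OF this flow_derivative[OF lam, of a z "\<tau> + s"]]
        show ?thesis by (simp add: o_def)
      qed
      show "norm (- \<i> * ?v s z) \<le> norm (?E z)" for s z
        unfolding norm_of_real using K(2)[of "\<tau> + s" z] by (simp add: norm_mult)
    qed auto
    also have "L2_inner h (\<lambda>z. - \<i> * ?v s z) = \<i> * L2_inner h (?v s)"
      unfolding L2.scale_right[OF v h] by simp
    finally show "((\<lambda>s. L2_inner h (?w s)) has_vector_derivative \<i> * L2_inner h (?v s)) (at s within {0..t})" .
  qed
  then show ?thesis by simp
qed

section \<open>Continuity of translations\<close>

lemma lborel_integral_affine:
  fixes f :: "'a::euclidean_space \<Rightarrow> 'b::{banach, second_countable_topology}"
  assumes f: "f \<in> borel_measurable borel" and c: "c \<noteq> 0"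
  shows "integral\<^sup>L lborel f = (\<bar>c\<bar> ^ DIM('a)) *\<^sub>R (LINT x|lborel. f (t + c *\<^sub>R x))"
proof -
  have "integral\<^sup>L lborel f = integral\<^sup>L (density (distr lborel borel (\<lambda>x. t + c *\<^sub>R x)) (\<lambda>_. ennreal (\<bar>c\<bar> ^ DIM('a)))) f"
    using lborel_affine[OF c, of t] by simp
  also have "\<dots> = (LINT x|distr lborel borel (\<lambda>x. t + c *\<^sub>R x). (\<bar>c\<bar> ^ DIM('a)) *\<^sub>R f x)"
    using f by (intro integral_density) auto
  also have "\<dots> = (LINT x|lborel. (\<bar>c\<bar> ^ DIM('a)) *\<^sub>R f (t + c *\<^sub>R x))"
    using f by (intro integral_distr) auto
  finally show ?thesis by simp
qed

lemma lborel_integral_shift: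
  fixes f :: "'a::euclidean_space \<Rightarrow> 'b::{banach, second_countable_topology}"
  assumes "f \<in> borel_measurable borel"
  shows "(LINT x|lborel. f (x + a)) = integral\<^sup>L lborel f"
  using lborel_integral_affine[OF assms, of 1 a] by (simp add: add.commute)

lemma lborel_integrable_shift:
  fixes f :: "'a::euclidean_space \<Rightarrow> 'b::{banach, second_countable_topology}"
  assumes "integrable lborel f"
  shows "integrable lborel (\<lambda>x. f (x + a))"
proof -
  have "integrable (distr lborel borel ((+) a)) f" using assms by (simp add: lborel_distr_plus)
  then have "integrable lborel (\<lambda>x. f (a + x))"
    using assms by (subst (asm) integrable_distr_eq) auto
  then show ?thesis by (simp add: add.commute)
qed

lemma emeasure_lborel_shift:
  assumes A: "A \<in> sets borel"
  shows "emeasure lborel {x. x + a \<in> A} = emeasure lborel (A :: 'a::euclidean_space set)"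
proof -
  have "emeasure lborel A = emeasure (distr lborel borel ((+) a)) A" by (simp add: lborel_distr_plus)
  also have "\<dots> = emeasure lborel {x. x + a \<in> A}"
    using A by (subst emeasure_distr) (auto simp: vimage_def add.commute)
  finally show ?thesis by simp
qed

lemma borel_shift: "A \<in> sets borel \<Longrightarrow> {x. x + a \<in> A} \<in> sets (borel :: 'a::euclidean_space measure)"
  using measurable_sets[of "\<lambda>x. x + a" borel borel A] by (simp add: vimage_def)

text \<open>
  A closed set inside \<open>A\<close> loses little measure, and cutting it off outside a large ball
  loses little more.
\<close>

lemma inner_regular_compact_lborel:
  fixes A :: "'a::euclidean_space set"
  assumes A: "A \<in> sets borel" and fin: "emeasure lborel A < \<infinity>" and e: "0 < e"
  obtains K where "compact K" "K \<subseteq> A" "emeasure lborel (A - K) < ennreal e"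
proof -
  have Al: "A \<in> sets lebesgue" using A by simp
  obtain F where F: "closed F" "F \<subseteq> A" "emeasure lebesgue (A - F) < ennreal (e / 2)"
    using sets_lebesgue_inner_closed[OF Al half_gt_zero[OF e]] by metis
  have Fb: "F \<in> sets borel" using F by auto
  have F2: "emeasure lborel (A - F) < ennreal (e / 2)"
    using F(3) A Fb by simp
  have lim: "(\<lambda>n. emeasure lborel (F - cball 0 (real n))) \<longlonglongrightarrow> emeasure lborel (\<Inter>n. F - cball 0 (real n))"
  proof (rule Lim_emeasure_decseq)
    show "range (\<lambda>n. F - cball 0 (real n)) \<subseteq> sets lborel" using Fb by auto
    show "decseq (\<lambda>n. F - cball 0 (real n))" by (auto simp: decseq_def)
    show "emeasure lborel (F - cball 0 (real n)) \<noteq> \<infinity>" for n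
    proof -
      have "emeasure lborel (F - cball 0 (real n)) \<le> emeasure lborel A"
        using F A by (intro emeasure_mono) auto
      then show ?thesis using fin by (metis infinity_ennreal_def top.not_eq_extremum top.extremum_uniqueI)
    qed
  qed
  have inter: "(\<Inter>n. F - cball 0 (real n)) = {}"
  proof -
    have "\<exists>n. norm x \<le> real n" for x :: 'a using real_arch_simple by blast
    then show ?thesis by auto
  qed
  have "(\<lambda>n. emeasure lborel (F - cball 0 (real n))) \<longlonglongrightarrow> 0"
    using lim unfolding inter by simp
  then have "\<forall>\<^sub>F n in sequentially. emeasure lborel (F - cball 0 (real n)) < ennreal (e / 2)"
    using e by (intro order_tendstoD) auto
  then obtain n where n: "emeasure lborel (F - cball 0 (real n)) < ennreal (e / 2)"
    by (auto simp: eventually_sequentially)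
  show thesis
  proof (rule that[of "F \<inter> cball 0 (real n)"])
    show "compact (F \<inter> cball 0 (real n))" using F(1) by (intro closed_Int_compact) auto
    show "F \<inter> cball 0 (real n) \<subseteq> A" using F by auto
    have "emeasure lborel (A - F \<inter> cball 0 (real n)) \<le> emeasure lborel ((A - F) \<union> (F - cball 0 (real n)))"
      using A Fb by (intro emeasure_mono) auto
    also have "\<dots> \<le> emeasure lborel (A - F) + emeasure lborel (F - cball 0 (real n))"
      using A Fb by (intro emeasure_subadditive) auto
    also have "\<dots> < ennreal (e / 2) + ennreal (e / 2)" using F2 n by (rule add_strict_mono)
    also have "\<dots> = ennreal e" using e by (simp flip: ennreal_plus)
    finally show "emeasure lborel (A - F \<inter> cball 0 (real n)) < ennreal e" .
  qed
qed

text \<open>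
  Choose a compact \<open>K\<close> inside \<open>A\<close> and an open \<open>U\<close> around
  \<open>K\<close>, both with small differences. For small \<open>h\<close> a point of
  \<open>K\<close> stays in \<open>U\<close>, so it leaves \<open>A\<close> only by entering the
  translate of \<open>U - K\<close>.
\<close>

lemma emeasure_shift_escape_small:
  fixes A :: "'a::euclidean_space set"
  assumes A: "A \<in> sets borel" and fin: "emeasure lborel A < \<infinity>" and e: "0 < e"
  shows "\<exists>\<delta>>0. \<forall>h. norm h < \<delta> \<longrightarrow> emeasure lborel {x \<in> A. x + h \<notin> A} < ennreal e"
proof -
  obtain K where K: "compact K" "K \<subseteq> A" "emeasure lborel (A - K) < ennreal (e / 2)"
    using inner_regular_compact_lborel[OF A fin, of "e / 2"] e by auto
  have Kb: "K \<in> sets borel" using K(1) by (simp add: compact_imp_closed)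
  obtain U where U: "open U" "K \<subseteq> U" "emeasure lborel (U - K) < ennreal (e / 2)"
    using outer_regular_lborel[OF Kb, of "e / 2"] e by auto
  obtain \<delta> where \<delta>: "0 < \<delta>" "(\<Union>x\<in>K. ball x \<delta>) \<subseteq> U"
    using compact_subset_open_imp_ball_epsilon_subset[OF K(1) U(1,2)] by blast
  have "emeasure lborel {x \<in> A. x + h \<notin> A} < ennreal e" if h: "norm h < \<delta>" for h
  proof -
    have UK: "U - K \<in> sets borel" using U Kb by auto
    have sub: "{x \<in> A. x + h \<notin> A} \<subseteq> (A - K) \<union> {x. x + h \<in> U - K}"
    proof
      fix x assume x: "x \<in> {x \<in> A. x + h \<notin> A}"
      show "x \<in> (A - K) \<union> {x. x + h \<in> U - K}"
      proof (cases "x \<in> K")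
        case True
        moreover have "x + h \<in> ball x \<delta>" using h by (simp add: dist_norm)
        ultimately have "x + h \<in> U" using \<delta>(2) by blast
        moreover have "x + h \<notin> K" using x K(2) by auto
        ultimately show ?thesis by auto
      qed (use x in auto)
    qed
    have "emeasure lborel {x \<in> A. x + h \<notin> A} \<le> emeasure lborel ((A - K) \<union> {x. x + h \<in> U - K})"
      using A Kb borel_shift[OF UK] by (intro emeasure_mono sub) auto
    also have "\<dots> \<le> emeasure lborel (A - K) + emeasure lborel {x. x + h \<in> U - K}"
      using A Kb borel_shift[OF UK] by (intro emeasure_subadditive) auto
    also have "\<dots> < ennreal (e / 2) + ennreal (e / 2)"
      unfolding emeasure_lborel_shift[OF UK] using K(3) U(3) by (rule add_strict_mono)
    also have "\<dots> = ennreal e" using e by (simp flip: ennreal_plus)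
    finally show ?thesis .
  qed
  with \<delta>(1) show ?thesis by blast
qed

lemma L1_continuity_of_translation:
  fixes f :: "'a::euclidean_space \<Rightarrow> complex"
  assumes "integrable lborel f"
  shows "\<forall>h. h \<longlonglongrightarrow> 0 \<longrightarrow> (\<lambda>k::nat. LINT x|lborel. norm (f (x + h k) - f x)) \<longlonglongrightarrow> 0"
  using assms
proof (induction rule: integrable_induct)
  case (base A c)
  have A: "A \<in> sets borel" using base by simp
  show ?case
  proof (intro allI impI)
    fix h :: "nat \<Rightarrow> 'a" assume h: "h \<longlonglongrightarrow> 0"
    show "(\<lambda>k. LINT x|lborel. norm (indicat_real A (x + h k) *\<^sub>R c - indicat_real A x *\<^sub>R c)) \<longlonglongrightarrow> 0"
    proof (rule LIMSEQ_I)
      fix r :: real assume r: "0 < r"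
      \<comment> \<open>The two indicators differ on two sets of measure below \<open>e\<close>; adding \<open>1\<close> avoids dividing by zero.\<close>
      define e where "e = r / (2 * (norm c + 1))"
      have e: "0 < e" using r by (simp add: e_def add_nonneg_pos)
      obtain \<delta> where \<delta>: "0 < \<delta>" "\<And>h. norm h < \<delta> \<Longrightarrow> emeasure lborel {x \<in> A. x + h \<notin> A} < ennreal e"
        using emeasure_shift_escape_small[OF A base(2) e] by blast
      obtain k0 where k0: "\<And>k. k \<ge> k0 \<Longrightarrow> norm (h k) < \<delta>"
        using LIMSEQ_D[OF h \<delta>(1)] by auto
      show "\<exists>no. \<forall>k\<ge>no. norm ((LINT x|lborel. norm (indicat_real A (x + h k) *\<^sub>R c - indicat_real A x *\<^sub>R c)) - 0) < r"
      proof (intro exI allI impI)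
        fix k assume "k0 \<le> k"
        then have hk: "norm (h k) < \<delta>" "norm (- h k) < \<delta>" using k0 by auto
        let ?X = "{x \<in> A. x + h k \<notin> A}" and ?Y = "{x. x + h k \<in> {x \<in> A. x + (- h k) \<notin> A}}"
        have Xb: "{x \<in> A. x + b \<notin> A} \<in> sets borel" for b
        proof -
          have "{x \<in> A. x + b \<notin> A} = A - {x. x + b \<in> A}" by auto
          then show ?thesis using A borel_shift[OF A, of b] by auto
        qed
        have X: "?X \<in> sets lborel" "?Y \<in> sets lborel" using Xb[of "h k"] borel_shift[OF Xb[of "- h k"], of "h k"] by auto
        have eX: "emeasure lborel ?X < ennreal e" using \<delta>(2)[OF hk(1)] .
        have eY: "emeasure lborel ?Y < ennreal e"
          using \<delta>(2)[OF hk(2)] emeasure_lborel_shift[OF Xb[of "- h k"], of "h k"] by simp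
        have fX: "emeasure lborel ?X < \<infinity>" "emeasure lborel ?Y < \<infinity>"
          using eX eY by (auto intro: order_less_trans)
        have mX: "measure lborel ?X < e" and mY: "measure lborel ?Y < e"
          using eX eY fX by (simp_all add: emeasure_eq_ennreal_measure ennreal_less_iff)
        have "norm (indicat_real A (x + h k) *\<^sub>R c - indicat_real A x *\<^sub>R c) = norm c * (indicat_real ?X x + indicat_real ?Y x)" for x
          by (auto simp: indicator_def)
        then have "(LINT x|lborel. norm (indicat_real A (x + h k) *\<^sub>R c - indicat_real A x *\<^sub>R c))
           = norm c * (measure lborel ?X + measure lborel ?Y)"
          using X fX by simp
        also have "\<dots> \<le> norm c * (e + e)" using mX mY by (intro mult_left_mono) auto
        also have "\<dots> < (norm c + 1) * (e + e)" using e by (intro mult_strict_right_mono) auto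
        also have "\<dots> = r" using e_def by (simp add: field_simps add_nonneg_eq_0_iff) 
        finally show "norm ((LINT x|lborel. norm (indicat_real A (x + h k) *\<^sub>R c - indicat_real A x *\<^sub>R c)) - 0) < r"
          by simp
      qed
    qed
  qed
next
  case (add f g)
  show ?case
  proof (intro allI impI)
    fix h :: "nat \<Rightarrow> 'a" assume h: "h \<longlonglongrightarrow> 0"
    have sh: "integrable lborel (\<lambda>x. f (x + h k))" "integrable lborel (\<lambda>x. g (x + h k))" for k
      using add by (auto intro: lborel_integrable_shift)
    show "(\<lambda>k. LINT x|lborel. norm (f (x + h k) + g (x + h k) - (f x + g x))) \<longlonglongrightarrow> 0"
    proof (rule tendsto_sandwich[OF _ _ tendsto_const])
      show "\<forall>\<^sub>F k in sequentially. 0 \<le> (LINT x|lborel. norm (f (x + h k) + g (x + h k) - (f x + g x)))" by simp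
      show "\<forall>\<^sub>F k in sequentially. (LINT x|lborel. norm (f (x + h k) + g (x + h k) - (f x + g x)))
        \<le> (LINT x|lborel. norm (f (x + h k) - f x)) + (LINT x|lborel. norm (g (x + h k) - g x))"
      proof (intro always_eventually allI)
        fix k
        have "(LINT x|lborel. norm (f (x + h k) + g (x + h k) - (f x + g x)))
          \<le> (LINT x|lborel. norm (f (x + h k) - f x) + norm (g (x + h k) - g x))"
          using add sh by (intro integral_mono norm_diff_triangle_ineq) auto
        also have "\<dots> = (LINT x|lborel. norm (f (x + h k) - f x)) + (LINT x|lborel. norm (g (x + h k) - g x))"
          using add sh by (intro Bochner_Integration.integral_add) auto
        finally show "(LINT x|lborel. norm (f (x + h k) + g (x + h k) - (f x + g x)))
        \<le> (LINT x|lborel. norm (f (x + h k) - f x)) + (LINT x|lborel. norm (g (x + h k) - g x))" .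
      qed
      show "(\<lambda>k. (LINT x|lborel. norm (f (x + h k) - f x)) + (LINT x|lborel. norm (g (x + h k) - g x))) \<longlonglongrightarrow> 0"
        using add h by (auto intro: tendsto_add_zero)
    qed
  qed
next
  case (lim f s)
  have fi: "integrable lborel f" using lim by blast
  have si: "integrable lborel (s i)" for i using lim by blast
  have ds: "(\<lambda>i. LINT x|lborel. norm (s i x - f x)) \<longlonglongrightarrow> (LINT x|(lborel :: 'a measure). 0)"
  proof (rule integral_dominated_convergence)
    show "integrable lborel (\<lambda>x. 3 * norm (f x))" using fi by simp
    show "AE x in lborel. (\<lambda>i. norm (s i x - f x)) \<longlonglongrightarrow> 0"
      using lim.hyps(2) by (intro AE_I2) (auto intro!: tendsto_norm_zero LIM_zero)
    show "AE x in lborel. norm (norm (s i x - f x)) \<le> 3 * norm (f x)" for i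
    proof (intro AE_I2)
      fix x :: 'a
      have "norm (s i x - f x) \<le> norm (s i x) + norm (f x)" by (rule norm_triangle_ineq4)
      also have "norm (s i x) \<le> 2 * norm (f x)" using lim.hyps(3)[of x i] by simp
      finally show "norm (norm (s i x - f x)) \<le> 3 * norm (f x)" by simp
    qed
    show "(\<lambda>x. norm (s i x - f x)) \<in> borel_measurable lborel" for i
      by (rule borel_measurable_integrable[OF integrable_norm[OF Bochner_Integration.integrable_diff[OF si fi]]])
  qed auto
  show ?case
  proof (intro allI impI)
    fix h :: "nat \<Rightarrow> 'a" assume h: "h \<longlonglongrightarrow> 0"
    have sh: "integrable lborel (\<lambda>x. f (x + b))" "integrable lborel (\<lambda>x. s i (x + b))" for b i
      using fi si by (auto intro: lborel_integrable_shift)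
    show "(\<lambda>k. LINT x|lborel. norm (f (x + h k) - f x)) \<longlonglongrightarrow> 0"
    proof (rule LIMSEQ_I)
      fix r :: real assume r: "0 < r"
      obtain i where i: "(LINT x|lborel. norm (s i x - f x)) < r / 3"
        using LIMSEQ_D[OF ds, of "r / 3"] r by auto
      obtain k0 where k0: "\<And>k. k \<ge> k0 \<Longrightarrow> (LINT x|lborel. norm (s i (x + h k) - s i x)) < r / 3"
        using LIMSEQ_D[OF lim.IH[rule_format, OF h, of i], of "r / 3"] r by auto
      show "\<exists>no. \<forall>k\<ge>no. norm ((LINT x|lborel. norm (f (x + h k) - f x)) - 0) < r"
      proof (intro exI allI impI)
        fix k assume k: "k0 \<le> k"
        have sh2: "(LINT x|lborel. norm (s i (x + h k) - f (x + h k))) = (LINT x|lborel. norm (s i x - f x))"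
          using si fi by (intro lborel_integral_shift) (auto dest: borel_measurable_integrable)
        have "(LINT x|lborel. norm (f (x + h k) - f x)) \<le>
          (LINT x|lborel. norm (s i (x + h k) - f (x + h k)) + norm (s i (x + h k) - s i x) + norm (s i x - f x))"
        proof (intro integral_mono)
          fix x
          have "f (x + h k) - f x = - (s i (x + h k) - f (x + h k)) + (s i (x + h k) - s i x) + (s i x - f x)" by simp
          then show "norm (f (x + h k) - f x) \<le> norm (s i (x + h k) - f (x + h k)) + norm (s i (x + h k) - s i x) + norm (s i x - f x)"
            by (smt (verit) norm_minus_cancel norm_triangle_ineq)
        qed (use sh fi si in auto)
        also have "\<dots> = (LINT x|lborel. norm (s i (x + h k) - f (x + h k))) + (LINT x|lborel. norm (s i (x + h k) - s i x)) + (LINT x|lborel. norm (s i x - f x))"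
          using sh fi si by (subst Bochner_Integration.integral_add) (auto intro!: Bochner_Integration.integral_add)
        also have "\<dots> < r" using sh2 i k0[OF k] by simp
        finally show "norm ((LINT x|lborel. norm (f (x + h k) - f x)) - 0) < r" by simp
      qed
    qed
  qed
qed

text \<open>
  Take the inner product of \<open>|u| u - |w| w\<close> with \<open>u - w\<close>. The inequality
  deduces continuity of translations in \<open>L2\<close> from continuity in \<open>L1\<close>,
  applied to \<open>|f| f\<close>.
\<close>

lemma norm_diff_square_le_scaled:
  fixes u w :: complex
  shows "(norm (u - w))\<^sup>2 \<le> 2 * norm (of_real (norm u) * u - of_real (norm w) * w)"
proof (cases "u = w")
  case False
  let ?p = "norm u" and ?q = "norm w" and ?d = "u - w"
  let ?D = "of_real ?p * u - of_real ?q * w"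
  have uu: "u \<bullet> u = ?p\<^sup>2" "w \<bullet> w = ?q\<^sup>2" by (simp_all add: power2_norm_eq_inner)
  have dd: "(norm ?d)\<^sup>2 = ?p\<^sup>2 - 2 * (u \<bullet> w) + ?q\<^sup>2"
    by (simp add: power2_norm_eq_inner inner_diff inner_commute algebra_simps)
  have D: "?D = ?p *\<^sub>R u - ?q *\<^sub>R w" by (simp only: scaleR_conv_of_real)
  have "?D \<bullet> ?d = ?p * ?p\<^sup>2 - (?p + ?q) * (u \<bullet> w) + ?q * ?q\<^sup>2"
    unfolding D using uu by (simp add: inner_diff inner_commute algebra_simps)
  then have "2 * (?D \<bullet> ?d) = (?p + ?q) * (norm ?d)\<^sup>2 + (?p + ?q) * (?p - ?q)\<^sup>2"
    unfolding dd by (simp add: power2_eq_square algebra_simps)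
  then have "(?p + ?q) * (norm ?d)\<^sup>2 \<le> 2 * (?D \<bullet> ?d)" by simp
  also have "\<dots> \<le> 2 * (norm ?D * norm ?d)"
    using Cauchy_Schwarz_ineq2[of ?D ?d] by simp
  finally have "(?p + ?q) * (norm ?d)\<^sup>2 \<le> 2 * (norm ?D * norm ?d)" .
  moreover have "norm ?d * (norm ?d)\<^sup>2 \<le> (?p + ?q) * (norm ?d)\<^sup>2"
    by (intro mult_right_mono norm_triangle_ineq4) simp
  ultimately have "norm ?d * (norm ?d)\<^sup>2 \<le> 2 * (norm ?D * norm ?d)" by linarith
  then have "norm ?d * (norm ?d)\<^sup>2 \<le> norm ?d * (2 * norm ?D)" by (simp add: mult_ac)
  then show ?thesis using False by simp
qed simp

lemma L2_continuity_of_translation: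
  fixes f :: "'a::euclidean_space \<Rightarrow> complex"
  assumes f: "f \<in> sqint lborel" and h: "h \<longlonglongrightarrow> (0 :: 'a)"
  shows "(\<lambda>k. LINT x|lborel. (norm (f (x + h k) - f x))\<^sup>2) \<longlonglongrightarrow> 0"
proof -
  let ?F = "\<lambda>x. of_real (norm (f x)) * f x"
  have fm[measurable]: "f \<in> borel_measurable borel" using f by (simp add: sqint_def)
  have F: "integrable lborel ?F"
  proof (rule Bochner_Integration.integrable_bound)
    show "integrable lborel (\<lambda>x. (norm (f x))\<^sup>2)" using f by (simp add: sqint_def)
    show "?F \<in> borel_measurable lborel" by measurable
  qed (simp add: norm_mult power2_eq_square)
  have Fs: "integrable lborel (\<lambda>x. ?F (x + b))" for b by (rule lborel_integrable_shift[OF F])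
  have lim: "(\<lambda>k. 2 * (LINT x|lborel. norm (?F (x + h k) - ?F x))) \<longlonglongrightarrow> 0"
    using tendsto_mult_right_zero[OF L1_continuity_of_translation[OF F, rule_format, OF h]] .
  show ?thesis
  proof (rule tendsto_sandwich[OF _ _ tendsto_const lim])
    show "\<forall>\<^sub>F k in sequentially. (LINT x|lborel. (norm (f (x + h k) - f x))\<^sup>2) \<le> 2 * (LINT x|lborel. norm (?F (x + h k) - ?F x))"
    proof (intro always_eventually allI)
      fix k
      have i: "integrable lborel (\<lambda>x. 2 * norm (?F (x + h k) - ?F x))"
        using F Fs by (intro integrable_mult_right integrable_norm Bochner_Integration.integrable_diff)
      have "(LINT x|lborel. (norm (f (x + h k) - f x))\<^sup>2) \<le> (LINT x|lborel. 2 * norm (?F (x + h k) - ?F x))"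
      proof (intro integral_mono norm_diff_square_le_scaled i)
        show "integrable lborel (\<lambda>x. (norm (f (x + h k) - f x))\<^sup>2)"
          by (rule Bochner_Integration.integrable_bound[OF i])
            (measurable, auto intro!: AE_I2 order_trans[OF norm_diff_square_le_scaled])
      qed
      then show "(LINT x|lborel. (norm (f (x + h k) - f x))\<^sup>2) \<le> 2 * (LINT x|lborel. norm (?F (x + h k) - ?F x))"
        by simp
    qed
  qed simp
qed

section \<open>Twisted translations and approximate identities\<close>

text \<open>
  The integral of each \<open>bump n\<close> is \<open>gauss_mass\<close>, a positive constant that
  all estimates carry along.
\<close>

definition bump :: "nat \<Rightarrow> 'a::euclidean_space \<Rightarrow> complex" where
  "bump n v = of_real (real (Suc n) ^ DIM('a) * exp (- ((real (Suc n))\<^sup>2 * (v \<bullet> v))))"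

definition gauss_mass :: "'a::euclidean_space itself \<Rightarrow> real" where
  "gauss_mass _ = (LINT v|lborel. exp (- ((v::'a) \<bullet> v)))"

lemma gauss_le_exp_norm: "exp (- (v \<bullet> v)) \<le> exp (9 / 4) * exp (- norm (v :: 'a::real_inner))"
proof -
  have "1 * exp (- 1 * (norm (v - 0))\<^sup>2) \<le> (1 + norm v)\<^sup>2 * exp (- 1 * (norm (v - 0))\<^sup>2)"
    by (intro mult_right_mono one_le_square) simp
  also have "\<dots> \<le> exp (3 * norm (0::'a) + 9 / (4 * 1)) * exp (- norm v)"
    by (rule polynomial_gaussian_bound) simp
  finally show ?thesis by (simp add: power2_norm_eq_inner)
qed

lemma integrable_gauss: "integrable lborel (\<lambda>v::'a::euclidean_space. exp (- (v \<bullet> v)))"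
proof (rule Bochner_Integration.integrable_bound)
  show "integrable lborel (\<lambda>v::'a. exp (9 / 4) * exp (- norm v))"
    using integrable_exp_minus_norm[of 1, where 'a = 'a] by simp
  show "AE v::'a in lborel. norm (exp (- (v \<bullet> v))) \<le> norm (exp (9 / 4) * exp (- norm v))"
    using gauss_le_exp_norm by (intro AE_I2) (simp add: abs_mult)
qed simp

lemma gauss_mass_pos: "0 < gauss_mass TYPE('a::euclidean_space)"
proof -
  let ?g = "\<lambda>v::'a. exp (- (v \<bullet> v))"
  have "integral\<^sup>L lborel ?g \<noteq> 0"
  proof
    assume "integral\<^sup>L lborel ?g = 0"
    then have "AE v in lborel. ?g v = 0"
      using integral_nonneg_eq_0_iff_AE[OF integrable_gauss[where 'a = 'a]] by simp
    then have "AE v::'a in lborel. False" by simp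
    then have "emeasure lborel (UNIV :: 'a set) = 0"
      using AE_iff_measurable[of UNIV "lborel :: 'a measure" "\<lambda>_. False"] by simp
    then show False by simp
  qed
  moreover have "0 \<le> integral\<^sup>L lborel ?g" by (rule Bochner_Integration.integral_nonneg) simp
  ultimately show ?thesis unfolding gauss_mass_def by linarith
qed

locale twisted_translation =
  fixes J :: "'a::euclidean_space \<Rightarrow> 'a"
  assumes linear_J: "linear J" and antisym: "x \<bullet> J y = - (y \<bullet> J x)"
begin

lemma inner_J_self [simp]: "x \<bullet> J x = 0"
  using antisym[of x x] by simp

lemma J_measurable [measurable]: "J \<in> borel_measurable borel"
  by (intro borel_measurable_continuous_onI linear_continuous_on linear_J linear_conv_bounded_linear[THEN iffD1])

definition tw :: "'a \<Rightarrow> ('a \<Rightarrow> complex) \<Rightarrow> 'a \<Rightarrow> complex" where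
  "tw a h z = exp (\<i> * of_real (z \<bullet> J a)) * h (z - a)"

lemma norm_tw [simp]: "norm (tw a h z) = norm (h (z - a))"
  by (simp add: tw_def norm_mult)

lemma tw_measurable [measurable]:
  assumes [measurable]: "h \<in> borel_measurable borel"
  shows "tw a h \<in> borel_measurable borel"
  unfolding tw_def[abs_def] by measurable

lemma tw_sqint: "h \<in> sqint lborel \<Longrightarrow> tw a h \<in> sqint lborel"
  using lborel_integrable_shift[of "\<lambda>z. (norm (h z))\<^sup>2" "- a"]
  by (auto simp: sqint_def intro: tw_measurable)

lemma tw_tw: "tw b (tw a h) z = exp (- \<i> * of_real (b \<bullet> J a)) * tw (a + b) h z"
proof -
  have "exp (\<i> * of_real (z \<bullet> J b)) * exp (\<i> * of_real ((z - b) \<bullet> J a))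
      = exp (- \<i> * of_real (b \<bullet> J a)) * exp (\<i> * of_real (z \<bullet> J (a + b)))"
    unfolding exp_add[symmetric] linear_add[OF linear_J] by (simp add: inner_diff inner_add algebra_simps)
  then show ?thesis by (simp add: tw_def algebra_simps)
qed

lemma ip_tw:
  assumes "f \<in> borel_measurable borel" "g \<in> borel_measurable borel"
  shows "ip lborel (tw b f) g = ip lborel f (tw (- b) g)"
proof -
  have "ip lborel (tw b f) g = (LINT z|lborel. tw b f (z + b) * cnj (g (z + b)))"
    unfolding ip_def using assms
    by (subst lborel_integral_shift) (auto intro!: borel_measurable_times borel_measurable_cnj tw_measurable)
  also have "\<dots> = ip lborel f (tw (- b) g)"
    unfolding ip_def
  proof (intro Bochner_Integration.integral_cong refl)
    fix z
    have "cnj (exp (\<i> * of_real (z \<bullet> J (- b)))) = exp (\<i> * of_real ((z + b) \<bullet> J b))"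
      unfolding exp_cnj linear_neg[OF linear_J] by (simp add: inner_add)
    then show "tw b f (z + b) * cnj (g (z + b)) = f z * cnj (tw (- b) g z)"
      by (simp add: tw_def mult_ac)
  qed
  finally show ?thesis .
qed

text \<open>
  Viewing the pairing of \<open>f\<close> with \<open>tw a (bump n)\<close> as a function of
  \<open>a\<close> shifts \<open>f\<close> by the twisted translations from the other side.
\<close>

definition cotw :: "'a \<Rightarrow> ('a \<Rightarrow> complex) \<Rightarrow> 'a \<Rightarrow> complex" where
  "cotw h f a = exp (\<i> * of_real (a \<bullet> J h)) * f (a + h)"

lemma norm_cotw [simp]: "norm (cotw h f a) = norm (f (a + h))"
  by (simp add: cotw_def norm_mult)

lemma cotw_measurable [measurable]:
  assumes [measurable]: "f \<in> borel_measurable borel"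
  shows "cotw h f \<in> borel_measurable borel"
  unfolding cotw_def[abs_def] by measurable

lemma cotw_sqint: "f \<in> sqint lborel \<Longrightarrow> cotw h f \<in> sqint lborel"
  using lborel_integrable_shift[of "\<lambda>z. (norm (f z))\<^sup>2" h]
  by (auto simp: sqint_def intro: cotw_measurable)

lemma ip_cotw_self: "f \<in> borel_measurable borel \<Longrightarrow> ip lborel (cotw h f) (cotw h f) = ip lborel f f"
  unfolding ip_self using lborel_integral_shift[of "\<lambda>z. (norm (f z))\<^sup>2" h] by simp

text \<open>
  Substitute \<open>a + v / (n + 1)\<close> for the variable of integration; the power of \<open>n +
  1\<close> in \<open>bump\<close> is the Jacobian.
\<close>

lemma ip_tw_bump:
  assumes f: "f \<in> borel_measurable borel"
  shows "ip lborel f (tw a (bump n))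
    = (LINT v|lborel. cotw (v /\<^sub>R real (Suc n)) f a * of_real (exp (- (v \<bullet> v))))"
proof -
  let ?m = "real (Suc n)"
  let ?c = "\<bar>inverse ?m\<bar> ^ DIM('a)"
  have [measurable]: "bump n \<in> borel_measurable (borel :: 'a measure)"
    unfolding bump_def[abs_def] by measurable
  have m: "inverse ?m \<noteq> 0" by simp
  have "ip lborel f (tw a (bump n))
     = ?c *\<^sub>R (LINT v|lborel. f (a + v /\<^sub>R ?m) * cnj (tw a (bump n) (a + v /\<^sub>R ?m)))"
    unfolding ip_def
    by (rule lborel_integral_affine[OF _ m])
      (use f in \<open>intro borel_measurable_times borel_measurable_cnj tw_measurable; simp\<close>)
  also have "\<dots> = (LINT v|lborel. ?c *\<^sub>R (f (a + v /\<^sub>R ?m) * cnj (tw a (bump n) (a + v /\<^sub>R ?m))))"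
    by simp
  also have "\<dots> = (LINT v|lborel. cotw (v /\<^sub>R ?m) f a * of_real (exp (- (v \<bullet> v))))"
  proof (intro Bochner_Integration.integral_cong refl)
    fix v
    have c: "cnj (exp (\<i> * of_real ((a + v /\<^sub>R ?m) \<bullet> J a))) = exp (\<i> * of_real (a \<bullet> J (v /\<^sub>R ?m)))"
      unfolding exp_cnj antisym[of a "v /\<^sub>R ?m"] by (simp add: inner_add)
    have q: "?m\<^sup>2 * ((v /\<^sub>R ?m) \<bullet> (v /\<^sub>R ?m)) = v \<bullet> v"
      by (simp add: power2_eq_square field_simps del: of_nat_Suc)
    have s: "?c * ?m ^ DIM('a) = 1"
      by (simp add: power_mult_distrib[symmetric] del: of_nat_Suc)
    have "?c *\<^sub>R (f (a + v /\<^sub>R ?m) * cnj (tw a (bump n) (a + v /\<^sub>R ?m)))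
       = cotw (v /\<^sub>R ?m) f a * of_real ((?c * ?m ^ DIM('a)) * exp (- (v \<bullet> v)))"
      unfolding tw_def cotw_def complex_cnj_mult c bump_def add_diff_cancel_left' q scaleR_conv_of_real of_real_mult
      by (simp only: complex_cnj_complex_of_real mult_ac of_real_mult complex_cnj_mult)
    then show "?c *\<^sub>R (f (a + v /\<^sub>R ?m) * cnj (tw a (bump n) (a + v /\<^sub>R ?m)))
       = cotw (v /\<^sub>R ?m) f a * of_real (exp (- (v \<bullet> v)))"
      unfolding s by simp
  qed
  finally show ?thesis .
qed

lemma norm_ip_cotw_le:
  assumes f: "f \<in> sqint lborel"
  shows "norm (ip lborel (cotw h f) f) \<le> Re (ip lborel f f)"
proof (rule power2_le_imp_le)
  have "f \<in> borel_measurable borel" using f by (simp add: sqint_def)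
  then show "(norm (ip lborel (cotw h f) f))\<^sup>2 \<le> (Re (ip lborel f f))\<^sup>2"
    using sqint.Cauchy_Schwarz_square[OF cotw_sqint[OF f] f, of h]
    by (simp add: ip_cotw_self power2_eq_square)
qed (rule sqint.nonneg[OF f])

lemma ip_cotw_tendsto:
  assumes f: "f \<in> sqint lborel" and h: "h \<longlonglongrightarrow> 0"
  shows "(\<lambda>n. ip lborel (cotw (h n) f) f) \<longlonglongrightarrow> ip lborel f f"
proof -
  let ?N = "Re (ip lborel f f)"
  have fm[measurable]: "f \<in> borel_measurable borel" using f by (simp add: sqint_def)
  define p where "p n a = exp (\<i> * of_real (a \<bullet> J (h n))) * f a" for n a
  have norm_p: "norm (p n a) = norm (f a)" for n a by (simp add: p_def norm_mult)
  have pm[measurable]: "p n \<in> borel_measurable borel" for n unfolding p_def[abs_def] by measurable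
  have p: "p n \<in> sqint lborel" for n by (rule sqint_bound[OF f]) (simp_all add: norm_p)
  have "(\<lambda>n. ip lborel (cotw (h n) f) f - ip lborel (p n) f) \<longlonglongrightarrow> 0"
  proof (rule Lim_null_comparison)
    let ?d = "\<lambda>n. LINT a|lborel. (norm (f (a + h n) - f a))\<^sup>2"
    show "\<forall>\<^sub>F n in sequentially. norm (ip lborel (cotw (h n) f) f - ip lborel (p n) f) \<le> sqrt (?d n * ?N)"
    proof (intro always_eventually allI)
      fix n
      let ?u = "\<lambda>a. cotw (h n) f a - p n a"
      have "norm (?u a) = norm (f (a + h n) - f a)" for a
        unfolding cotw_def p_def right_diff_distrib[symmetric] norm_mult by simp
      then have "Re (ip lborel ?u ?u) = ?d n" unfolding ip_self by simp
      then have "(norm (ip lborel ?u f))\<^sup>2 \<le> ?d n * ?N"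
        using sqint.Cauchy_Schwarz_square[OF sqint.diff_mem[OF cotw_sqint[OF f] p] f, of "h n" n] by simp
      then show "norm (ip lborel (cotw (h n) f) f - ip lborel (p n) f) \<le> sqrt (?d n * ?N)"
        unfolding sqint.diff_left[OF cotw_sqint[OF f] p f, symmetric] by (rule real_le_rsqrt)
    qed
    have "(\<lambda>n. sqrt (?d n * ?N)) \<longlonglongrightarrow> sqrt (0 * ?N)"
      by (intro tendsto_intros L2_continuity_of_translation[OF f h])
    then show "(\<lambda>n. sqrt (?d n * ?N)) \<longlonglongrightarrow> 0" by simp
  qed
  moreover have "(\<lambda>n. ip lborel (p n) f) \<longlonglongrightarrow> ip lborel f f"
    unfolding ip_def
  proof (rule integral_dominated_convergence)
    show "integrable lborel (\<lambda>a. norm (f a * cnj (f a)))"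
      using f by (intro integrable_norm ip_integrable)
    show "AE a in lborel. (\<lambda>n. p n a * cnj (f a)) \<longlonglongrightarrow> f a * cnj (f a)"
    proof (intro AE_I2)
      fix a
      have "(\<lambda>n. J (h n)) \<longlonglongrightarrow> J 0"
        by (rule bounded_linear.tendsto[OF linear_conv_bounded_linear[THEN iffD1, OF linear_J] h])
      then have "(\<lambda>n. p n a * cnj (f a)) \<longlonglongrightarrow> exp (\<i> * of_real (a \<bullet> J 0)) * f a * cnj (f a)"
        unfolding p_def by (intro tendsto_intros)
      then show "(\<lambda>n. p n a * cnj (f a)) \<longlonglongrightarrow> f a * cnj (f a)" using linear_0[OF linear_J] by simp
    qed
    show "AE a in lborel. norm (p n a * cnj (f a)) \<le> norm (f a * cnj (f a))" for n
      by (simp add: norm_mult norm_p)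
    show "(\<lambda>a. f a * cnj (f a)) \<in> borel_measurable lborel"
      "(\<lambda>a. p n a * cnj (f a)) \<in> borel_measurable lborel" for n by measurable
  qed
  ultimately show ?thesis using tendsto_add by fastforce
qed

text \<open>
  By Fubini the integral is a Gaussian average over \<open>v\<close> of the inner product of
  \<open>f\<close> with its shift by \<open>v / (n + 1)\<close>. These inner products are bounded
  and tend to the squared norm of \<open>f\<close>.
\<close>

theorem bump_approximate_identity:
  assumes f: "f \<in> sqint lborel"
  shows "(\<lambda>n. LINT a|lborel. ip lborel f (tw a (bump n)) * cnj (f a))
     \<longlonglongrightarrow> of_real (gauss_mass TYPE('a)) * ip lborel f f"
proof -
  have fm[measurable]: "f \<in> borel_measurable borel" using f by (simp add: sqint_def)
  let ?g = "\<lambda>v::'a. complex_of_real (exp (- (v \<bullet> v)))"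
  let ?N = "Re (ip lborel f f)"
  let ?h = "\<lambda>n v. v /\<^sub>R real (Suc n)"
  define H where "H n v a = cotw (?h n v) f a * cnj (f a) * ?g v" for n v a
  have Hm: "(\<lambda>(v, a). H n v a) \<in> borel_measurable (lborel \<Otimes>\<^sub>M lborel)" for n
    unfolding H_def cotw_def by measurable
  have Hi: "integrable lborel (H n v)" for n v
    unfolding H_def[abs_def] by (intro integrable_mult_left ip_integrable cotw_sqint f)
  have H_norm: "(LINT a|lborel. norm (H n v a)) \<le> 2 * ?N * exp (- (v \<bullet> v))" for n v
  proof -
    have sh: "integrable lborel (\<lambda>a. (norm (f (a + ?h n v)))\<^sup>2)" and sq: "integrable lborel (\<lambda>a. (norm (f a))\<^sup>2)"
      using f lborel_integrable_shift[of "\<lambda>a. (norm (f a))\<^sup>2"] by (auto simp: sqint_def)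
    have "(LINT a|lborel. norm (H n v a)) \<le> (LINT a|lborel. ((norm (f (a + ?h n v)))\<^sup>2 + (norm (f a))\<^sup>2) * exp (- (v \<bullet> v)))"
    proof (intro integral_mono integrable_norm Hi)
      fix a
      show "norm (H n v a) \<le> ((norm (f (a + ?h n v)))\<^sup>2 + (norm (f a))\<^sup>2) * exp (- (v \<bullet> v))"
        using mult_right_mono[OF norm_mult_le_squares[of "cotw (?h n v) f a" "cnj (f a)"], of "exp (- (v \<bullet> v))"]
        by (simp add: H_def norm_mult)
    qed (use sh sq in simp)
    also have "\<dots> = 2 * ?N * exp (- (v \<bullet> v))"
      using sh sq lborel_integral_shift[of "\<lambda>a. (norm (f a))\<^sup>2" "?h n v"] by (simp add: ip_self)
    finally show ?thesis .
  qed
  have Hint: "integrable (lborel \<Otimes>\<^sub>M lborel) (\<lambda>(v, a). H n v a)" for n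
  proof (rule lborel_pair.Fubini_integrable[OF Hm])
    show "AE v in lborel. integrable lborel (\<lambda>a. case (v, a) of (v, a) \<Rightarrow> H n v a)"
      using Hi by (intro AE_I2) simp
    show "integrable lborel (\<lambda>v. LINT a|lborel. norm (case (v, a) of (v, a) \<Rightarrow> H n v a))"
    proof (rule Bochner_Integration.integrable_bound)
      show "integrable lborel (\<lambda>v::'a. 2 * ?N * exp (- (v \<bullet> v)))"
        by (intro integrable_mult_right integrable_gauss)
      show "(\<lambda>v. LINT a|lborel. norm (case (v, a) of (v, a) \<Rightarrow> H n v a)) \<in> borel_measurable lborel"
        unfolding H_def cotw_def by measurable
    qed (intro AE_I2, simp, rule order_trans[OF H_norm abs_ge_self])
  qed
  have Q: "(LINT a|lborel. ip lborel f (tw a (bump n)) * cnj (f a)) = (LINT v|lborel. ip lborel (cotw (?h n v) f) f * ?g v)" for n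
  proof -
    have "(LINT a|lborel. ip lborel f (tw a (bump n)) * cnj (f a)) = (LINT a|lborel. (LINT v|lborel. H n v a))"
      unfolding ip_tw_bump[OF fm] integral_mult_left_zero[symmetric] H_def by (simp only: mult_ac)
    also have "\<dots> = (LINT v|lborel. (LINT a|lborel. H n v a))"
      by (rule lborel_pair.Fubini_integral[OF Hint])
    also have "\<dots> = (LINT v|lborel. ip lborel (cotw (?h n v) f) f * ?g v)"
      unfolding H_def ip_def integral_mult_left_zero ..
    finally show ?thesis .
  qed
  have "(\<lambda>n. inverse (real (Suc n)) *\<^sub>R v) \<longlonglongrightarrow> 0 *\<^sub>R v" for v :: 'a
    by (intro tendsto_intros LIMSEQ_inverse_real_of_nat)
  then have h0: "(\<lambda>n. ?h n v) \<longlonglongrightarrow> 0" for v :: 'a by simp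
  have lim: "(\<lambda>n. LINT v|lborel. ip lborel (cotw (?h n v) f) f * ?g v) \<longlonglongrightarrow> (LINT v|lborel. ip lborel f f * ?g v)"
  proof (rule integral_dominated_convergence)
    show "integrable lborel (\<lambda>v::'a. ?N * exp (- (v \<bullet> v)))" by (intro integrable_mult_right integrable_gauss)
    show "AE v in lborel. (\<lambda>n. ip lborel (cotw (?h n v) f) f * ?g v) \<longlonglongrightarrow> ip lborel f f * ?g v"
      by (intro AE_I2 tendsto_intros ip_cotw_tendsto f h0)
    show "AE v in lborel. norm (ip lborel (cotw (?h n v) f) f * ?g v) \<le> ?N * exp (- (v \<bullet> v))" for n
      using norm_ip_cotw_le[OF f] by (intro AE_I2) (simp add: norm_mult mult_right_mono)
    show "(\<lambda>v. ip lborel (cotw (?h n v) f) f * ?g v) \<in> borel_measurable lborel" for n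
      unfolding ip_def cotw_def by measurable
  qed measurable
  have val: "(LINT v|lborel. ip lborel f f * ?g v) = of_real (gauss_mass TYPE('a)) * ip lborel f f"
    by (simp add: gauss_mass_def mult.commute)
  show ?thesis using lim unfolding Q val .
qed

end

section \<open>Orthonormal systems and bounded kernels\<close>

lemma sqint_imp_integrable:
  assumes f: "f \<in> sqint M" and S: "S \<in> sets M" "emeasure M S < \<infinity>"
    and z: "AE x in M. x \<notin> S \<longrightarrow> f x = 0"
  shows "integrable M f"
proof (rule Bochner_Integration.integrable_bound)
  show "integrable M (\<lambda>x. (norm (f x))\<^sup>2 + indicat_real S x)"
    using f S by (intro Bochner_Integration.integrable_add) (auto simp: sqint_def)
  show "f \<in> borel_measurable M" using f by (simp add: sqint_def)
  show "AE x in M. norm (f x) \<le> norm ((norm (f x))\<^sup>2 + indicat_real S x)"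
    using z
  proof eventually_elim
    case (elim x)
    have "t \<le> t\<^sup>2 + 1" for t :: real
    proof -
      have "0 \<le> (t - 1 / 2)\<^sup>2" by simp
      also have "\<dots> = t\<^sup>2 - t + 1 / 4" by (simp add: power2_eq_square field_simps)
      finally show ?thesis by linarith
    qed
    then show ?case using elim by (cases "x \<in> S") auto
  qed
qed

context twisted_translation
begin

text \<open>
  By \<open>rel\<close> and Fubini, the \<open>i\<close>-th integral equals the integral over
  \<open>T\<close> of \<open>G i\<close> times the inner product of \<open>m z\<close> with \<open>F
  i\<close>, where \<open>m z\<close> is the kernel in its second variable, cut off to
  \<open>S\<close>. Bessel's inequality bounds the sum over \<open>i\<close> of the squares of these
  inner products by the squared norm of \<open>m z\<close>, which is at most
  \<open>C\<^sup>2\<close> times the measure of \<open>S\<close>, however large \<open>N\<close> is.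
  The weight \<open>\<kappa> / 4\<close> is small enough for the first summand to be absorbed when
  the bound is compared with the approximate identity.
\<close>

lemma pairing_bound:
  fixes F G :: "nat \<Rightarrow> 'a \<Rightarrow> complex" and K :: "'a \<Rightarrow> complex"
  assumes S: "S \<in> sets borel" "emeasure lborel S < \<infinity>" and T: "T \<in> sets borel" "emeasure lborel T < \<infinity>"
    and F: "\<And>i. i < N \<Longrightarrow> F i \<in> sqint lborel" and G: "\<And>i. i < N \<Longrightarrow> G i \<in> sqint lborel"
    and FS: "\<And>i. i < N \<Longrightarrow> AE z in lborel. z \<notin> S \<longrightarrow> F i z = 0"
    and GT: "\<And>i. i < N \<Longrightarrow> AE z in lborel. z \<notin> T \<longrightarrow> G i z = 0"
    and Km[measurable]: "K \<in> borel_measurable borel" and KC: "\<And>v. norm (K v) \<le> C"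
    and rel: "\<And>i a. i < N \<Longrightarrow> ip lborel (F i) (tw a (bump n)) = ip lborel (G i) (tw a K)"
    and bessel: "\<And>m. m \<in> sqint lborel \<Longrightarrow> (\<Sum>i<N. (norm (ip lborel m (F i)))\<^sup>2) \<le> Re (ip lborel m m)"
    and \<kappa>: "0 < \<kappa>"
  shows "norm (\<Sum>i<N. LINT a|lborel. ip lborel (F i) (tw a (bump n)) * cnj (F i a))
     \<le> \<kappa> / 4 * (\<Sum>i<N. Re (ip lborel (G i) (G i))) + C\<^sup>2 * measure lborel S * measure lborel T / \<kappa>"
proof -
  note [measurable] = S(1) T(1)
  have C0: "0 \<le> C" using KC[of 0] norm_ge_zero order_trans by blast
  define m where "m z a = indicator S a * cnj (tw a K z)" for z a
  have norm_m: "(norm (m z a))\<^sup>2 \<le> C\<^sup>2 * indicat_real S a" for z a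
    using power_mono[OF KC norm_ge_zero, of "z - a" 2] by (auto simp: m_def norm_mult indicator_def)
  have intS: "integrable lborel (\<lambda>a. C\<^sup>2 * indicat_real S a)" using S by simp
  have m_meas[measurable]: "m z \<in> borel_measurable borel" for z
    unfolding m_def[abs_def] tw_def by measurable
  have m_sq: "integrable lborel (\<lambda>a. (norm (m z a))\<^sup>2)" for z
    by (rule Bochner_Integration.integrable_bound[OF intS]) (use norm_m in auto)
  have m: "m z \<in> sqint lborel" for z using m_sq by (simp add: sqint_def)
  have mm: "Re (ip lborel (m z) (m z)) \<le> C\<^sup>2 * measure lborel S" for z
  proof -
    have "Re (ip lborel (m z) (m z)) \<le> (LINT a|lborel. C\<^sup>2 * indicat_real S a)"
      unfolding ip_self Re_complex_of_real by (intro integral_mono m_sq intS norm_m)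
    also have "\<dots> = C\<^sup>2 * measure lborel S" using S by simp
    finally show ?thesis .
  qed
  define H where "H i z = ip lborel (m z) (F i)" for i z
  have Hsum: "(\<Sum>i<N. (norm (H i z))\<^sup>2) \<le> C\<^sup>2 * measure lborel S" for z
    using bessel[OF m[of z]] mm[of z] unfolding H_def by linarith
  have H1: "(norm (H i z))\<^sup>2 \<le> C\<^sup>2 * measure lborel S" if "i < N" for i z
    by (rule order_trans[OF member_le_sum Hsum[of z]]) (use that in auto)
  have Fm: "F i \<in> borel_measurable borel" and Gm: "G i \<in> borel_measurable borel" if "i < N" for i
    using F[OF that] G[OF that] by (auto simp: sqint_def)
  have Hm: "H i \<in> borel_measurable borel" if i: "i < N" for i
  proof -
    note [measurable] = Fm[OF i]
    show ?thesis unfolding H_def[abs_def] ip_def m_def tw_def by measurable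
  qed
  have iT: "integrable lborel (\<lambda>z. indicat_real T z * (norm (H i z))\<^sup>2)" if i: "i < N" for i
  proof (rule Bochner_Integration.integrable_bound)
    show "integrable lborel (\<lambda>z. C\<^sup>2 * measure lborel S * indicat_real T z)" using T by simp
    show "(\<lambda>z. indicat_real T z * (norm (H i z))\<^sup>2) \<in> borel_measurable lborel"
      using Hm[OF i] by measurable
    show "AE z in lborel. norm (indicat_real T z * (norm (H i z))\<^sup>2) \<le> norm (C\<^sup>2 * measure lborel S * indicat_real T z)"
      using H1[OF i] by (intro AE_I2) (auto simp: indicator_def)
  qed
  have single: "norm (LINT a|lborel. ip lborel (F i) (tw a (bump n)) * cnj (F i a))
     \<le> \<kappa> / 4 * Re (ip lborel (G i) (G i)) + 1 / \<kappa> * (LINT z|lborel. indicat_real T z * (norm (H i z))\<^sup>2)" if i: "i < N" for i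
  proof -
    note [measurable] = Fm[OF i] Gm[OF i]
    define W where "W a z = G i z * cnj (tw a K z) * cnj (F i a)" for a z
    have F1: "integrable lborel (F i)" by (rule sqint_imp_integrable[OF F[OF i] _ S(2) FS[OF i]]) simp
    have G1: "integrable lborel (G i)" by (rule sqint_imp_integrable[OF G[OF i] _ T(2) GT[OF i]]) simp
    have nW: "norm (W a z) \<le> C * norm (F i a) * norm (G i z)" for a z
    proof -
      have "norm (W a z) = norm (K (z - a)) * (norm (F i a) * norm (G i z))"
        by (simp add: W_def norm_mult)
      also have "\<dots> \<le> C * (norm (F i a) * norm (G i z))" by (intro mult_right_mono KC) simp
      finally show ?thesis by simp
    qed
    have Wm: "(\<lambda>(a, z). W a z) \<in> borel_measurable (lborel \<Otimes>\<^sub>M lborel)"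
      unfolding W_def tw_def by measurable
    have Wa: "W a \<in> borel_measurable borel" for a unfolding W_def[abs_def] tw_def by measurable
    have Wi: "integrable lborel (W a)" for a
    proof (rule Bochner_Integration.integrable_bound)
      show "integrable lborel (\<lambda>z. C * norm (F i a) * norm (G i z))"
        by (intro integrable_mult_right integrable_norm G1)
      show "AE z in lborel. norm (W a z) \<le> norm (C * norm (F i a) * norm (G i z))"
        using nW C0 by (intro AE_I2) simp
    qed (use Wa in simp)
    have Wint: "integrable (lborel \<Otimes>\<^sub>M lborel) (\<lambda>(a, z). W a z)"
    proof (rule lborel_pair.Fubini_integrable[OF Wm])
      show "AE a in lborel. integrable lborel (\<lambda>z. case (a, z) of (a, z) \<Rightarrow> W a z)"
        using Wi by (intro AE_I2) simp
      show "integrable lborel (\<lambda>a. LINT z|lborel. norm (case (a, z) of (a, z) \<Rightarrow> W a z))"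
      proof (rule Bochner_Integration.integrable_bound)
        show "integrable lborel (\<lambda>a. (C * (LINT z|lborel. norm (G i z))) * norm (F i a))"
          by (intro integrable_mult_right integrable_norm F1)
        show "(\<lambda>a. LINT z|lborel. norm (case (a, z) of (a, z) \<Rightarrow> W a z)) \<in> borel_measurable lborel"
          unfolding W_def tw_def by measurable
        show "AE a in lborel. norm (LINT z|lborel. norm (case (a, z) of (a, z) \<Rightarrow> W a z))
            \<le> norm (C * (LINT z|lborel. norm (G i z)) * norm (F i a))"
        proof (intro AE_I2)
          fix a
          have "(LINT z|lborel. norm (W a z)) \<le> (LINT z|lborel. C * norm (F i a) * norm (G i z))"
            by (intro integral_mono integrable_norm Wi nW integrable_mult_right G1)
          also have "\<dots> = C * (LINT z|lborel. norm (G i z)) * norm (F i a)" by simp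
          finally have "(LINT z|lborel. norm (W a z)) \<le> C * (LINT z|lborel. norm (G i z)) * norm (F i a)" .
          moreover have "0 \<le> (LINT z|lborel. norm (W a z))" by simp
          ultimately show "norm (LINT z|lborel. norm (case (a, z) of (a, z) \<Rightarrow> W a z))
            \<le> norm (C * (LINT z|lborel. norm (G i z)) * norm (F i a))" by simp
        qed
      qed
    qed
    have inner: "(LINT a|lborel. W a z) = G i z * H i z" for z
    proof -
      have "(LINT a|lborel. W a z) = (LINT a|lborel. G i z * (m z a * cnj (F i a)))"
      proof (rule integral_cong_AE)
        show "(\<lambda>a. W a z) \<in> borel_measurable lborel" unfolding W_def tw_def by measurable
        show "(\<lambda>a. G i z * (m z a * cnj (F i a))) \<in> borel_measurable lborel" by measurable
        show "AE a in lborel. W a z = G i z * (m z a * cnj (F i a))"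
          using FS[OF i] by eventually_elim (auto simp: W_def m_def indicator_def)
      qed
      then show ?thesis by (simp add: H_def ip_def)
    qed
    have iGH: "integrable lborel (\<lambda>z. G i z * H i z)"
      using lborel_pair.integrable_snd[OF Wint] by (simp add: inner)
    have "(LINT a|lborel. ip lborel (F i) (tw a (bump n)) * cnj (F i a)) = (LINT a|lborel. LINT z|lborel. W a z)"
      unfolding rel[OF i] unfolding ip_def W_def by simp
    also have "\<dots> = (LINT z|lborel. LINT a|lborel. W a z)"
      by (rule lborel_pair.Fubini_integral[OF Wint, symmetric])
    also have "\<dots> = (LINT z|lborel. G i z * H i z)" unfolding inner ..
    finally have "norm (LINT a|lborel. ip lborel (F i) (tw a (bump n)) * cnj (F i a)) \<le> (LINT z|lborel. norm (G i z * H i z))"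
      using integral_norm_bound[of lborel "\<lambda>z. G i z * H i z"] by simp
    also have "\<dots> \<le> (LINT z|lborel. \<kappa> / 4 * (norm (G i z))\<^sup>2 + 1 / \<kappa> * (indicat_real T z * (norm (H i z))\<^sup>2))"
    proof (rule integral_mono_AE)
      show "integrable lborel (\<lambda>z. norm (G i z * H i z))" by (rule integrable_norm[OF iGH])
      show "integrable lborel (\<lambda>z. \<kappa> / 4 * (norm (G i z))\<^sup>2 + 1 / \<kappa> * (indicat_real T z * (norm (H i z))\<^sup>2))"
        using G[OF i] iT[OF i] by (intro Bochner_Integration.integrable_add integrable_mult_right) (auto simp: sqint_def)
      show "AE z in lborel. norm (G i z * H i z) \<le> \<kappa> / 4 * (norm (G i z))\<^sup>2 + 1 / \<kappa> * (indicat_real T z * (norm (H i z))\<^sup>2)"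
        using GT[OF i]
      proof eventually_elim
        case (elim z)
        show ?case
        proof (cases "z \<in> T")
          case True
          \<comment> \<open>Young's inequality, weighted so that \<open>G i\<close> receives the small factor \<open>\<kappa> / 4\<close>.\<close>
          have "0 \<le> (\<kappa> / 2 * norm (G i z) - norm (H i z))\<^sup>2 / \<kappa>" using \<kappa> by simp
          also have "\<dots> = \<kappa> / 4 * (norm (G i z))\<^sup>2 + 1 / \<kappa> * (norm (H i z))\<^sup>2 - norm (G i z) * norm (H i z)"
            using \<kappa> by (simp add: power2_eq_square field_simps)
          finally show ?thesis using True by (simp add: norm_mult)
        next
          case False
          then show ?thesis using elim \<kappa> by simp
        qed
      qed
    qed
    also have "\<dots> = \<kappa> / 4 * Re (ip lborel (G i) (G i)) + 1 / \<kappa> * (LINT z|lborel. indicat_real T z * (norm (H i z))\<^sup>2)"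
      using G[OF i] iT[OF i] by (subst Bochner_Integration.integral_add) (auto simp: sqint_def ip_self)
    finally show ?thesis .
  qed
  have "norm (\<Sum>i<N. LINT a|lborel. ip lborel (F i) (tw a (bump n)) * cnj (F i a))
     \<le> (\<Sum>i<N. \<kappa> / 4 * Re (ip lborel (G i) (G i)) + 1 / \<kappa> * (LINT z|lborel. indicat_real T z * (norm (H i z))\<^sup>2))"
    by (rule sum_norm_le) (use single in auto)
  also have "\<dots> = \<kappa> / 4 * (\<Sum>i<N. Re (ip lborel (G i) (G i))) + 1 / \<kappa> * (\<Sum>i<N. LINT z|lborel. indicat_real T z * (norm (H i z))\<^sup>2)"
    by (simp add: sum.distrib sum_distrib_left)
  also have "(\<Sum>i<N. LINT z|lborel. indicat_real T z * (norm (H i z))\<^sup>2) \<le> C\<^sup>2 * measure lborel S * measure lborel T"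
  proof -
    have "(\<Sum>i<N. LINT z|lborel. indicat_real T z * (norm (H i z))\<^sup>2) = (LINT z|lborel. (\<Sum>i<N. indicat_real T z * (norm (H i z))\<^sup>2))"
      using iT by (intro Bochner_Integration.integral_sum[symmetric]) auto
    also have "\<dots> \<le> (LINT z|lborel. C\<^sup>2 * measure lborel S * indicat_real T z)"
    proof (intro integral_mono)
      show "integrable lborel (\<lambda>z. \<Sum>i<N. indicat_real T z * (norm (H i z))\<^sup>2)"
        by (rule Bochner_Integration.integrable_sum) (use iT in auto)
      show "integrable lborel (\<lambda>z. C\<^sup>2 * measure lborel S * indicat_real T z)" using T by simp
      show "(\<Sum>i<N. indicat_real T z * (norm (H i z))\<^sup>2) \<le> C\<^sup>2 * measure lborel S * indicat_real T z" for z
        using Hsum[of z] by (auto simp: indicator_def)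
    qed
    also have "\<dots> = C\<^sup>2 * measure lborel S * measure lborel T" using T by simp
    finally show ?thesis .
  qed
  finally show ?thesis using \<kappa> by (simp add: divide_right_mono)
qed

end

text \<open>
  A pair of functions is encoded as one function on the sum type, so that orthonormal systems of
  pairs are instances of the general notion.
\<close>

definition left_part :: "('a + 'a \<Rightarrow> complex) \<Rightarrow> 'a \<Rightarrow> complex" where
  "left_part h z = h (Inl z)"

definition right_part :: "('a + 'a \<Rightarrow> complex) \<Rightarrow> 'a \<Rightarrow> complex" where
  "right_part h z = h (Inr z)"

definition pair_space :: "('a::euclidean_space + 'a \<Rightarrow> complex) set" where
  "pair_space = {h. left_part h \<in> sqint lborel \<and> right_part h \<in> sqint lborel}"

definition pair_ip :: "('a::euclidean_space + 'a \<Rightarrow> complex) \<Rightarrow> ('a + 'a \<Rightarrow> complex) \<Rightarrow> complex" where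
  "pair_ip h k = ip lborel (left_part h) (left_part k) + ip lborel (right_part h) (right_part k)"

lemma part_lin:
  "left_part (\<lambda>x. c * h x + k x) = (\<lambda>z. c * left_part h z + left_part k z)"
  "right_part (\<lambda>x. c * h x + k x) = (\<lambda>z. c * right_part h z + right_part k z)"
  by (simp_all add: left_part_def right_part_def fun_eq_iff)

lemma part_case_sum [simp]: "left_part (case_sum f g) = f" "right_part (case_sum f g) = g"
  by (simp_all add: left_part_def right_part_def fun_eq_iff)

interpretation pair: semi_inner "pair_space :: ('a::euclidean_space + 'a \<Rightarrow> complex) set" pair_ip
proof
  have z: "left_part (\<lambda>_. 0) = (\<lambda>_. 0)" "right_part (\<lambda>_. 0) = (\<lambda>_. 0)"
    by (simp_all add: left_part_def right_part_def fun_eq_iff)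
  show "(\<lambda>_. 0) \<in> pair_space" by (simp add: pair_space_def z sqint.zero_mem)
  fix f g h :: "'a + 'a \<Rightarrow> complex" and c
  show "f \<in> pair_space \<Longrightarrow> g \<in> pair_space \<Longrightarrow> (\<lambda>x. c * f x + g x) \<in> pair_space"
    by (simp add: pair_space_def part_lin sqint.lin_mem)
  show "f \<in> pair_space \<Longrightarrow> g \<in> pair_space \<Longrightarrow> h \<in> pair_space \<Longrightarrow>
    pair_ip (\<lambda>x. c * f x + g x) h = c * pair_ip f h + pair_ip g h"
    unfolding pair_space_def pair_ip_def part_lin mem_Collect_eq
    by (elim conjE, simp only: sqint.lin_left) (simp add: algebra_simps)
  show "f \<in> pair_space \<Longrightarrow> g \<in> pair_space \<Longrightarrow> pair_ip g f = cnj (pair_ip f g)"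
    using sqint.herm[of "left_part f" lborel "left_part g"] sqint.herm[of "right_part f" lborel "right_part g"]
    by (simp add: pair_space_def pair_ip_def)
  show "f \<in> pair_space \<Longrightarrow> 0 \<le> Re (pair_ip f f)"
    by (simp add: pair_space_def pair_ip_def sqint.nonneg)
qed

section \<open>Related pairs with supports of finite measure\<close>

text \<open>
  If \<open>f\<close> did not vanish, a bounded set \<open>D\<close> of positive measure would lie
  in the set where \<open>f\<close> is nonzero. Sufficiently long multiples of \<open>a\<close>
  carry \<open>D\<close> to infinitely many disjoint sets of the same measure, all inside
  \<open>S\<close> up to null sets.
\<close>

lemma translates_in_finite_measure_set_zero:
  fixes f :: "'a::euclidean_space \<Rightarrow> complex"
  assumes f: "f \<in> borel_measurable borel" and S: "S \<in> sets borel" "emeasure lborel S < \<infinity>" and a: "a \<noteq> 0"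
    and z: "\<And>k::nat. AE z in lborel. z \<notin> S \<longrightarrow> f (z - real k *\<^sub>R a) = 0"
  shows "AE z in lborel. f z = 0"
proof -
  have nz: "{z. f z \<noteq> 0} \<in> sets borel"
    using measurable_sets[OF f, of "- {0}"] by (simp add: vimage_def Compl_eq)
  have null: "emeasure lborel ({z. f z \<noteq> 0} \<inter> cball 0 R) = 0" if R: "0 < R" for R
  proof (rule ccontr)
    let ?D = "{z. f z \<noteq> 0} \<inter> cball 0 R"
    assume pos: "emeasure lborel ?D \<noteq> 0"
    have Db: "?D \<in> sets borel" using nz by auto
    have Dfin: "emeasure lborel ?D < \<infinity>"
      by (rule le_less_trans[OF emeasure_mono[of _ "cball 0 R"]]) (auto simp: emeasure_cball R less_imp_le)
    obtain m :: nat where m: "2 * R < real m * norm a"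
      using reals_Archimedean3[of "norm a"] a by auto
    define E where "E j = {z. z + (- (real (j * m) *\<^sub>R a)) \<in> ?D}" for j :: nat
    have Eb: "E j \<in> sets borel" for j unfolding E_def by (rule borel_shift[OF Db])
    have Em: "emeasure lborel (E j) = emeasure lborel ?D" for j unfolding E_def by (rule emeasure_lborel_shift[OF Db])
    have ES: "emeasure lborel (E j \<inter> S) = emeasure lborel ?D" for j
    proof -
      have "emeasure lborel (E j \<inter> S) = emeasure lborel (E j)"
      proof (rule emeasure_eq_AE)
        show "AE z in lborel. z \<in> E j \<inter> S \<longleftrightarrow> z \<in> E j"
          using z[of "j * m"] by eventually_elim (auto simp: E_def)
      qed (use Eb S in auto)
      then show ?thesis using Em by simp
    qed
    have disj: "E i \<inter> E j = {}" if "i \<noteq> j" for i j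
    proof (rule ccontr)
      assume "E i \<inter> E j \<noteq> {}"
      then obtain x where x: "norm (x - real (i * m) *\<^sub>R a) \<le> R" "norm (x - real (j * m) *\<^sub>R a) \<le> R"
        by (auto simp: E_def)
      have "(x - real (j * m) *\<^sub>R a) - (x - real (i * m) *\<^sub>R a) = ((real i - real j) * real m) *\<^sub>R a"
        by (simp add: algebra_simps)
      then have "\<bar>real i - real j\<bar> * (real m * norm a) = norm ((x - real (j * m) *\<^sub>R a) - (x - real (i * m) *\<^sub>R a))"
        by (simp add: abs_mult)
      also have "\<dots> \<le> R + R"
        by (rule order_trans[OF norm_triangle_ineq4]) (use x in linarith)
      finally have "\<bar>real i - real j\<bar> * (real m * norm a) \<le> 2 * R" by simp
      moreover have "1 \<le> \<bar>real i - real j\<bar>" using that by (cases "i < j") auto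
      then have "1 * (real m * norm a) \<le> \<bar>real i - real j\<bar> * (real m * norm a)"
        by (intro mult_right_mono) auto
      ultimately show False using m by linarith
    qed
    define c where "c = measure lborel ?D"
    have c: "emeasure lborel ?D = ennreal c" "0 < c"
      using Dfin pos by (auto simp: c_def emeasure_eq_ennreal_measure zero_less_measure_iff)
    define s where "s = measure lborel S"
    have s: "emeasure lborel S = ennreal s" using S by (auto simp: s_def emeasure_eq_ennreal_measure)
    have "real M * c \<le> s" for M
    proof -
      have "ennreal (real M * c) = (\<Sum>j<M. emeasure lborel (E j \<inter> S))"
        unfolding ES c(1) using c(2) by (simp add: ennreal_mult ennreal_of_nat_eq_real_of_nat)
      also have "\<dots> = emeasure lborel (\<Union>j\<in>{..<M}. E j \<inter> S)"
        using Eb S disj by (intro sum_emeasure) (auto simp: disjoint_family_on_def)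
      also have "\<dots> \<le> emeasure lborel S" using S by (intro emeasure_mono) auto
      finally show ?thesis unfolding s by (simp add: s_def)
    qed
    moreover obtain M :: nat where "s < real M * c" using reals_Archimedean3[OF c(2)] by blast
    ultimately show False by (meson not_less)
  qed
  have "AE z in lborel. \<forall>n::nat. z \<notin> {z. f z \<noteq> 0} \<inter> cball 0 (real (Suc n))"
  proof (rule AE_all_countable[THEN iffD2, rule_format])
    fix n :: nat
    have "{z. f z \<noteq> 0} \<inter> cball 0 (real (Suc n)) \<in> null_sets lborel"
      using null[of "real (Suc n)"] nz by (intro null_setsI) (simp, simp)
    then show "AE z in lborel. z \<notin> {z. f z \<noteq> 0} \<inter> cball 0 (real (Suc n))" by (rule AE_not_in)
  qed
  then show ?thesis
  proof eventually_elim
    case (elim z)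
    obtain n :: nat where "norm z \<le> real n" using real_arch_simple by blast
    then have "norm z \<le> real (Suc n)" by simp
    with elim show ?case by auto
  qed
qed

text \<open>
  The functions \<open>Kp n\<close> and \<open>Km n\<close> stand for the images of \<open>bump
  n\<close> under a unitary map and under its inverse. That both are bounded uniformly in
  \<open>n\<close> expresses a dispersive estimate from \<open>L1\<close> to bounded functions.
\<close>

locale kernel_pair = twisted_translation J for J :: "'a::euclidean_space \<Rightarrow> 'a" +
  fixes Kp Km :: "nat \<Rightarrow> 'a \<Rightarrow> complex" and C :: real
  assumes Kp_measurable: "Kp n \<in> borel_measurable borel" and Km_measurable: "Km n \<in> borel_measurable borel"
    and Kp_sqint: "Kp n \<in> sqint lborel" and Km_sqint: "Km n \<in> sqint lborel"
    and Kp_bound: "norm (Kp n v) \<le> C" and Km_bound: "norm (Km n v) \<le> C"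
begin

text \<open>
  The unitary map itself does not occur: a pair is tested only against the twisted translates of the
  \<open>bump n\<close>. This condition is linear and visibly invariant under twisted translations.
\<close>

definition related :: "('a + 'a \<Rightarrow> complex) \<Rightarrow> bool" where
  "related h \<longleftrightarrow> h \<in> pair_space \<and>
     (\<forall>n a. ip lborel (left_part h) (tw a (bump n)) = ip lborel (right_part h) (tw a (Kp n))) \<and>
     (\<forall>n a. ip lborel (right_part h) (tw a (bump n)) = ip lborel (left_part h) (tw a (Km n)))"

definition supported :: "'a set \<Rightarrow> 'a set \<Rightarrow> ('a + 'a \<Rightarrow> complex) \<Rightarrow> bool" where
  "supported S T h \<longleftrightarrow> (AE z in lborel. z \<notin> S \<longrightarrow> left_part h z = 0) \<and> (AE z in lborel. z \<notin> T \<longrightarrow> right_part h z = 0)"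

definition tw2 :: "'a \<Rightarrow> ('a + 'a \<Rightarrow> complex) \<Rightarrow> 'a + 'a \<Rightarrow> complex" where
  "tw2 a h = case_sum (tw a (left_part h)) (tw a (right_part h))"

lemma bump_measurable [measurable]: "bump n \<in> borel_measurable (borel :: 'a measure)"
  unfolding bump_def[abs_def] by measurable

lemma bump_sqint: "(bump n :: 'a \<Rightarrow> complex) \<in> sqint lborel"
proof (rule sqint_lborel_exp_bound[where C = "real (Suc n) ^ DIM('a) * exp (9 / 4)"])
  show "continuous_on UNIV (bump n :: 'a \<Rightarrow> complex)"
    unfolding bump_def[abs_def] by (intro continuous_intros)
  fix v :: 'a
  have "exp (- ((real (Suc n))\<^sup>2 * (v \<bullet> v))) \<le> exp (- (v \<bullet> v))"
    using mult_right_mono[of 1 "(real (Suc n))\<^sup>2" "v \<bullet> v"] by (simp add: one_le_power)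
  also have "\<dots> \<le> exp (9 / 4) * exp (- norm v)" by (rule gauss_le_exp_norm)
  finally have "real (Suc n) ^ DIM('a) * exp (- ((real (Suc n))\<^sup>2 * (v \<bullet> v)))
      \<le> real (Suc n) ^ DIM('a) * (exp (9 / 4) * exp (- norm v))" by (intro mult_left_mono) auto
  then show "norm (bump n v) \<le> real (Suc n) ^ DIM('a) * exp (9 / 4) * exp (- norm v)"
    unfolding bump_def norm_of_real by (simp add: mult.assoc)
qed

lemma related_lin:
  assumes "related h" "related k"
  shows "related (\<lambda>x. c * h x + k x)"
  using assms unfolding related_def
  by (auto simp: part_lin pair.lin_mem pair_space_def sqint.lin_mem sqint.lin_left tw_sqint bump_sqint Kp_sqint Km_sqint)

lemma related_zero: "related (\<lambda>_. 0)"
proof -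
  have "left_part (\<lambda>_::'a + 'a. 0) = (\<lambda>_. 0)" "right_part (\<lambda>_::'a + 'a. 0) = (\<lambda>_. 0)"
    by (simp_all add: left_part_def right_part_def fun_eq_iff)
  then show ?thesis by (simp add: related_def pair.zero_mem ip_def)
qed

lemma supported_lin: "supported S T h \<Longrightarrow> supported S T k \<Longrightarrow> supported S T (\<lambda>x. c * h x + k x)"
  unfolding supported_def part_lin by (auto elim: AE_mp)

lemma supported_zero: "supported S T (\<lambda>_. 0)"
  by (simp add: supported_def left_part_def right_part_def)

lemma supported_mono: "supported S T h \<Longrightarrow> S \<subseteq> S' \<Longrightarrow> T \<subseteq> T' \<Longrightarrow> supported S' T' h"
  unfolding supported_def by (auto elim: AE_mp)

lemma related_sum:
  "finite I \<Longrightarrow> (\<And>i. i \<in> I \<Longrightarrow> related (e i) \<and> supported S T (e i)) \<Longrightarrow>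
   related (\<lambda>x. \<Sum>i\<in>I. c i * e i x) \<and> supported S T (\<lambda>x. \<Sum>i\<in>I. c i * e i x)"
  by (induction I rule: finite_induct)
    (simp_all add: related_zero supported_zero related_lin supported_lin)

text \<open>
  The adjoint of \<open>tw b\<close> is \<open>tw (- b)\<close>, and composing it with \<open>tw
  a\<close> gives the same scalar on both sides of each relation.
\<close>

lemma related_tw2:
  assumes "related h"
  shows "related (tw2 b h)"
proof -
  have l: "left_part h \<in> sqint lborel" "right_part h \<in> sqint lborel"
    using assms by (auto simp: related_def pair_space_def)
  have m: "left_part h \<in> borel_measurable borel" "right_part h \<in> borel_measurable borel"
    using l by (auto simp: sqint_def)
  have shift: "ip lborel (tw b f) (tw a g) = cnj (exp (- \<i> * of_real (- b \<bullet> J a))) * ip lborel f (tw (a + - b) g)"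
    if "f \<in> sqint lborel" "g \<in> sqint lborel" for f g a
  proof -
    have fm: "f \<in> borel_measurable borel" "g \<in> borel_measurable borel" using that by (auto simp: sqint_def)
    have "ip lborel (tw b f) (tw a g) = ip lborel f (tw (- b) (tw a g))"
      using fm by (intro ip_tw tw_measurable)
    also have "tw (- b) (tw a g) = (\<lambda>z. exp (- \<i> * of_real (- b \<bullet> J a)) * tw (a + - b) g z)"
      by (rule ext) (rule tw_tw)
    also have "ip lborel f \<dots> = cnj (exp (- \<i> * of_real (- b \<bullet> J a))) * ip lborel f (tw (a + - b) g)"
      by (rule sqint.scale_right[OF tw_sqint[OF that(2)] that(1)])
    finally show ?thesis .
  qed
  show ?thesis
    using assms l unfolding related_def tw2_def part_case_sum
    by (simp add: shift bump_sqint Kp_sqint Km_sqint pair_space_def tw_sqint)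
qed

lemma AE_lborel_shift:
  assumes "AE z in lborel. P (z :: 'a)"
  shows "AE z in lborel. P (z + b)"
proof -
  obtain N where N: "N \<in> null_sets lborel" "{z. \<not> P z} \<subseteq> N"
    using assms by (auto elim!: AE_E simp: null_sets_def)
  have "{z. z + b \<in> N} \<in> null_sets lborel"
    using N(1) emeasure_lborel_shift[of N b] borel_shift[of N b] by (auto simp: null_sets_def)
  then show ?thesis by (rule AE_I') (use N(2) in auto)
qed

lemma supported_tw2:
  assumes "supported S T h"
  shows "supported {z. z + - b \<in> S} {z. z + - b \<in> T} (tw2 b h)"
proof -
  have "AE z in lborel. z + - b \<notin> S \<longrightarrow> left_part h (z + - b) = 0"
    by (rule AE_lborel_shift) (use assms in \<open>simp add: supported_def\<close>)
  moreover have "AE z in lborel. z + - b \<notin> T \<longrightarrow> right_part h (z + - b) = 0"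
    by (rule AE_lborel_shift) (use assms in \<open>simp add: supported_def\<close>)
  ultimately show ?thesis by (simp add: supported_def tw2_def tw_def)
qed

text \<open>
  This takes the place of a Hilbert-Schmidt bound for the map restricted to functions supported in
  \<open>S\<close> and followed by the restriction to \<open>T\<close>. The approximate identity
  recovers the squared norms of the left parts from their pairings with twisted bumps, and
  \<open>pairing_bound\<close> bounds these through the right parts; the reverse relation exchanges
  the roles. Adding both estimates, \<open>N\<close> is bounded by \<open>N / 4\<close> plus a
  constant.
\<close>

theorem dimension_bound:
  assumes S: "S \<in> sets borel" "emeasure lborel S < \<infinity>" and T: "T \<in> sets borel" "emeasure lborel T < \<infinity>"
    and e: "pair.orthonormal N e" and adm: "\<And>i. i < N \<Longrightarrow> related (e i) \<and> supported S T (e i)"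
  shows "real N \<le> 4 * (C\<^sup>2 * measure lborel S * measure lborel T) / (gauss_mass TYPE('a))\<^sup>2"
proof -
  let ?\<kappa> = "gauss_mass TYPE('a)"
  let ?X = "C\<^sup>2 * measure lborel S * measure lborel T"
  define F where "F i = left_part (e i)" for i
  define G where "G i = right_part (e i)" for i
  have \<kappa>: "0 < ?\<kappa>" by (rule gauss_mass_pos)
  have F: "F i \<in> sqint lborel" and G: "G i \<in> sqint lborel" if "i < N" for i
    using adm[OF that] by (auto simp: related_def pair_space_def F_def G_def)
  have FS: "AE z in lborel. z \<notin> S \<longrightarrow> F i z = 0" and GT: "AE z in lborel. z \<notin> T \<longrightarrow> G i z = 0" if "i < N" for i
    using adm[OF that] by (auto simp: supported_def F_def G_def)
  have z0: "(\<lambda>_. 0) \<in> sqint lborel" by (rule sqint.zero_mem)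
  have ip0: "ip lborel (\<lambda>_. 0) g = 0" for g :: "'a \<Rightarrow> complex" by (simp add: ip_def)
  \<comment> \<open>The left parts alone need not be orthonormal, but Bessel's inequality for pairs \<open>(m, 0)\<close> only involves them.\<close>
  have besselF: "(\<Sum>i<N. (norm (ip lborel m (F i)))\<^sup>2) \<le> Re (ip lborel m m)" if "m \<in> sqint lborel" for m
    using pair.Bessel[OF e, of "case_sum m (\<lambda>_. 0)"] that z0
    by (simp add: pair_space_def pair_ip_def F_def ip0)
  have besselG: "(\<Sum>i<N. (norm (ip lborel m (G i)))\<^sup>2) \<le> Re (ip lborel m m)" if "m \<in> sqint lborel" for m
    using pair.Bessel[OF e, of "case_sum (\<lambda>_. 0) m"] that z0
    by (simp add: pair_space_def pair_ip_def G_def ip0)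
  have limit: "?\<kappa> * (\<Sum>i<N. Re (ip lborel (A i) (A i))) \<le> B"
    if A: "\<And>i. i < N \<Longrightarrow> A i \<in> sqint lborel"
      and b: "\<And>n. norm (\<Sum>i<N. LINT a|lborel. ip lborel (A i) (tw a (bump n)) * cnj (A i a)) \<le> B" for A B
  proof -
    have "(\<lambda>n. \<Sum>i<N. LINT a|lborel. ip lborel (A i) (tw a (bump n)) * cnj (A i a))
      \<longlonglongrightarrow> (\<Sum>i<N. of_real ?\<kappa> * ip lborel (A i) (A i))"
      using A by (intro tendsto_sum bump_approximate_identity) auto
    then have "norm (\<Sum>i<N. of_real ?\<kappa> * ip lborel (A i) (A i)) \<le> B"
      by (rule LIMSEQ_le_const2[OF tendsto_norm]) (use b in blast)
    moreover have "Re (\<Sum>i<N. of_real ?\<kappa> * ip lborel (A i) (A i)) = ?\<kappa> * (\<Sum>i<N. Re (ip lborel (A i) (A i)))"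
      by (simp add: sum_distrib_left)
    ultimately show ?thesis by (metis complex_Re_le_cmod order_trans)
  qed
  have 1: "?\<kappa> * (\<Sum>i<N. Re (ip lborel (F i) (F i))) \<le> ?\<kappa> / 4 * (\<Sum>i<N. Re (ip lborel (G i) (G i))) + ?X / ?\<kappa>"
  proof (rule limit)
    fix n
    show "norm (\<Sum>i<N. LINT a|lborel. ip lborel (F i) (tw a (bump n)) * cnj (F i a))
      \<le> ?\<kappa> / 4 * (\<Sum>i<N. Re (ip lborel (G i) (G i))) + ?X / ?\<kappa>"
      by (rule pairing_bound[where K = "Kp n"])
        (use S T F G FS GT Kp_measurable Kp_bound besselF \<kappa> adm in \<open>auto simp: related_def F_def G_def\<close>)
  qed (rule F)
  have 2: "?\<kappa> * (\<Sum>i<N. Re (ip lborel (G i) (G i))) \<le> ?\<kappa> / 4 * (\<Sum>i<N. Re (ip lborel (F i) (F i))) + ?X / ?\<kappa>"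
  proof (rule limit)
    fix n
    have "norm (\<Sum>i<N. LINT a|lborel. ip lborel (G i) (tw a (bump n)) * cnj (G i a))
      \<le> ?\<kappa> / 4 * (\<Sum>i<N. Re (ip lborel (F i) (F i))) + C\<^sup>2 * measure lborel T * measure lborel S / ?\<kappa>"
      by (rule pairing_bound[where K = "Km n"])
        (use S T F G FS GT Km_measurable Km_bound besselG \<kappa> adm in \<open>auto simp: related_def F_def G_def\<close>)
    then show "norm (\<Sum>i<N. LINT a|lborel. ip lborel (G i) (tw a (bump n)) * cnj (G i a))
      \<le> ?\<kappa> / 4 * (\<Sum>i<N. Re (ip lborel (F i) (F i))) + ?X / ?\<kappa>" by (simp add: mult.commute mult.left_commute)
  qed (rule G)
  have tot: "(\<Sum>i<N. Re (ip lborel (F i) (F i))) + (\<Sum>i<N. Re (ip lborel (G i) (G i))) = real N"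
  proof -
    have "Re (ip lborel (F i) (F i)) + Re (ip lborel (G i) (G i)) = 1" if "i < N" for i
    proof -
      have "pair_ip (e i) (e i) = 1" using e that by (simp add: pair.orthonormal_def)
      then have "Re (pair_ip (e i) (e i)) = 1" by simp
      then show ?thesis by (simp add: pair_ip_def F_def G_def)
    qed
    then show ?thesis by (simp add: sum.distrib[symmetric])
  qed
  have FG: "0 \<le> (\<Sum>i<N. Re (ip lborel (F i) (F i)))" "0 \<le> (\<Sum>i<N. Re (ip lborel (G i) (G i)))"
    by (intro sum_nonneg; use F G sqint.nonneg in auto)+
  have "?\<kappa> * real N \<le> ?\<kappa> / 4 * real N + 2 * (?X / ?\<kappa>)"
    using 1 2 unfolding tot[symmetric] by (simp add: algebra_simps)
  then have "?\<kappa> * real N * ?\<kappa> \<le> (?\<kappa> / 4 * real N + 2 * (?X / ?\<kappa>)) * ?\<kappa>"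
    using \<kappa> by (intro mult_right_mono) auto
  also have "\<dots> = ?\<kappa>\<^sup>2 * real N / 4 + 2 * ?X"
    using \<kappa> by (simp add: power2_eq_square field_simps)
  finally have "3 * (real N * ?\<kappa>\<^sup>2) \<le> 8 * ?X" by (simp add: power2_eq_square field_simps)
  moreover have "0 \<le> ?X" by (intro mult_nonneg_nonneg) auto
  ultimately have "real N * ?\<kappa>\<^sup>2 \<le> 4 * ?X" by linarith
  then show ?thesis using \<kappa> by (simp add: field_simps)
qed

text \<open>
  The strict inequalities leave room for enlarging \<open>S\<close> and \<open>T\<close> by small
  translates.
\<close>

definition dimension_at_least :: "real \<Rightarrow> nat \<Rightarrow> bool" where
  "dimension_at_least A N \<longleftrightarrow> (\<exists>S T e. S \<in> sets borel \<and> T \<in> sets borel \<and>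
     emeasure lborel S < ennreal A \<and> emeasure lborel T < ennreal A \<and> pair.orthonormal N e \<and>
     (\<forall>i<N. related (e i) \<and> supported S T (e i)))"

lemma dimension_at_least_bound:
  assumes "dimension_at_least A N"
  shows "real N \<le> 4 * (C\<^sup>2 * A * A) / (gauss_mass TYPE('a))\<^sup>2"
proof -
  obtain S T e where *: "S \<in> sets borel" "T \<in> sets borel"
     "emeasure lborel S < ennreal A" "emeasure lborel T < ennreal A" "pair.orthonormal N e"
     "\<And>i. i < N \<Longrightarrow> related (e i) \<and> supported S T (e i)"
    using assms unfolding dimension_at_least_def by blast
  have fin: "emeasure lborel S < \<infinity>" "emeasure lborel T < \<infinity>"
    using *(3,4) by (auto intro: order_less_trans)
  have m: "measure lborel S \<le> A" "measure lborel T \<le> A"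
    using *(3,4) fin by (auto simp: emeasure_eq_ennreal_measure ennreal_less_iff)
  have A: "0 \<le> A" using m(1) measure_nonneg order_trans by blast
  have "real N \<le> 4 * (C\<^sup>2 * measure lborel S * measure lborel T) / (gauss_mass TYPE('a))\<^sup>2"
    by (rule dimension_bound[OF *(1) fin(1) *(2) fin(2) *(5,6)])
  also have "\<dots> \<le> 4 * (C\<^sup>2 * A * A) / (gauss_mass TYPE('a))\<^sup>2"
    using m A by (intro divide_right_mono mult_left_mono mult_mono) auto
  finally show ?thesis .
qed

lemma emeasure_Un_shift_less:
  fixes S :: "'a set"
  assumes S: "S \<in> sets borel" "emeasure lborel S < ennreal A"
  shows "\<exists>\<delta>>0. \<forall>b. norm b < \<delta> \<longrightarrow> emeasure lborel (S \<union> {z. z + - b \<in> S}) < ennreal A"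
proof -
  have fin: "emeasure lborel S < \<infinity>" using S(2) by (auto intro: order_less_trans)
  define s where "s = measure lborel S"
  have s: "emeasure lborel S = ennreal s" "0 \<le> s" using fin by (auto simp: s_def emeasure_eq_ennreal_measure)
  have sA: "s < A" using S(2) s by (simp add: ennreal_less_iff)
  obtain \<delta> where \<delta>: "0 < \<delta>" "\<And>h. norm h < \<delta> \<Longrightarrow> emeasure lborel {x \<in> S. x + h \<notin> S} < ennreal (A - s)"
    using emeasure_shift_escape_small[OF S(1) fin, of "A - s"] sA by auto
  have "emeasure lborel (S \<union> {z. z + - b \<in> S}) < ennreal A" if b: "norm b < \<delta>" for b
  proof -
    let ?Y = "{x \<in> S. x + b \<notin> S}"
    have Y: "?Y \<in> sets borel"
    proof -
      have "?Y = S - {x. x + b \<in> S}" by auto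
      then show ?thesis using S(1) borel_shift[OF S(1), of b] by auto
    qed
    \<comment> \<open>The part of the translate outside \<open>S\<close> comes from the points that leave \<open>S\<close>.\<close>
    have "S \<union> {z. z + - b \<in> S} = S \<union> {z. z + - b \<in> ?Y}" by auto
    then have "emeasure lborel (S \<union> {z. z + - b \<in> S}) \<le> emeasure lborel S + emeasure lborel {z. z + - b \<in> ?Y}"
      using S(1) borel_shift[OF Y, of "- b"] by (simp only:) (intro emeasure_subadditive, auto)
    also have "\<dots> = ennreal s + emeasure lborel ?Y" unfolding s emeasure_lborel_shift[OF Y] ..
    also have "\<dots> < ennreal s + ennreal (A - s)"
      using \<delta>(2)[OF b] by (intro ennreal_add_left_cancel_less[THEN iffD2]) auto
    also have "\<dots> = ennreal A" using s sA by (simp flip: ennreal_plus)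
    finally show ?thesis .
  qed
  with \<delta>(1) show ?thesis by blast
qed

lemma pair_ip_self_zero:
  assumes h: "h \<in> pair_space" and z: "Re (pair_ip h h) = 0"
  shows "AE z in lborel. left_part h z = 0" "AE z in lborel. right_part h z = 0"
proof -
  have s: "left_part h \<in> sqint lborel" "right_part h \<in> sqint lborel" using h by (auto simp: pair_space_def)
  have "Re (ip lborel (left_part h) (left_part h)) = 0" "Re (ip lborel (right_part h) (right_part h)) = 0"
    using z sqint.nonneg[OF s(1)] sqint.nonneg[OF s(2)] by (auto simp: pair_ip_def)
  then show "AE z in lborel. left_part h z = 0" "AE z in lborel. right_part h z = 0"
    using s by (simp_all add: ip_self_zero_iff)
qed

text \<open>
  A small twisted translate of \<open>k\<close> is supported in \<open>S\<close> and
  \<open>T\<close> enlarged by their translates, whose measures are still below \<open>A\<close>. If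
  it had a residual, the orthonormal system could be extended, against maximality. So it is a
  combination of the \<open>e i\<close>, which are supported in \<open>S\<close> and
  \<open>T\<close> themselves.
\<close>

lemma small_translation_invariance:
  assumes S: "S \<in> sets borel" "emeasure lborel S < ennreal A" and T: "T \<in> sets borel" "emeasure lborel T < ennreal A"
    and e: "pair.orthonormal N e" and adm: "\<And>i. i < N \<Longrightarrow> related (e i) \<and> supported S T (e i)"
    and maximal: "\<not> dimension_at_least A (Suc N)"
  shows "\<exists>\<delta>>0. \<forall>b k. norm b < \<delta> \<longrightarrow> related k \<longrightarrow> supported S T k \<longrightarrow> supported S T (tw2 b k)"
proof -
  obtain \<delta>1 where \<delta>1: "0 < \<delta>1" "\<And>b. norm b < \<delta>1 \<Longrightarrow> emeasure lborel (S \<union> {z. z + - b \<in> S}) < ennreal A"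
    using emeasure_Un_shift_less[OF S] by blast
  obtain \<delta>2 where \<delta>2: "0 < \<delta>2" "\<And>b. norm b < \<delta>2 \<Longrightarrow> emeasure lborel (T \<union> {z. z + - b \<in> T}) < ennreal A"
    using emeasure_Un_shift_less[OF T] by blast
  have "supported S T (tw2 b k)" if b: "norm b < min \<delta>1 \<delta>2" and k: "related k" "supported S T k" for b k
  proof -
    let ?S = "S \<union> {z. z + - b \<in> S}" and ?T = "T \<union> {z. z + - b \<in> T}"
    let ?k = "tw2 b k"
    have kr: "related ?k" and ks: "supported ?S ?T ?k"
      using related_tw2[OF k(1)] supported_mono[OF supported_tw2[OF k(2)]] by auto
    have kV: "?k \<in> pair_space" using kr by (simp add: related_def)
    let ?p = "\<lambda>x. \<Sum>i<N. pair_ip ?k (e i) * e i x"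
    have p: "related ?p" "supported S T ?p"
      using related_sum[of "{..<N}" e S T "\<lambda>i. pair_ip ?k (e i)"] adm by auto
    have res: "pair.residual N e ?k = (\<lambda>x. (- 1) * ?p x + ?k x)"
      by (simp add: pair.residual_def fun_eq_iff)
    have rr: "related (pair.residual N e ?k)"
      unfolding res by (rule related_lin[OF p(1) kr])
    have rs: "supported ?S ?T (pair.residual N e ?k)"
      unfolding res by (rule supported_lin[OF supported_mono[OF p(2)] ks]) auto
    have rV: "pair.residual N e ?k \<in> pair_space" using rr by (simp add: related_def)
    have "Re (pair_ip (pair.residual N e ?k) (pair.residual N e ?k)) = 0"
    proof (rule ccontr)
      assume "Re (pair_ip (pair.residual N e ?k) (pair.residual N e ?k)) \<noteq> 0"
      then obtain c where c: "pair.orthonormal (Suc N) (e(N := (\<lambda>x. c * pair.residual N e ?k x)))"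
        using pair.orthonormal_extend[OF e kV] by blast
      have new: "related (\<lambda>x. c * pair.residual N e ?k x)" "supported ?S ?T (\<lambda>x. c * pair.residual N e ?k x)"
        using related_lin[OF rr related_zero, of c] supported_lin[OF rs supported_zero, of c] by simp_all
      have "dimension_at_least A (Suc N)"
        unfolding dimension_at_least_def
      proof (intro exI conjI allI impI)
        show "?S \<in> sets borel" "?T \<in> sets borel" using S T borel_shift by auto
        show "emeasure lborel ?S < ennreal A" "emeasure lborel ?T < ennreal A"
          using \<delta>1(2) \<delta>2(2) b by auto
        show "pair.orthonormal (Suc N) (e(N := (\<lambda>x. c * pair.residual N e ?k x)))" by (rule c)
        fix i assume "i < Suc N"
        then show "related ((e(N := (\<lambda>x. c * pair.residual N e ?k x))) i)"
          "supported ?S ?T ((e(N := (\<lambda>x. c * pair.residual N e ?k x))) i)"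
          using new adm[of i] supported_mono[of S T "e i" ?S ?T] by (auto simp: less_Suc_eq)
      qed
      with maximal show False by blast
    qed
    note zero = pair_ip_self_zero[OF rV this]
    have "AE z in lborel. left_part ?k z = left_part ?p z" "AE z in lborel. right_part ?k z = right_part ?p z"
      using zero unfolding res by (auto simp: left_part_def right_part_def)
    then show ?thesis using p(2) unfolding supported_def by (auto elim: AE_mp)
  qed
  then show ?thesis using \<delta>1(1) \<delta>2(1) by (intro exI[of _ "min \<delta>1 \<delta>2"]) auto
qed

lemma norm_tw2_iterate:
  "norm (left_part ((tw2 b ^^ k) h) z) = norm (left_part h (z - real k *\<^sub>R b))"
  "norm (right_part ((tw2 b ^^ k) h) z) = norm (right_part h (z - real k *\<^sub>R b))"
  by (induction k arbitrary: z) (simp_all add: tw2_def algebra_simps)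

lemma tw2_iterate_zero_iff:
  "left_part ((tw2 b ^^ k) h) z = 0 \<longleftrightarrow> left_part h (z - real k *\<^sub>R b) = 0"
  "right_part ((tw2 b ^^ k) h) z = 0 \<longleftrightarrow> right_part h (z - real k *\<^sub>R b) = 0"
  using arg_cong[OF norm_tw2_iterate(1)[of k b h z], of "\<lambda>x. x = 0"]
    arg_cong[OF norm_tw2_iterate(2)[of k b h z], of "\<lambda>x. x = 0"] by simp_all

text \<open>
  A nonzero pair makes the dimension at least \<open>1\<close> for some \<open>A\<close>; the
  dimension is bounded, so a maximal one exists. Its space is invariant under small twisted
  translations, hence under their iterates, and these would keep a nonzero function inside a set of
  finite measure.
\<close>

theorem related_finite_support_zero:
  assumes h: "related h" "supported S T h"
    and S: "S \<in> sets borel" "emeasure lborel S < \<infinity>" and T: "T \<in> sets borel" "emeasure lborel T < \<infinity>"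
  shows "Re (pair_ip h h) = 0"
proof (rule ccontr)
  assume nz: "Re (pair_ip h h) \<noteq> 0"
  have hV: "h \<in> pair_space" using h by (simp add: related_def)
  define A where "A = measure lborel S + measure lborel T + 1"
  have A: "emeasure lborel S < ennreal A" "emeasure lborel T < ennreal A"
  proof -
    have em: "emeasure lborel S = ennreal (measure lborel S)" "emeasure lborel T = ennreal (measure lborel T)"
      using S T by (simp_all add: emeasure_eq_ennreal_measure)
    have "0 \<le> measure lborel S" "0 \<le> measure lborel T" by (rule measure_nonneg)+
    then show "emeasure lborel S < ennreal A" "emeasure lborel T < ennreal A"
      unfolding em A_def by (intro ennreal_lessI; linarith)+
  qed
  have o0: "pair.orthonormal 0 (\<lambda>_. h)" by (simp add: pair.orthonormal_def)
  have r0: "pair.residual 0 (\<lambda>_. h) h = h" by (simp add: pair.residual_def)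
  obtain c where c: "pair.orthonormal (Suc 0) ((\<lambda>_. h)(0 := (\<lambda>x. c * h x)))"
    using pair.orthonormal_extend[OF o0 hV] nz unfolding r0 by blast
  have start: "dimension_at_least A 1"
    unfolding dimension_at_least_def
  proof (intro exI conjI allI impI)
    show "pair.orthonormal 1 ((\<lambda>_. h)(0 := (\<lambda>x. c * h x)))" using c by simp
    fix i :: nat assume "i < 1"
    then show "related (((\<lambda>_. h)(0 := (\<lambda>x. c * h x))) i)" "supported S T (((\<lambda>_. h)(0 := (\<lambda>x. c * h x))) i)"
      using related_lin[OF h(1) related_zero, of c] supported_lin[OF h(2) supported_zero, of c] by simp_all
  qed (use S T A in auto)
  \<comment> \<open>If every attained dimension could be raised by one, all of them would be attained, against the bound.\<close>
  obtain N where N: "1 \<le> N" "dimension_at_least A N" "\<not> dimension_at_least A (Suc N)"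
  proof (rule ccontr)
    assume "\<not> thesis"
    then have step: "1 \<le> N \<Longrightarrow> dimension_at_least A N \<Longrightarrow> dimension_at_least A (Suc N)" for N
      using that by blast
    have all: "dimension_at_least A (Suc N)" for N
      by (induction N) (use start step in auto)
    obtain N :: nat where "4 * (C\<^sup>2 * A * A) / (gauss_mass TYPE('a))\<^sup>2 < real N"
      using reals_Archimedean2 by blast
    with dimension_at_least_bound[OF all[of N]] show False by simp
  qed
  obtain S' T' e where e: "S' \<in> sets borel" "T' \<in> sets borel"
     "emeasure lborel S' < ennreal A" "emeasure lborel T' < ennreal A" "pair.orthonormal N e"
     "\<And>i. i < N \<Longrightarrow> related (e i) \<and> supported S' T' (e i)"
    using N(2) unfolding dimension_at_least_def by blast
  obtain \<delta> where \<delta>: "0 < \<delta>" "\<And>b k. norm b < \<delta> \<Longrightarrow> related k \<Longrightarrow> supported S' T' k \<Longrightarrow> supported S' T' (tw2 b k)"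
    using small_translation_invariance[OF e(1,3,2,4,5,6) N(3)] by blast
  obtain u :: 'a where u: "u \<in> Basis" using nonempty_Basis by blast
  define b where "b = (\<delta> / 2) *\<^sub>R u"
  have b: "norm b < \<delta>" "b \<noteq> 0" using u \<delta>(1) by (auto simp: b_def nonzero_Basis)
  let ?h = "e 0"
  have h0: "related ?h" "supported S' T' ?h" using e(6)[of 0] N(1) by auto
  have iter: "related ((tw2 b ^^ k) ?h) \<and> supported S' T' ((tw2 b ^^ k) ?h)" for k
    by (induction k) (use h0 \<delta>(2)[OF b(1)] related_tw2 in auto)
  have fin: "emeasure lborel S' < \<infinity>" "emeasure lborel T' < \<infinity>"
    using e(3,4) by (auto intro: order_less_trans)
  have m: "left_part ?h \<in> borel_measurable borel" "right_part ?h \<in> borel_measurable borel"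
    using h0(1) by (auto simp: related_def pair_space_def sqint_def)
  have "AE z in lborel. left_part ?h z = 0"
  proof (rule translates_in_finite_measure_set_zero[OF m(1) e(1) fin(1) b(2)])
    show "AE z in lborel. z \<notin> S' \<longrightarrow> left_part ?h (z - real k *\<^sub>R b) = 0" for k
      using iter[of k] by (simp add: supported_def tw2_iterate_zero_iff)
  qed
  moreover have "AE z in lborel. right_part ?h z = 0"
  proof (rule translates_in_finite_measure_set_zero[OF m(2) e(2) fin(2) b(2)])
    show "AE z in lborel. z \<notin> T' \<longrightarrow> right_part ?h (z - real k *\<^sub>R b) = 0" for k
      using iter[of k] by (simp add: supported_def tw2_iterate_zero_iff)
  qed
  ultimately have "pair_ip ?h ?h = 0"
    using h0(1) ip_self_zero_iff[of "left_part ?h" lborel] ip_self_zero_iff[of "right_part ?h" lborel]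
      sqint.self_real[of "left_part ?h" lborel] sqint.self_real[of "right_part ?h" lborel]
    by (simp add: pair_ip_def related_def pair_space_def)
  moreover have "pair_ip ?h ?h = 1" using e(5) N(1) by (simp add: pair.orthonormal_def)
  ultimately show False by simp
qed

end

section \<open>The uncertainty principle for the special Hermite flow\<close>

lemma twisted_translation_twist: "twisted_translation (twist lam :: complex ^ 'd::finite \<Rightarrow> complex ^ 'd)"
proof
  fix x y :: "complex ^ 'd" and r :: real
  show "twist lam (x + y) = twist lam x + twist lam y"
    by (simp add: twist_def vec_eq_iff algebra_simps)
  show "twist lam (r *\<^sub>R x) = r *\<^sub>R twist lam x"
    by (simp add: twist_def vec_eq_iff scaleR_conv_of_real)
  show "x \<bullet> twist lam y = - (y \<bullet> twist lam x)"
    by (simp add: inner_vec_complex twist_def sum_negf[symmetric] algebra_simps)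
qed

lemma twist_0 [simp]: "twist lam 0 = 0"
  by (simp add: twist_def vec_eq_iff)

lemma flow_eq_tw: "flow lam \<alpha> a s = twisted_translation.tw (twist lam) a (flow lam \<alpha> 0 s)"
  by (simp add: flow_def wave_def twisted_translation.tw_def[OF twisted_translation_twist] fun_eq_iff
      exp_add exp_diff exp_minus field_simps)

text \<open>
  The initial width \<open>\<alpha> = (n + 1)\<^sup>2\<close> makes the amplitude \<open>\<alpha> ^
  d\<close> equal to \<open>n + 1\<close> to the power of the real dimension \<open>2 d\<close>.
\<close>

lemma flow_0_eq_bump:
  assumes "lam \<noteq> 0"
  shows "flow lam ((real (Suc n))\<^sup>2) (0 :: complex ^ 'd::finite) 0 = bump n"
  using assms
  by (simp add: flow_def wave_def fun_eq_iff bump_def osc_def osc'_def width_def amplitude_def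
      exp_of_real[symmetric] power_mult[symmetric] mult.commute[of 2] del: of_nat_Suc)

text \<open>
  The modulus of \<open>osc\<close> is at least \<open>4 \<alpha> |sin (lam * t)| / |lam|\<close>,
  so the factor \<open>\<alpha> ^ d\<close> of the amplitude cancels and the bound is uniform as the
  initial Gaussian concentrates.
\<close>

lemma norm_flow_le:
  fixes v :: "complex ^ 'd::finite"
  assumes lam: "lam \<noteq> 0" and \<alpha>: "0 < \<alpha>" and t: "sin (lam * t) \<noteq> 0"
  shows "norm (flow lam \<alpha> 0 t v) \<le> (\<bar>lam\<bar> / (4 * \<bar>sin (lam * t)\<bar>)) ^ CARD('d)"
proof -
  have "(4 * \<alpha> / \<bar>lam\<bar> * \<bar>sin (lam * t)\<bar>)\<^sup>2 \<le> (norm (osc lam \<alpha> t))\<^sup>2"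
    unfolding norm_osc_square by (simp add: power_mult_distrib power_divide)
  then have o: "4 * \<alpha> / \<bar>lam\<bar> * \<bar>sin (lam * t)\<bar> \<le> norm (osc lam \<alpha> t)"
    by (rule power2_le_imp_le) simp
  have pos: "0 < 4 * \<alpha> / \<bar>lam\<bar> * \<bar>sin (lam * t)\<bar>" using lam \<alpha> t by simp
  have "\<alpha> / norm (osc lam \<alpha> t) \<le> \<alpha> / (4 * \<alpha> / \<bar>lam\<bar> * \<bar>sin (lam * t)\<bar>)"
    by (rule divide_left_mono[OF o _ mult_pos_pos[OF less_le_trans[OF pos o] pos]]) (use \<alpha> in simp)
  also have "\<dots> = \<bar>lam\<bar> / (4 * \<bar>sin (lam * t)\<bar>)" using lam \<alpha> t by (simp add: field_simps)
  finally have q: "\<alpha> / norm (osc lam \<alpha> t) \<le> \<bar>lam\<bar> / (4 * \<bar>sin (lam * t)\<bar>)" .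
  have "norm (amplitude CARD('d) lam \<alpha> t) = (\<alpha> / norm (osc lam \<alpha> t)) ^ CARD('d)"
    using \<alpha> by (simp add: amplitude_def norm_power norm_divide)
  also have "\<dots> \<le> (\<bar>lam\<bar> / (4 * \<bar>sin (lam * t)\<bar>)) ^ CARD('d)"
    using q \<alpha> by (intro power_mono) auto
  finally have amp: "norm (amplitude CARD('d) lam \<alpha> t) \<le> (\<bar>lam\<bar> / (4 * \<bar>sin (lam * t)\<bar>)) ^ CARD('d)" .
  have "norm (flow lam \<alpha> 0 t v) \<le> norm (amplitude CARD('d) lam \<alpha> t) * 1"
    unfolding flow_def norm_wave using Re_width_pos[OF lam \<alpha>, of t]
    by (intro mult_left_mono) (auto intro!: mult_nonneg_nonneg)
  with amp show ?thesis by linarith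
qed

lemma borel_representative:
  fixes f :: "'a::euclidean_space \<Rightarrow> complex"
  assumes f: "f \<in> L2"
  obtains f' where "f' \<in> sqint lborel" "AE z in lebesgue. f z = f' z"
proof -
  have fm: "f \<in> borel_measurable lebesgue" using f by (simp add: L2_def)
  have r: "(\<lambda>z. Re (f z)) \<in> borel_measurable lebesgue" "(\<lambda>z. Im (f z)) \<in> borel_measurable lebesgue"
    using fm by (simp_all add: borel_measurable_complex_iff)
  obtain g where g: "g \<in> borel_measurable lborel" "AE z in lborel. Re (f z) = g z"
    using completion_ex_borel_measurable_real[OF r(1)] by blast
  obtain h where h: "h \<in> borel_measurable lborel" "AE z in lborel. Im (f z) = h z"
    using completion_ex_borel_measurable_real[OF r(2)] by blast
  let ?f = "\<lambda>z. Complex (g z) (h z)"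
  have m: "?f \<in> borel_measurable lborel"
    using g h by (simp add: borel_measurable_complex_iff)
  have "AE z in lborel. f z = ?f z"
    using g(2) h(2) by eventually_elim (simp add: complex_eq_iff)
  then have ae: "AE z in lebesgue. f z = ?f z" by (rule AE_completion)
  have ml: "?f \<in> borel_measurable lebesgue" using m by (intro borel_measurable_lebesgueI) simp
  have "integrable lebesgue (\<lambda>z. (norm (?f z))\<^sup>2)"
  proof (rule integrable_cong_AE_imp)
    show "integrable lebesgue (\<lambda>z. (norm (f z))\<^sup>2)" using f by (simp add: L2_def)
    show "(\<lambda>z. (norm (?f z))\<^sup>2) \<in> borel_measurable lebesgue"
      by (rule borel_measurable_power[OF measurable_compose[OF ml borel_measurable_norm]])
    show "AE z in lebesgue. (norm (f z))\<^sup>2 = (norm (?f z))\<^sup>2" using ae by eventually_elim simp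
  qed
  then have "integrable lborel (\<lambda>z. (norm (?f z))\<^sup>2)"
    by (rule integrable_completion[THEN iffD1, OF borel_measurable_power[OF measurable_compose[OF m borel_measurable_norm]]])
  then show thesis using that[of ?f] m ae by (simp add: sqint_def)
qed

lemma L2_inner_eq_ip_lborel:
  assumes "f \<in> L2" "f' \<in> sqint lborel" "AE z in lebesgue. f z = f' z" "w \<in> sqint lborel"
  shows "L2_inner f w = ip lborel f' w"
proof -
  have m: "f' \<in> borel_measurable borel" "w \<in> borel_measurable borel" using assms by (auto simp: sqint_def)
  have "L2_inner f w = ip lebesgue f' w"
    unfolding L2_inner_eq_ip
    by (rule ip_cong) (use assms m in \<open>auto simp: L2_def intro: borel_measurable_lebesgueI\<close>)
  also have "\<dots> = ip lborel f' w"
    unfolding ip_def using m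
    by (intro integral_completion) (simp add: borel_measurable_times borel_measurable_cnj)
  finally show ?thesis .
qed

theorem corollary1p3:
  fixes lam :: real
    and E \<Omega> :: "(complex ^ 'd::finite) set"
    and u0 :: "complex ^ 'd \<Rightarrow> complex"
    and u :: "real \<Rightarrow> complex ^ 'd \<Rightarrow> complex"
  assumes "lam \<noteq> 0"
    and "E \<in> sets lebesgue" and "0 < emeasure lebesgue E" and "emeasure lebesgue E < \<infinity>"
    and "\<Omega> \<in> sets lebesgue" and "0 < emeasure lebesgue \<Omega>" and "emeasure lebesgue \<Omega> < \<infinity>"
    and "u0 \<in> L2"
    and "schroedinger_solution lam u0 u"
    and "\<exists>t>0. (\<forall>k::int. lam * t \<noteq> pi * real_of_int k) \<and>
           (AE z in lebesgue. z \<notin> E \<longrightarrow> u0 z = 0) \<and>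
           (AE z in lebesgue. z \<notin> \<Omega> \<longrightarrow> u t z = 0)"
  shows "\<forall>s\<ge>0. AE z in lebesgue. u s z = 0"
proof -
  obtain t where t: "0 < t" "\<And>k::int. lam * t \<noteq> pi * real_of_int k"
    and u0E: "AE z in lebesgue. z \<notin> E \<longrightarrow> u0 z = 0"
    and ut\<Omega>: "AE z in lebesgue. z \<notin> \<Omega> \<longrightarrow> u t z = 0"
    using assms(10) by blast
  have sin: "sin (lam * t) \<noteq> 0"
    using t(2) by (auto simp: sin_zero_iff_int2 mult.commute)
  have sol: "(u0, u s) \<in> functional_calculus (special_hermite lam)
      (\<lambda>x. exp (- \<i> * complex_of_real s * complex_of_real x))" if "0 \<le> s" for s
    using assms(9) that by (simp add: schroedinger_solution_def)
  have ut: "u t \<in> L2" using sol[of t] t(1) by (auto simp: functional_calculus_def spectral_integral_def)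
  obtain f where f: "f \<in> sqint lborel" "AE z in lebesgue. u0 z = f z"
    using borel_representative[OF assms(8)] .
  obtain g where g: "g \<in> sqint lborel" "AE z in lebesgue. u t z = g z"
    using borel_representative[OF ut] .
  let ?\<alpha> = "\<lambda>n. (real (Suc n))\<^sup>2"
  let ?Kp = "\<lambda>n. flow lam (?\<alpha> n) (0 :: complex ^ 'd) t"
  let ?Km = "\<lambda>n. flow lam (?\<alpha> n) (0 :: complex ^ 'd) (- t)"
  let ?C = "(\<bar>lam\<bar> / (4 * \<bar>sin (lam * t)\<bar>)) ^ CARD('d)"
  have \<alpha>: "0 < ?\<alpha> n" for n by simp
  have K: "flow lam (?\<alpha> n) (0 :: complex ^ 'd) s \<in> sqint lborel" for n s
    by (rule flow_sqint[OF assms(1) \<alpha>])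
  interpret kernel_pair "twist lam :: complex ^ 'd \<Rightarrow> complex ^ 'd" ?Kp ?Km ?C
  proof (intro kernel_pair.intro kernel_pair_axioms.intro twisted_translation_twist K)
    show "?Kp n \<in> borel_measurable borel" "?Km n \<in> borel_measurable borel" for n
      using K[of n t] K[of n "- t"] by (auto simp: sqint_def)
    show "norm (?Kp n v) \<le> ?C" for n v by (rule norm_flow_le[OF assms(1) \<alpha> sin])
    show "norm (?Km n v) \<le> ?C" for n v
      using norm_flow_le[OF assms(1) \<alpha>, of "- t" n v] sin by simp
  qed
  have pairing: "ip lborel g (flow lam (?\<alpha> n) a (\<tau> + t)) = ip lborel f (flow lam (?\<alpha> n) a \<tau>)" for n a \<tau>
    using solution_pairing_flow[OF assms(1) \<alpha> less_imp_le[OF t(1)] sol[OF less_imp_le[OF t(1)]], of n a \<tau>]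
      L2_inner_eq_ip_lborel[OF assms(8) f flow_sqint[OF assms(1) \<alpha>], of n a \<tau>]
      L2_inner_eq_ip_lborel[OF ut g flow_sqint[OF assms(1) \<alpha>], of n a "\<tau> + t"] by simp
  have bump: "flow lam (?\<alpha> n) a 0 = tw a (bump n)" for n and a :: "complex ^ 'd"
    using flow_eq_tw[of lam "?\<alpha> n" a 0] flow_0_eq_bump[OF assms(1), of n, where 'd = 'd] by simp
  let ?h = "case_sum f g"
  have rel: "related ?h"
    unfolding related_def part_case_sum
  proof (intro conjI allI)
    show "?h \<in> pair_space" using f g by (simp add: pair_space_def)
    fix n and a :: "complex ^ 'd"
    show "ip lborel f (tw a (bump n)) = ip lborel g (tw a (?Kp n))"
      using pairing[of n a 0] unfolding bump[symmetric] flow_eq_tw[of lam "?\<alpha> n" a t, symmetric] by simp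
    show "ip lborel g (tw a (bump n)) = ip lborel f (tw a (?Km n))"
      using pairing[of n a "- t"] unfolding bump[symmetric] flow_eq_tw[of lam "?\<alpha> n" a "- t", symmetric] by simp
  qed
  define S where "S = {z. f z \<noteq> 0}"
  define T where "T = {z. g z \<noteq> 0}"
  have supp: "{z. k z \<noteq> 0} \<in> sets borel \<and> emeasure lborel {z. k z \<noteq> 0} < \<infinity>"
    if k: "k \<in> sqint lborel" and W: "W \<in> sets lebesgue" "emeasure lebesgue W < \<infinity>"
      and z: "AE z in lebesgue. z \<notin> W \<longrightarrow> k z = 0" for k :: "complex ^ 'd \<Rightarrow> complex" and W
  proof
    have km: "k \<in> borel_measurable borel" using k by (simp add: sqint_def)
    show b: "{z. k z \<noteq> 0} \<in> sets borel"
      using measurable_sets[OF km, of "- {0}"] by (simp add: vimage_def Compl_eq)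
    have "emeasure lborel {z. k z \<noteq> 0} = emeasure lebesgue {z. k z \<noteq> 0}" using b by simp
    also have "\<dots> \<le> emeasure lebesgue W"
      by (rule emeasure_mono_AE) (use z W in \<open>auto elim: AE_mp\<close>)
    also note W(2)
    finally show "emeasure lborel {z. k z \<noteq> 0} < \<infinity>" .
  qed
  have fE: "AE z in lebesgue. z \<notin> E \<longrightarrow> f z = 0" using u0E f(2) by eventually_elim auto
  have g\<Omega>: "AE z in lebesgue. z \<notin> \<Omega> \<longrightarrow> g z = 0" using ut\<Omega> g(2) by eventually_elim auto
  have S: "S \<in> sets borel" "emeasure lborel S < \<infinity>"
    unfolding S_def using supp[OF f(1) assms(2,4) fE] by auto
  have T: "T \<in> sets borel" "emeasure lborel T < \<infinity>"
    unfolding T_def using supp[OF g(1) assms(5,7) g\<Omega>] by auto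
  have "supported S T ?h" by (simp add: supported_def S_def T_def)
  then have "Re (pair_ip ?h ?h) = 0"
    by (rule related_finite_support_zero[OF rel _ S T])
  then have "AE z in lborel. f z = 0"
    using pair_ip_self_zero(1)[of ?h] f g by (simp add: pair_space_def)
  then have "AE z in lebesgue. f z = 0" by (rule AE_completion)
  with f(2) have u00: "AE z in lebesgue. u0 z = 0" by eventually_elim simp
  show ?thesis
  proof (intro allI impI)
    fix s :: real assume "0 \<le> s"
    from sol[OF this] obtain P where P: "projection_valued_measure P"
      "(u0, u s) \<in> spectral_integral P (\<lambda>x. exp (- \<i> * complex_of_real s * complex_of_real x))"
      by (auto simp: functional_calculus_def spectral_resolution_def)
    interpret pvm P by unfold_locales (rule P)
    show "AE z in lebesgue. u s z = 0" by (rule spectral_integral_zero[OF P(2) u00])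
  qed
qed

end
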